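(* Let $w$ be a (periodic) compound Poisson noise on $\mathbb{T}^d$. Then, for every $\tau\in\mathbb{R}$ and $0<p,q\leq\infty$ such that $$\tau<d\left(\frac1p-1\right),$$ we have $w\in B_{p,q}^{\tau}(\mathbb{T}^d)$ almost surely.
   Context: $\mathbb{T}^d=\mathbb{R}^d/\mathbb{Z}^d$ with Lebesgue measure $\lambda$ normalized by $\lambda(\mathbb{T}^d)=1$. $\mathcal{S}(\mathbb{T}^d)$ is the space of smooth periodic (real-valued) functions, $\mathcal{S}'(\mathbb{T}^d)$ its topological dual, $\langle u,\varphi\rangle$ the (bilinear) duality product. The cylindrical $\sigma$-field $\mathcal{B}_c(\mathcal{S}'(\mathbb{T}^d))$ is generated by the sets $\{u : (\langle u,\varphi_1\rangle,\dots,\langle u,\varphi_N\rangle)\in B\}$ with $N\in\mathbb{N}$, $\varphi_i\in\mathcal{S}(\mathbb{T}^d)$, $B\subset\mathbb{R}^N$ Borel. A generalized periodic process is a measurable map $s$ from a probability space $(\Omega,\mathcal{F},\mathscr{P})$ to $(\mathcal{S}'(\mathbb{T}^d),\mathcal{B}_c(\mathcal{S}'(\mathbb{T}^d)))$; its characteristic functional is $\widehat{\mathscr{P}}_s(\varphi)=\mathbb{E}[e^{\mathrm{i}\langle s,\varphi\rangle}]$, $\varphi\in\mathcal{S}(\mathbb{T}^d)$. A compound Poisson noise is a generalized periodic process $w$ with characteristic functional, for $\varphi\in\mathcal{S}(\mathbb{T}^d)$, $$\widehat{\mathscr{P}}_w(\varphi)=\exp\left(c\int_{\mathbb{T}^d}\int_{\mathbb{R}\setminus\{0\}}\left(e^{\mathrm{i}t\varphi(\mathbf{r})}-1\right)P(\mathrm{d}t)\,\lambda(\mathrm{d}\mathbf{r})\right),$$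 where $c>0$ and $P$ is a probability measure on $\mathbb{R}\setminus\{0\}$. Wavelets: for $u\in\mathbb{N}$, a wavelet system of regularity $u$ is obtained from real compactly supported $\psi_F,\psi_M\in C^u(\mathbb{R})$ (scaling function and orthonormal Daubechies-type wavelet, $\psi_M$ having vanishing moments up to order $u-1$). $G^0=\{F,M\}^d$ and, for $j\geq1$, $G^j$ is the set of $G\in\{F,M\}^d$ with at least one component equal to $M$. $L\in\mathbb{N}$ is fixed large enough that the scale-$0$ wavelets are supported within the torus, $\mathbb{P}_j^d=\{m\in\mathbb{Z}^d : 0\leq m_k<2^{j+L},\ 1\leq k\leq d\}$, and $\Psi_{G,m}^{j,\mathrm{per}}$ is the $\mathbb{Z}^d$-periodization of $2^{(j+L)d/2}\prod_{a=1}^d\psi_{G_a}(2^{j+L}x_a-m_a)$. The family $\{\Psi_{G,m}^{j,\mathrm{per}} : j\in\mathbb{N}_0,\ G\in G^j,\ m\in\mathbb{P}_j^d\}$ is an orthonormal basis of $L_2(\mathbb{T}^d)$. Besov sequence spaces: $b_{p,q}^{\tau,\mathrm{per}}$ is the set of sequences $\lambda=(\lambda_m^{j,G})$ of complex numbers with $$\|\lambda\|_{b_{p,q}^{\tau,\mathrm{per}}}=\Big(\sum_{j\geq0}2^{j(\tau-d/p)q}\sum_{G\in G^j}\Big(\sum_{m\in\mathbb{P}_j^d}|\lambda_m^{j,G}|^p\Big)^{q/p}\Big)^{1/q}<\infty$$ (usual supremum modifications if $p=\infty$ or $q=\infty$; $1/\infty=0$). Besov spaces: $B_{p,q}^{\tau}(\mathbb{T}^d)$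 is the usual periodic Besov space, equivalently (with $(x)_+=\max(x,0)$): choosing a wavelet system of regularity $u>\max(\tau,d(1/p-1)_+-\tau)$, it is the set of $f\in\mathcal{S}'(\mathbb{T}^d)$ that can be written $f=\sum_{j,G,m}\lambda_m^{j,G}2^{-(j+L)d/2}\Psi_{G,m}^{j,\mathrm{per}}$ with $\lambda\in b_{p,q}^{\tau,\mathrm{per}}$ (unconditional convergence in $\mathcal{S}'(\mathbb{T}^d)$); the representation is unique and the space does not depend on the choice of wavelet system. Besov spaces belong to $\mathcal{B}_c(\mathcal{S}'(\mathbb{T}^d))$, so the almost-sure statement is meaningful. *)

theory Defs
  imports "HOL-Probability.Probability"
begin

text \<open>
  The torus \<open>\<real>\<^sup>d / \<int>\<^sup>d\<close> is handled through periodic functions on \<open>real ^ 'd\<close>, with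
  \<open>d = CARD('d)\<close>, and its normalized Lebesgue measure through the fundamental domain \<open>[0,1)\<^sup>d\<close>.
\<close>

section \<open>Test functions and generalized functions on the torus\<close>

definition int_vec :: "int ^ 'd \<Rightarrow> real ^ 'd" where
  "int_vec k = (\<chi> a. of_int (k $ a))"

definition periodic :: "(real ^ 'd \<Rightarrow> 'b) \<Rightarrow> bool" where
  "periodic f \<longleftrightarrow> (\<forall>x k. f (x + int_vec k) = f x)"

definition torus_measure :: "(real ^ 'd::finite) measure" where
  "torus_measure = restrict_space lborel {x. \<forall>a. 0 \<le> x $ a \<and> x $ a < 1}"

definition partial_deriv :: "'d \<Rightarrow> (real ^ 'd::finite \<Rightarrow> real) \<Rightarrow> real ^ 'd \<Rightarrow> real" where
  "partial_deriv a f x = frechet_derivative f (at x) (axis a 1)"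

fun iter_partial :: "'d list \<Rightarrow> (real ^ 'd::finite \<Rightarrow> real) \<Rightarrow> real ^ 'd \<Rightarrow> real" where
  "iter_partial [] f = f"
| "iter_partial (a # as) f = partial_deriv a (iter_partial as f)"

definition smooth :: "(real ^ 'd::finite \<Rightarrow> real) \<Rightarrow> bool" where
  "smooth f \<longleftrightarrow> (\<forall>as x. iter_partial as f differentiable (at x))"

definition test_functions :: "(real ^ 'd::finite \<Rightarrow> real) set" where
  "test_functions = {\<phi>. smooth \<phi> \<and> periodic \<phi>}"

definition test_seminorm :: "nat \<Rightarrow> (real ^ 'd::finite \<Rightarrow> real) \<Rightarrow> real" where
  "test_seminorm N \<phi> = (SUP (as, x) \<in> {as. length as \<le> N} \<times> UNIV. \<bar>iter_partial as \<phi> x\<bar>)"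

definition test_topology :: "(real ^ 'd::finite \<Rightarrow> real) topology" where
  "test_topology = topology_generated_by
     {{\<psi> \<in> test_functions. test_seminorm N (\<lambda>x. \<psi> x - \<phi> x) < \<epsilon>} | N \<phi> \<epsilon>.
        \<phi> \<in> test_functions \<and> \<epsilon> > 0}"

text \<open>
  The topological dual. A functional is a HOL function on all of \<open>real ^ 'd \<Rightarrow> real\<close>;
  extensionality makes it determined by its values on test functions.
\<close>

definition gen_functions :: "((real ^ 'd::finite \<Rightarrow> real) \<Rightarrow> real) set" where
  "gen_functions = {u \<in> extensional test_functions.
     (\<forall>\<phi>\<in>test_functions. \<forall>\<psi>\<in>test_functions. \<forall>a b.
        u (\<lambda>x. a * \<phi> x + b * \<psi> x) = a * u \<phi> + b * u \<psi>) \<and>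
     continuous_map test_topology euclideanreal u}"

section \<open>Generalized periodic processes and compound Poisson noises\<close>

definition cylindrical :: "((real ^ 'd::finite \<Rightarrow> real) \<Rightarrow> real) measure" where
  "cylindrical = sigma gen_functions
     {{u \<in> gen_functions. (\<lambda>i\<in>{..<N}. u (\<phi> i)) \<in> B} | (N::nat) \<phi> B.
        (\<forall>i<N. \<phi> i \<in> test_functions) \<and> B \<in> sets (Pi\<^sub>M {..<N} (\<lambda>_. borel :: real measure))}"

definition gen_periodic_process ::
    "'w measure \<Rightarrow> ('w \<Rightarrow> (real ^ 'd::finite \<Rightarrow> real) \<Rightarrow> real) \<Rightarrow> bool" where
  "gen_periodic_process M s \<longleftrightarrow> prob_space M \<and> s \<in> measurable M cylindrical"

definition char_functional ::
    "'w measure \<Rightarrow> ('w \<Rightarrow> (real ^ 'd::finite \<Rightarrow> real) \<Rightarrow> real) \<Rightarrow> (real ^ 'd \<Rightarrow> real) \<Rightarrow> complex" where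
  "char_functional M s \<phi> = (\<integral>\<omega>. iexp (s \<omega> \<phi>) \<partial>M)"

definition compound_poisson_noise ::
    "'w measure \<Rightarrow> ('w \<Rightarrow> (real ^ 'd::finite \<Rightarrow> real) \<Rightarrow> real) \<Rightarrow> bool" where
  "compound_poisson_noise M w \<longleftrightarrow> gen_periodic_process M w \<and>
     (\<exists>(c::real) (P::real measure).
        c > 0 \<and> prob_space P \<and> sets P = sets (restrict_space borel (- {0})) \<and>
        (\<forall>\<phi>\<in>test_functions. char_functional M w \<phi> =
           exp (of_real c * (\<integral>r. (\<integral>t. iexp (t * \<phi> r) - 1 \<partial>P) \<partial>torus_measure))))"

section \<open>Wavelet systems\<close>

datatype gender = Father | Mother

definition C_k :: "nat \<Rightarrow> (real \<Rightarrow> real) \<Rightarrow> bool" where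
  "C_k k f \<longleftrightarrow> (\<forall>i<k. \<forall>x. (deriv ^^ i) f differentiable (at x)) \<and> continuous_on UNIV ((deriv ^^ k) f)"

definition orthonormal_basis_L2 :: "('i \<Rightarrow> real \<Rightarrow> real) \<Rightarrow> bool" where
  "orthonormal_basis_L2 e \<longleftrightarrow>
     (\<forall>i. e i \<in> borel_measurable lborel \<and> integrable lborel (\<lambda>x. (e i x)\<^sup>2)) \<and>
     (\<forall>i j. (\<integral>x. e i x * e j x \<partial>lborel) = (if i = j then 1 else 0)) \<and>
     (\<forall>g. g \<in> borel_measurable lborel \<longrightarrow> integrable lborel (\<lambda>x. (g x)\<^sup>2) \<longrightarrow>
        (\<forall>i. (\<integral>x. g x * e i x \<partial>lborel) = 0) \<longrightarrow> (AE x in lborel. g x = 0))"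

text \<open>
  The integer translates of the scaling function together with the dyadic dilates and
  translates of the mother wavelet. If this family is an orthonormal basis of \<open>L\<^sub>2(\<real>)\<close>, then
  dilating it by 2 shows that the span \<open>V\<^sub>1\<close> of the half-integer translates of
  \<open>\<psi> Father (2 x)\<close> is the orthogonal sum of the span \<open>V\<^sub>0\<close> of the translates of the scaling
  function and the span \<open>W\<^sub>0\<close> of the translates of the wavelet. The two-scale relations of a
  multiresolution analysis therefore need not be required separately.
\<close>

definition wavelet_family_1d :: "(gender \<Rightarrow> real \<Rightarrow> real) \<Rightarrow> int + nat \<times> int \<Rightarrow> real \<Rightarrow> real" where
  "wavelet_family_1d \<psi> i x = (case i of
       Inl m \<Rightarrow> \<psi> Father (x - of_int m)
     | Inr (j, m) \<Rightarrow> 2 powr (real j / 2) * \<psi> Mother (2 ^ j * x - of_int m))"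

definition wavelet_system :: "nat \<Rightarrow> (gender \<Rightarrow> real \<Rightarrow> real) \<Rightarrow> bool" where
  "wavelet_system u \<psi> \<longleftrightarrow>
     (\<forall>g. C_k u (\<psi> g) \<and> compact (closure {x. \<psi> g x \<noteq> 0})) \<and>
     (\<forall>v<u. (\<integral>x. x ^ v * \<psi> Mother x \<partial>lborel) = 0) \<and>
     orthonormal_basis_L2 (wavelet_family_1d \<psi>)"

definition genders :: "nat \<Rightarrow> ('d \<Rightarrow> gender) set" where
  "genders j = (if j = 0 then UNIV else {G. \<exists>a. G a = Mother})"

definition positions :: "nat \<Rightarrow> nat \<Rightarrow> (int ^ 'd) set" where
  "positions L j = {m. \<forall>a. 0 \<le> m $ a \<and> m $ a < 2 ^ (j + L)}"

definition wavelet ::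
    "(gender \<Rightarrow> real \<Rightarrow> real) \<Rightarrow> nat \<Rightarrow> nat \<Rightarrow> ('d::finite \<Rightarrow> gender) \<Rightarrow> int ^ 'd \<Rightarrow> real ^ 'd \<Rightarrow> real" where
  "wavelet \<psi> L j G m x = 2 powr (real (j + L) * real CARD('d) / 2) *
     (\<Prod>a\<in>UNIV. \<psi> (G a) (2 ^ (j + L) * x $ a - of_int (m $ a)))"

definition wavelet_per ::
    "(gender \<Rightarrow> real \<Rightarrow> real) \<Rightarrow> nat \<Rightarrow> nat \<Rightarrow> ('d::finite \<Rightarrow> gender) \<Rightarrow> int ^ 'd \<Rightarrow> real ^ 'd \<Rightarrow> real" where
  "wavelet_per \<psi> L j G m x = (\<Sum>\<^sub>\<infinity>k\<in>UNIV. wavelet \<psi> L j G m (x + int_vec k))"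

text \<open>
  The scale-0 wavelets are supported within one copy of the torus, i.e. within some translate
  of the closed unit cube.
\<close>

definition scale0_in_torus :: "'d::finite itself \<Rightarrow> (gender \<Rightarrow> real \<Rightarrow> real) \<Rightarrow> nat \<Rightarrow> bool" where
  "scale0_in_torus _ \<psi> L \<longleftrightarrow>
     (\<forall>G::'d \<Rightarrow> gender. \<exists>a. {x. wavelet \<psi> L 0 G 0 x \<noteq> 0} \<subseteq> cbox a (a + 1))"

section \<open>Besov spaces\<close>

text \<open>Only used for positive exponents, so that \<open>\<infinity>\<close> is mapped to \<open>\<infinity>\<close>.\<close>

definition enn_powr :: "ennreal \<Rightarrow> real \<Rightarrow> ennreal" where
  "enn_powr x r = (if x = \<infinity> then \<infinity> else ennreal (enn2real x powr r))"

definition lp_norm :: "ereal \<Rightarrow> 'i set \<Rightarrow> ('i \<Rightarrow> ennreal) \<Rightarrow> ennreal" where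
  "lp_norm p I a =
     (if p = \<infinity> then (SUP i\<in>I. a i)
      else enn_powr (\<Sum>\<^sub>\<infinity>i\<in>I. enn_powr (a i) (real_of_ereal p)) (1 / real_of_ereal p))"

text \<open>For \<open>p = \<infinity>\<close> the value below is 0.\<close>

definition recip :: "ereal \<Rightarrow> real" where
  "recip p = real_of_ereal (1 / p)"

definition besov_seq_norm ::
    "nat \<Rightarrow> real \<Rightarrow> ereal \<Rightarrow> ereal \<Rightarrow> (nat \<Rightarrow> ('d::finite \<Rightarrow> gender) \<Rightarrow> int ^ 'd \<Rightarrow> complex) \<Rightarrow> ennreal" where
  "besov_seq_norm L \<tau> p q c =
     lp_norm q UNIV (\<lambda>j. ennreal (2 powr (real j * (\<tau> - real CARD('d) * recip p))) *
       lp_norm q (genders j) (\<lambda>G. lp_norm p (positions L j) (\<lambda>m. ennreal (norm (c j G m)))))"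

text \<open>
  Unconditional convergence is stated for the weak-* topology of the dual. For countable
  families this agrees with unconditional convergence for the strong dual topology, because
  the test functions form a Montel space.
\<close>

definition wavelet_expansion ::
    "(gender \<Rightarrow> real \<Rightarrow> real) \<Rightarrow> nat \<Rightarrow> (nat \<Rightarrow> ('d::finite \<Rightarrow> gender) \<Rightarrow> int ^ 'd \<Rightarrow> complex) \<Rightarrow>
     ((real ^ 'd \<Rightarrow> real) \<Rightarrow> real) \<Rightarrow> bool" where
  "wavelet_expansion \<psi> L c f \<longleftrightarrow>
     (\<forall>\<phi>\<in>test_functions.
        ((\<lambda>(j, G, m). c j G m * of_real (2 powr (- (real (j + L) * real CARD('d) / 2)) *
            (\<integral>x. wavelet_per \<psi> L j G m x * \<phi> x \<partial>torus_measure)))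
         has_sum of_real (f \<phi>)) {(j, G, m). G \<in> genders j \<and> m \<in> positions L j})"

text \<open>
  The space does not depend on the wavelet system, as long as the regularity is large enough;
  membership is expressed as the expansion property for every admissible system. Daubechies
  wavelets provide systems of arbitrarily large regularity.
\<close>

definition besov_space :: "real \<Rightarrow> ereal \<Rightarrow> ereal \<Rightarrow> ((real ^ 'd::finite \<Rightarrow> real) \<Rightarrow> real) set" where
  "besov_space \<tau> p q = {f \<in> gen_functions.
     \<forall>u \<psi> L. wavelet_system u \<psi> \<and> scale0_in_torus TYPE('d) \<psi> L \<and>
       real u > max \<tau> (real CARD('d) * max (recip p - 1) 0 - \<tau>) \<longrightarrow>
       (\<exists>c. besov_seq_norm L \<tau> p q c < \<infinity> \<and> wavelet_expansion \<psi> L c f)}"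

end

(* The noise w has the characteristic functional of a finite sum of N Dirac masses t_k at x_k, where N is
   Poisson and the pairs (t_k, x_k) are independent with law P times Lebesgue measure. The characteristic
   functional determines the joint law of w on a countable dense set of test functions, and the
   finite Dirac combinations, evaluated on this set, form a countable union of compact subsets of
   the space of real sequences. Hence w is almost surely a finite Dirac combination, and this null
   set does not depend on the wavelet system.

   Only boundedly many wavelets per scale j charge a given point, and there the normalized
   coefficient is O(2^(jd)); so the Besov sequence norm is dominated by a geometric series of ratio
   2^(tau - d/p + d). The expansion itself amounts to the pointwise wavelet expansion of a test function.
   It converges absolutely since the mother wavelet has integral 0, and its partial sums telescope to
   integrals against the scaling kernels, which form an approximate identity. *)

theory Submission
  imports Defs
begin

text \<open>Three obstacles shape the proof. Equality of characteristic functionals gives equality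
  in law only, without a coupling, so being a Dirac combination has to be a measurable event in
  sequence space. A continuous image of a Borel set may fail to be Borel; compact parameter sets
  (bounded amplitudes, closed unit cube) avoid this. Continuity of each realization then passes from
  the countable dense set to all test functions. \<open>besov_space\<close> quantifies over an
  uncountable family of wavelet systems, so the random part has to end before a system is chosen;
  everything after that is deterministic. A wavelet system is given by an orthonormal basis, without
  a two-scale relation. The relation is recovered from completeness of the dilated basis, and it is
  what makes the detail kernels telescope. In dimension d everything is derived from products of
  one-dimensional kernels. Convergence at points is the right notion: pairing the expansion of a
  Dirac mass at x with \<phi> gives terms Psi(x) times the integral of Psi \<phi>, that is, the
  wavelet series of \<phi> at x.\<close>

section \<open>Laws on sequence space are determined by characteristic functions\<close>

text \<open>Divided by their common total mass, the weights \<open>u\<close> and \<open>v\<close>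
  become probability densities, and Levy's uniqueness theorem compares the laws of \<open>f\<close>
  and \<open>g\<close> under them.\<close>

lemma integral_indicator_eq_if_char_eq:
  fixes f u :: "'a \<Rightarrow> real" and g v :: "'b \<Rightarrow> real" and B :: real
  assumes "finite_measure M" "finite_measure N"
    and [measurable]: "f \<in> borel_measurable M" "g \<in> borel_measurable N"
    and [measurable]: "u \<in> borel_measurable M" "v \<in> borel_measurable N"
    and u: "\<And>x. 0 \<le> u x" "\<And>x. u x \<le> B" and v: "\<And>x. 0 \<le> v x" "\<And>x. v x \<le> B"
    and eq: "\<And>\<xi>. (\<integral>x. u x * iexp (\<xi> * f x) \<partial>M) = (\<integral>x. v x * iexp (\<xi> * g x) \<partial>N)"
    and A: "A \<in> sets borel"
  shows "(\<integral>x. u x * indicator A (f x) \<partial>M) = (\<integral>x. v x * indicator A (g x) \<partial>N)"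
proof -
  interpret M: finite_measure M by fact
  interpret N: finite_measure N by fact
  have intu: "integrable M u" using u by (intro M.integrable_const_bound[where B=B]) auto
  have intv: "integrable N v" using v by (intro N.integrable_const_bound[where B=B]) auto
  define c where "c = (\<integral>x. u x \<partial>M)"
  \<comment> \<open>The value at frequency 0 shows that both weights have the same total
    mass.\<close>
  have "complex_of_real c = of_real (\<integral>x. v x \<partial>N)"
    using eq[of 0] unfolding c_def by simp
  then have c': "c = (\<integral>x. v x \<partial>N)" using of_real_eq_iff by blast
  show ?thesis
  proof (cases "c = 0")
    case True
    have "AE x in M. u x = 0" using True integral_nonneg_eq_0_iff_AE[OF intu] u unfolding c_def by auto
    then have "(\<integral>x. u x * indicator A (f x) \<partial>M) = 0" by (intro integral_eq_zero_AE) auto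
    moreover have "AE x in N. v x = 0" using True integral_nonneg_eq_0_iff_AE[OF intv] v unfolding c' by auto
    then have "(\<integral>x. v x * indicator A (g x) \<partial>N) = 0" by (intro integral_eq_zero_AE) auto
    ultimately show ?thesis by simp
  next
    case False
    have cpos: "c > 0" using False u unfolding c_def
      by (metis integral_nonneg_AE AE_I2 order_less_le)
    define MM where "MM = density M (\<lambda>x. ennreal (u x / c))"
    define NN where "NN = density N (\<lambda>x. ennreal (v x / c))"
    have [simp]: "sets MM = sets M" "sets NN = sets N" unfolding MM_def NN_def by simp_all
    have [measurable]: "f \<in> borel_measurable MM" "g \<in> borel_measurable NN"
      unfolding MM_def NN_def by simp_all
    have "emeasure MM (space MM) = (\<integral>\<^sup>+x. ennreal (u x / c) \<partial>M)"
      unfolding MM_def by (subst emeasure_density) (auto intro!: nn_integral_cong)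
    also have "\<dots> = ennreal (\<integral>x. u x / c \<partial>M)"
      using u cpos intu by (intro nn_integral_eq_integral) auto
    also have "\<dots> = 1" using False by (simp add: c_def)
    finally have PM: "prob_space MM" by (rule prob_spaceI)
    have "emeasure NN (space NN) = (\<integral>\<^sup>+x. ennreal (v x / c) \<partial>N)"
      unfolding NN_def by (subst emeasure_density) (auto intro!: nn_integral_cong)
    also have "\<dots> = ennreal (\<integral>x. v x / c \<partial>N)"
      using v cpos intv by (intro nn_integral_eq_integral) auto
    also have "\<dots> = 1" using False by (simp add: c')
    finally have PN: "prob_space NN" by (rule prob_spaceI)
    have "distr MM borel f = distr NN borel g"
    proof (rule Levy_uniqueness)
      show "real_distribution (distr MM borel f)" "real_distribution (distr NN borel g)"
        by (intro prob_space.real_distribution_distr PM PN; measurable)+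
      show "char (distr MM borel f) = char (distr NN borel g)"
      proof
        fix \<xi>
        have "char (distr MM borel f) \<xi> = (\<integral>x. iexp (\<xi> * f x) \<partial>MM)"
          unfolding char_def by (subst integral_distr) auto
        also have "\<dots> = (\<integral>x. (u x / c) *\<^sub>R iexp (\<xi> * f x) \<partial>M)"
          unfolding MM_def using u cpos by (subst integral_density) auto
        also have "\<dots> = (\<integral>x. u x * iexp (\<xi> * f x) \<partial>M) / c"
          by (simp add: scaleR_conv_of_real flip: integral_divide_zero)
        also have "\<dots> = (\<integral>x. v x * iexp (\<xi> * g x) \<partial>N) / c" by (simp only: eq)
        also have "\<dots> = (\<integral>x. (v x / c) *\<^sub>R iexp (\<xi> * g x) \<partial>N)"
          by (simp add: scaleR_conv_of_real flip: integral_divide_zero)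
        also have "\<dots> = (\<integral>x. iexp (\<xi> * g x) \<partial>NN)"
          unfolding NN_def using v cpos by (subst integral_density) auto
        also have "\<dots> = char (distr NN borel g) \<xi>"
          unfolding char_def by (subst integral_distr) auto
        finally show "char (distr MM borel f) \<xi> = char (distr NN borel g) \<xi>" .
      qed
    qed
    then have "(\<integral>x. indicator A x \<partial>distr MM borel f) = (\<integral>x. indicator A x \<partial>distr NN borel g :: real)"
      by simp
    moreover have "(\<integral>x. indicator A x \<partial>distr MM borel f) = (\<integral>x. u x * indicator A (f x) \<partial>M) / c"
    proof -
      have "(\<integral>x. indicator A x \<partial>distr MM borel f) = (\<integral>x. indicator A (f x) \<partial>MM :: real)"
        using A by (subst integral_distr) auto
      also have "\<dots> = (\<integral>x. (u x / c) * indicator A (f x) \<partial>M)"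
        unfolding MM_def using u cpos A by (subst integral_real_density) auto
      also have "\<dots> = (\<integral>x. u x * indicator A (f x) \<partial>M) / c"
        by (simp flip: integral_divide_zero)
      finally show ?thesis .
    qed
    moreover have "(\<integral>x. indicator A x \<partial>distr NN borel g) = (\<integral>x. v x * indicator A (g x) \<partial>N) / c"
    proof -
      have "(\<integral>x. indicator A x \<partial>distr NN borel g) = (\<integral>x. indicator A (g x) \<partial>NN :: real)"
        using A by (subst integral_distr) auto
      also have "\<dots> = (\<integral>x. (v x / c) * indicator A (g x) \<partial>N)"
        unfolding NN_def using v cpos A by (subst integral_real_density) auto
      also have "\<dots> = (\<integral>x. v x * indicator A (g x) \<partial>N) / c"
        by (simp flip: integral_divide_zero)
      finally show ?thesis .
    qed
    ultimately show ?thesis using False by simp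
  qed
qed

text \<open>An index may occur repeatedly in the list, so one more frequency is prepended without
  merging it into an existing coefficient.\<close>

abbreviation lin_comb :: "(real \<times> nat) list \<Rightarrow> (nat \<Rightarrow> real) \<Rightarrow> real" where
  "lin_comb l x \<equiv> (\<Sum>(a, i)\<leftarrow>l. a * x i)"

lemma lin_comb_uminus: "lin_comb (map (\<lambda>(a, i). (- a, i)) l) x = - lin_comb l x"
  by (induction l) auto

lemma lin_comb_measurable [measurable]:
  assumes "\<And>i. (\<lambda>\<omega>. X \<omega> i) \<in> borel_measurable M"
  shows "(\<lambda>\<omega>. lin_comb l (X \<omega>)) \<in> borel_measurable M"
  using assms by (induction l) auto

text \<open>
  The induction adds one coordinate at a time: the weights \<open>1 + cos Z\<close> and \<open>1 + sin Z\<close> are nonnegative, so the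
  one-dimensional uniqueness theorem applies to the coordinate under the measures that they define.
\<close>

lemma integral_box_char_eq:
  fixes X :: "'a \<Rightarrow> nat \<Rightarrow> real" and Y :: "'b \<Rightarrow> nat \<Rightarrow> real"
  assumes "prob_space M" "prob_space N"
    and mX [measurable]: "\<And>i. (\<lambda>\<omega>. X \<omega> i) \<in> borel_measurable M"
    and mY [measurable]: "\<And>i. (\<lambda>\<omega>. Y \<omega> i) \<in> borel_measurable N"
    and eq: "\<And>l. (\<integral>\<omega>. iexp (lin_comb l (X \<omega>)) \<partial>M) = (\<integral>\<omega>. iexp (lin_comb l (Y \<omega>)) \<partial>N)"
    and "finite J" and "\<And>j. j \<in> J \<Longrightarrow> A j \<in> sets borel"
  shows "(\<integral>\<omega>. of_real (\<Prod>j\<in>J. indicator (A j) (X \<omega> j)) * iexp (lin_comb l (X \<omega>)) \<partial>M) =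
         (\<integral>\<omega>. of_real (\<Prod>j\<in>J. indicator (A j) (Y \<omega> j)) * iexp (lin_comb l (Y \<omega>)) \<partial>N)"
  using assms(6,7)
proof (induction J arbitrary: l)
  case empty
  then show ?case using eq by simp
next
  case (insert a J)
  interpret M: prob_space M by fact
  interpret N: prob_space N by fact
  define W where "W x = (\<Prod>j\<in>J. indicator (A j) (x j) :: real)" for x
  have W01: "0 \<le> W x" "W x \<le> 1" for x
    unfolding W_def by (auto intro!: prod_nonneg prod_le_1)
  have [measurable]: "A a \<in> sets borel" "\<And>j. j \<in> J \<Longrightarrow> A j \<in> sets borel" using insert by auto
  have [measurable]: "(\<lambda>\<omega>. W (X \<omega>)) \<in> borel_measurable M"
    unfolding W_def by (intro borel_measurable_prod) measurable
  have [measurable]: "(\<lambda>\<omega>. W (Y \<omega>)) \<in> borel_measurable N"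
    unfolding W_def by (intro borel_measurable_prod) measurable
  have IH: "(\<integral>\<omega>. W (X \<omega>) * iexp (lin_comb l (X \<omega>)) \<partial>M) = (\<integral>\<omega>. W (Y \<omega>) * iexp (lin_comb l (Y \<omega>)) \<partial>N)" for l
    using insert unfolding W_def by auto
  \<comment> \<open>The three choices of \<open>T\<close> are 0, cosine and sine. Each is a
    combination of \<open>iexp z\<close> and \<open>iexp (- z)\<close>, so the weighted integrals
    reduce to exponentials covered by \<open>IH\<close>.\<close>
  have trig: "(\<integral>x. W (X x) * (1 + T (lin_comb l (X x))) * indicator (A a) (X x a) \<partial>M)
      = (\<integral>x. W (Y x) * (1 + T (lin_comb l (Y x))) * indicator (A a) (Y x a) \<partial>N)"
    if T: "\<And>z. complex_of_real (T z) = \<alpha> * iexp z + \<beta> * iexp (- z)" "\<And>z. \<bar>T z\<bar> \<le> 1"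
      and [measurable]: "T \<in> borel_measurable borel" for T :: "real \<Rightarrow> real" and \<alpha> \<beta> l
  proof (rule integral_indicator_eq_if_char_eq[where B=2])
    have "0 \<le> 1 + T z" "1 + T z \<le> 2" for z using T(2)[of z] by auto
    then have "0 \<le> W z * (1 + T y)" "W z * (1 + T y) \<le> 2" for z y
      using W01[of z] mult_mono[of "W z" 1 "1 + T y" 2] by (auto intro!: mult_nonneg_nonneg)
    then show "0 \<le> W z * (1 + T y)" "W z * (1 + T y) \<le> 2"
      "0 \<le> W z * (1 + T y)" "W z * (1 + T y) \<le> 2" for z y by auto
    fix \<xi>
    define l1 where "l1 = (\<xi>, a) # l"
    \<comment> \<open>Negated coefficients give the conjugate exponential in the same
      format.\<close>
    define l2 where "l2 = (\<xi>, a) # map (\<lambda>(a, i). (- a, i)) l"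
    have exps: "iexp (\<xi> * x a) * iexp (lin_comb l x) = iexp (lin_comb l1 x)" 
       "iexp (\<xi> * x a) * iexp (- lin_comb l x) = iexp (lin_comb l2 x)" 
       "iexp (\<xi> * x a) = iexp (lin_comb [(\<xi>, a)] x)" for x
      unfolding l1_def l2_def using lin_comb_uminus[where l=l and x=x]
      by (simp_all del: map_map flip: exp_add add: algebra_simps)
    have dec: "of_real (W x * (1 + T (lin_comb l x))) * iexp (\<xi> * x a) =
        of_real (W x) * iexp (lin_comb [(\<xi>, a)] x) + \<alpha> * (of_real (W x) * iexp (lin_comb l1 x))
        + \<beta> * (of_real (W x) * iexp (lin_comb l2 x))" for x
    proof -
      have "of_real (W x * (1 + T (lin_comb l x))) * iexp (\<xi> * x a) =
        of_real (W x) * (1 + (\<alpha> * iexp (lin_comb l x) + \<beta> * iexp (- lin_comb l x))) * iexp (\<xi> * x a)"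
        by (simp add: T(1))
      also have "\<dots> = of_real (W x) * iexp (\<xi> * x a) + \<alpha> * (of_real (W x) * (iexp (\<xi> * x a) * iexp (lin_comb l x)))
         + \<beta> * (of_real (W x) * (iexp (\<xi> * x a) * iexp (- lin_comb l x)))"
        by (simp add: algebra_simps)
      finally show ?thesis unfolding exps(1,2) unfolding exps(3) .
    qed
    have iM: "integrable M (\<lambda>\<omega>. of_real (W (X \<omega>)) * iexp (lin_comb l (X \<omega>)))" for l
      using W01 by (intro M.integrable_const_bound[where B=1]) (auto simp: norm_mult)
    have iN: "integrable N (\<lambda>\<omega>. of_real (W (Y \<omega>)) * iexp (lin_comb l (Y \<omega>)))" for l
      using W01 by (intro N.integrable_const_bound[where B=1]) (auto simp: norm_mult)
    show "(\<integral>x. of_real (W (X x) * (1 + T (lin_comb l (X x)))) * iexp (\<xi> * X x a) \<partial>M) =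
      (\<integral>x. of_real (W (Y x) * (1 + T (lin_comb l (Y x)))) * iexp (\<xi> * Y x a) \<partial>N)"
      unfolding dec
      apply (subst Bochner_Integration.integral_add; (intro Bochner_Integration.integrable_add integrable_mult_right iM iN)?)+
      by (simp only: integral_mult_right_zero IH)
  qed (use \<open>prob_space M\<close> \<open>prob_space N\<close> prob_space.finite_measure in auto)
  define I where "I x = (indicator (A a) (x a) :: real)" for x
  have [measurable]: "(\<lambda>\<omega>. I (X \<omega>)) \<in> borel_measurable M" "(\<lambda>\<omega>. I (Y \<omega>)) \<in> borel_measurable N"
    unfolding I_def by measurable
  have I01: "0 \<le> I x" "I x \<le> 1" for x unfolding I_def by auto
  have WI01: "\<bar>W x * I x\<bar> \<le> 1" for x using W01[of x] I01[of x] by (auto intro!: mult_le_one)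
  have iM: "integrable M (\<lambda>\<omega>. W (X \<omega>) * T (lin_comb l (X \<omega>)) * I (X \<omega>))"
    if "\<And>z. \<bar>T z\<bar> \<le> 1" "T \<in> borel_measurable borel" for T
    using that(1) W01 I01 that(2)
    by (intro M.integrable_const_bound[where B=1]) (auto simp: abs_mult intro!: mult_le_one)
  have iN: "integrable N (\<lambda>\<omega>. W (Y \<omega>) * T (lin_comb l (Y \<omega>)) * I (Y \<omega>))"
    if "\<And>z. \<bar>T z\<bar> \<le> 1" "T \<in> borel_measurable borel" for T
    using that(1) W01 I01 that(2)
    by (intro N.integrable_const_bound[where B=1]) (auto simp: abs_mult intro!: mult_le_one)
  \<comment> \<open>With \<open>T\<close> equal to 0 the weight is \<open>W\<close> alone;
    subtracting it from the shifted weight \<open>1 + T\<close> isolates \<open>T\<close>.\<close>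
  have base: "(\<integral>x. W (X x) * I (X x) \<partial>M) = (\<integral>x. W (Y x) * I (Y x) \<partial>N)"
    using trig[of "\<lambda>z. 0" 0 0 l] by (simp add: I_def)
  have part: "(\<integral>x. W (X x) * T (lin_comb l (X x)) * I (X x) \<partial>M) = 
     (\<integral>x. W (Y x) * T (lin_comb l (Y x)) * I (Y x) \<partial>N)"
    if T: "\<And>z. complex_of_real (T z) = \<alpha> * iexp z + \<beta> * iexp (- z)" "\<And>z. \<bar>T z\<bar> \<le> 1"
      "T \<in> borel_measurable borel" for T :: "real \<Rightarrow> real" and \<alpha> \<beta>
  proof -
    have "(\<integral>x. W (X x) * (1 + T (lin_comb l (X x))) * I (X x) \<partial>M) = 
       (\<integral>x. W (X x) * I (X x) \<partial>M) + (\<integral>x. W (X x) * T (lin_comb l (X x)) * I (X x) \<partial>M)"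
      using iM[OF T(2,3)] iM[of "\<lambda>_. 1"]
      by (subst Bochner_Integration.integral_add[symmetric]) (auto simp: algebra_simps)
    moreover have "(\<integral>x. W (Y x) * (1 + T (lin_comb l (Y x))) * I (Y x) \<partial>N) = 
       (\<integral>x. W (Y x) * I (Y x) \<partial>N) + (\<integral>x. W (Y x) * T (lin_comb l (Y x)) * I (Y x) \<partial>N)"
      using iN[OF T(2,3)] iN[of "\<lambda>_. 1"]
      by (subst Bochner_Integration.integral_add[symmetric]) (auto simp: algebra_simps)
    ultimately show ?thesis using trig[OF T, of l] base unfolding I_def by simp
  qed
  have cos: "(\<integral>x. W (X x) * cos (lin_comb l (X x)) * I (X x) \<partial>M) = 
     (\<integral>x. W (Y x) * cos (lin_comb l (Y x)) * I (Y x) \<partial>N)"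
    by (rule part[of _ "1/2" "1/2"]) (auto simp: complex_eq_iff Re_exp Im_exp)
  have sin: "(\<integral>x. W (X x) * sin (lin_comb l (X x)) * I (X x) \<partial>M) = 
     (\<integral>x. W (Y x) * sin (lin_comb l (Y x)) * I (Y x) \<partial>N)"
    by (rule part[of _ "-\<i>/2" "\<i>/2"]) (auto simp: complex_eq_iff Re_exp Im_exp)
  have split: "of_real (\<Prod>j\<in>insert a J. indicator (A j) (x j)) * iexp (lin_comb l x) = 
     of_real (W x * cos (lin_comb l x) * I x) + \<i> * of_real (W x * sin (lin_comb l x) * I x)" for x
  proof -
    have "iexp z = of_real (cos z) + \<i> * of_real (sin z)" for z
      by (auto simp: complex_eq_iff Re_exp Im_exp)
    then show ?thesis
      using insert.hyps unfolding W_def I_def by (simp add: algebra_simps del: of_real_prod)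
  qed
  have "(\<integral>x. of_real (\<Prod>j\<in>insert a J. indicator (A j) (X x j)) * iexp (lin_comb l (X x)) \<partial>M) = 
    of_real (\<integral>x. W (X x) * cos (lin_comb l (X x)) * I (X x) \<partial>M) 
      + \<i> * of_real (\<integral>x. W (X x) * sin (lin_comb l (X x)) * I (X x) \<partial>M)"
    unfolding split using iM[of cos] iM[of sin]
    by (subst Bochner_Integration.integral_add) (auto simp del: of_real_mult)
  also have "\<dots> = (\<integral>x. of_real (\<Prod>j\<in>insert a J. indicator (A j) (Y x j)) * iexp (lin_comb l (Y x)) \<partial>N)"
    unfolding split cos sin using iN[of cos] iN[of sin]
    by (subst Bochner_Integration.integral_add) (auto simp del: of_real_mult)
  finally show ?case .
qed

text \<open>With the empty list, \<open>integral_box_char_eq\<close> compares the probabilities of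
  boxes in finitely many coordinates. These determine a finite measure on the countable product,
  whose sigma-algebra is the Borel one.\<close>

theorem distr_eq_if_char_eq:
  fixes X :: "'a \<Rightarrow> nat \<Rightarrow> real" and Y :: "'b \<Rightarrow> nat \<Rightarrow> real"
  assumes "prob_space M" "prob_space N"
    and mX: "X \<in> borel_measurable M" and mY: "Y \<in> borel_measurable N"
    and eq: "\<And>l. (\<integral>\<omega>. iexp (lin_comb l (X \<omega>)) \<partial>M) = (\<integral>\<omega>. iexp (lin_comb l (Y \<omega>)) \<partial>N)"
  shows "distr M borel X = distr N borel Y"
proof -
  interpret M: prob_space M by fact
  interpret N: prob_space N by fact
  have sets_eq: "sets (PiM UNIV (\<lambda>_::nat. borel :: real measure)) = sets borel"
    by (rule sets_PiM_equal_borel)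
  have mX' [measurable]: "(\<lambda>\<omega>. X \<omega> i) \<in> borel_measurable M" for i
    by (rule measurable_product_then_coordinatewise[OF mX])
  have mY' [measurable]: "(\<lambda>\<omega>. Y \<omega> i) \<in> borel_measurable N" for i
    by (rule measurable_product_then_coordinatewise[OF mY])
  show ?thesis
  proof (rule measure_eqI_PiM_infinite[where I=UNIV and M="\<lambda>_. borel"])
    show "sets (distr M borel X) = sets (PiM UNIV (\<lambda>_. borel))" "sets (distr N borel Y) = sets (PiM UNIV (\<lambda>_. borel))"
      using sets_eq by auto
    show "finite_measure (distr M borel X)"
      by (intro prob_space.finite_measure M.prob_space_distr mX)
    fix A :: "nat \<Rightarrow> real set" and J assume J: "finite J" and A: "\<And>i. i \<in> J \<Longrightarrow> A i \<in> sets borel"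
    let ?E = "prod_emb UNIV (\<lambda>_. borel) J (Pi\<^sub>E J A)"
    have E: "?E = {x. \<forall>j\<in>J. x j \<in> A j}" by (auto simp: prod_emb_def PiE_iff)
    have "?E \<in> sets (PiM UNIV (\<lambda>_. borel))" using J A by (intro sets_PiM_I) auto
    then have E': "{x. \<forall>j\<in>J. x j \<in> A j} \<in> sets borel" unfolding sets_eq E .
    have ind: "indicator {x. \<forall>j\<in>J. x j \<in> A j} x = (\<Prod>j\<in>J. indicator (A j) (x j) :: real)" for x
      using J by (auto simp: indicator_def)
    have "complex_of_real (measure (distr M borel X) ?E) = complex_of_real (\<integral>\<omega>. indicator {x. \<forall>j\<in>J. x j \<in> A j} (X \<omega>) \<partial>M)"
      unfolding E using mX E' by (subst integral_distr[of X M borel, symmetric]) auto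
    also have "\<dots> = (\<integral>\<omega>. of_real (\<Prod>j\<in>J. indicator (A j) (X \<omega> j)) * iexp (lin_comb [] (X \<omega>)) \<partial>M)"
      unfolding ind by (simp del: of_real_prod)
    also have "\<dots> = (\<integral>\<omega>. of_real (\<Prod>j\<in>J. indicator (A j) (Y \<omega> j)) * iexp (lin_comb [] (Y \<omega>)) \<partial>N)"
      by (intro integral_box_char_eq assms J A mX' mY')
    also have "\<dots> = complex_of_real (\<integral>\<omega>. indicator {x. \<forall>j\<in>J. x j \<in> A j} (Y \<omega>) \<partial>N)"
      unfolding ind by (simp del: of_real_prod)
    also have "\<dots> = complex_of_real (measure (distr N borel Y) ?E)"
      unfolding E using mY E' by (subst integral_distr[of Y N borel, symmetric]) auto
    finally have "measure (distr M borel X) ?E = measure (distr N borel Y) ?E"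
      using of_real_eq_iff by blast
    moreover have "finite_measure (distr M borel X)" "finite_measure (distr N borel Y)"
      by (intro prob_space.finite_measure M.prob_space_distr N.prob_space_distr mX mY)+
    ultimately show "emeasure (distr M borel X) ?E = emeasure (distr N borel Y) ?E"
      by (simp add: finite_measure.emeasure_eq_measure)
  qed
qed

section \<open>Test functions\<close>

lemma partial_deriv_eq_derivative:
  "(f has_derivative f') (at x) \<Longrightarrow> partial_deriv a f x = f' (axis a 1)"
  unfolding partial_deriv_def using frechet_derivative_at by metis

lemma iter_partial_append: "iter_partial (as @ bs) f = iter_partial as (iter_partial bs f)"
  by (induction as) auto

lemma smooth_differentiable: "smooth f \<Longrightarrow> iter_partial as f differentiable (at x)"
  unfolding smooth_def by blast

lemma smooth_iter_partial: "smooth f \<Longrightarrow> smooth (iter_partial as f)"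
  unfolding smooth_def by (simp flip: iter_partial_append)

lemma smooth_continuous_on: "smooth f \<Longrightarrow> continuous_on A f"
  using smooth_differentiable[of f "[]"]
  by (auto intro!: continuous_at_imp_continuous_on differentiable_imp_continuous_within)

lemma iter_partial_lin_comb:
  assumes "smooth f" "smooth g"
  shows "iter_partial as (\<lambda>x. a * f x + b * g x) = (\<lambda>x. a * iter_partial as f x + b * iter_partial as g x)"
proof (induction as)
  case (Cons c as)
  have "partial_deriv c (\<lambda>x. a * iter_partial as f x + b * iter_partial as g x) x =
      a * partial_deriv c (iter_partial as f) x + b * partial_deriv c (iter_partial as g) x" for x
  proof -
    have f: "(iter_partial as f has_derivative frechet_derivative (iter_partial as f) (at x)) (at x)"
      and g: "(iter_partial as g has_derivative frechet_derivative (iter_partial as g) (at x)) (at x)"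
      using smooth_differentiable[OF assms(1)] smooth_differentiable[OF assms(2)]
      by (simp_all flip: frechet_derivative_works)
    show ?thesis
      by (subst partial_deriv_eq_derivative[OF has_derivative_add[OF
             has_derivative_mult_right[OF f, of a] has_derivative_mult_right[OF g, of b]]])
         (simp add: partial_deriv_def)
  qed
  then show ?case using Cons by auto
qed auto

lemma smooth_lin_comb: "smooth f \<Longrightarrow> smooth g \<Longrightarrow> smooth (\<lambda>x. a * f x + b * g x)"
  unfolding smooth_def
  by (subst iter_partial_lin_comb) (auto simp: smooth_def intro!: differentiable_add differentiable_mult)

lemma smooth_zero: "smooth (\<lambda>_. 0)"
proof -
  have "iter_partial as (\<lambda>_. 0) = (\<lambda>_. 0)" for as :: "'a list"
  proof (induction as)
    case (Cons a as)
    have "partial_deriv a (\<lambda>_::real^'a. 0 :: real) x = 0" for x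
      by (subst partial_deriv_eq_derivative[OF has_derivative_const]) auto
    then show ?case using Cons by auto
  qed auto
  then show ?thesis unfolding smooth_def by simp
qed

lemma periodic_partial_deriv:
  assumes "periodic f" "\<And>x. f differentiable (at x)"
  shows "periodic (partial_deriv a f)"
  unfolding periodic_def
proof (intro allI)
  fix x k
  have "(f has_derivative frechet_derivative f (at (x + int_vec k))) (at (x + int_vec k))"
    using assms(2) by (simp flip: frechet_derivative_works)
  then have "((\<lambda>y. f (y + int_vec k)) has_derivative (\<lambda>y. frechet_derivative f (at (x + int_vec k)) y)) (at x)"
    using has_derivative_compose[of "\<lambda>y. y + int_vec k" "\<lambda>y. y" x UNIV f]
    by (force intro!: derivative_eq_intros)
  then have "(f has_derivative frechet_derivative f (at (x + int_vec k))) (at x)"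
    using assms(1) unfolding periodic_def by simp
  from partial_deriv_eq_derivative[OF this]
  show "partial_deriv a f (x + int_vec k) = partial_deriv a f x"
    unfolding partial_deriv_def by simp
qed

lemma periodic_iter_partial: "smooth f \<Longrightarrow> periodic f \<Longrightarrow> periodic (iter_partial as f)"
  by (induction as) (auto intro!: periodic_partial_deriv smooth_differentiable)

lemma test_functions_iter_partial: "f \<in> test_functions \<Longrightarrow> iter_partial as f \<in> test_functions"
  unfolding test_functions_def by (simp add: smooth_iter_partial periodic_iter_partial)

lemma test_functions_lin_comb:
  "f \<in> test_functions \<Longrightarrow> g \<in> test_functions \<Longrightarrow> (\<lambda>x. a * f x + b * g x) \<in> test_functions"
  unfolding test_functions_def by (auto simp: smooth_lin_comb periodic_def)

lemma test_functions_zero: "(\<lambda>_. 0) \<in> test_functions"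
  unfolding test_functions_def by (auto simp: smooth_zero periodic_def)

lemma test_functions_diff:
  "f \<in> test_functions \<Longrightarrow> g \<in> test_functions \<Longrightarrow> (\<lambda>x. f x - g x) \<in> test_functions"
  using test_functions_lin_comb[of f g 1 "-1"] by simp

lemma iter_partial_diff:
  "f \<in> test_functions \<Longrightarrow> g \<in> test_functions \<Longrightarrow>
    iter_partial as (\<lambda>x. f x - g x) x = iter_partial as f x - iter_partial as g x"
  using iter_partial_lin_comb[of f g as 1 "-1"] unfolding test_functions_def by simp

lemma test_functions_continuous_on: "f \<in> test_functions \<Longrightarrow> continuous_on A f"
  unfolding test_functions_def by (auto intro: smooth_continuous_on)

lemma test_functions_measurable [measurable_dest]: "f \<in> test_functions \<Longrightarrow> f \<in> borel_measurable borel"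
  by (intro borel_measurable_continuous_onI test_functions_continuous_on)

lemma ex_int_vec_unit_cube:
  fixes x :: "real ^ 'd::finite"
  obtains k where "x + int_vec k \<in> cbox 0 1"
proof
  show "x + int_vec (\<chi> a. - \<lfloor>x $ a\<rfloor>) \<in> cbox 0 1"
    unfolding mem_box_cart int_vec_def by (auto; linarith)
qed

lemma periodic_bounded:
  fixes f :: "real ^ 'd::finite \<Rightarrow> real"
  assumes "periodic f" "continuous_on UNIV f"
  obtains B where "B > 0" "\<And>x. \<bar>f x\<bar> \<le> B"
proof -
  have "compact (f ` cbox 0 1)"
    using assms(2) by (intro compact_continuous_image) (auto intro: continuous_on_subset)
  then obtain B where B: "B > 0" "\<And>x. x \<in> cbox 0 1 \<Longrightarrow> \<bar>f x\<bar> \<le> B"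
    using bounded_pos compact_imp_bounded by (metis imageI real_norm_def)
  have "\<bar>f x\<bar> \<le> B" for x
  proof -
    obtain k where k: "x + int_vec k \<in> cbox 0 1" using ex_int_vec_unit_cube[of x] by blast
    then show ?thesis using B(2)[OF k] assms(1) unfolding periodic_def by simp
  qed
  then show ?thesis using that B by blast
qed

lemma test_functions_bounded:
  assumes "f \<in> test_functions"
  obtains B where "B > 0" "\<And>x. \<bar>f x\<bar> \<le> B"
  using periodic_bounded[of f] assms test_functions_continuous_on[of f UNIV]
  unfolding test_functions_def by blast

text \<open>First-order partial derivatives of a test function are again test functions, hence
  bounded, and the sum of their bounds dominates the operator norm of the derivative.\<close>

lemma test_functions_lipschitz:
  fixes f :: "real ^ 'd::finite \<Rightarrow> real"
  assumes f: "f \<in> test_functions"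
  obtains B where "B > 0" "\<And>x y. \<bar>f x - f y\<bar> \<le> B * norm (x - y)"
proof -
  have "\<exists>B. \<forall>a. B a > 0 \<and> (\<forall>x. \<bar>partial_deriv a f x\<bar> \<le> B a)"
  proof (intro choice allI)
    fix a
    have "partial_deriv a f \<in> test_functions" using test_functions_iter_partial[OF f, of "[a]"] by simp
    then show "\<exists>B>0. \<forall>x. \<bar>partial_deriv a f x\<bar> \<le> B" using test_functions_bounded by metis
  qed
  then obtain B where B: "\<And>a. B a > 0" "\<And>a x. \<bar>partial_deriv a f x\<bar> \<le> B a" by blast
  have d: "(f has_derivative frechet_derivative f (at x)) (at x)" for x
    using f smooth_differentiable[of f "[]"]
    unfolding test_functions_def by (simp flip: frechet_derivative_works)
  have "onorm (frechet_derivative f (at x)) \<le> (\<Sum>a\<in>UNIV. B a)" for x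
  proof (rule onorm_bound)
    show "0 \<le> sum B UNIV" using B(1) by (intro sum_nonneg) (auto intro: less_imp_le)
    fix h :: "real ^ 'd"
    interpret bounded_linear "frechet_derivative f (at x)" using d has_derivative_bounded_linear by blast
    have "frechet_derivative f (at x) h = frechet_derivative f (at x) (\<Sum>a\<in>UNIV. (h $ a) *\<^sub>R axis a 1)"
      using basis_expansion[of h] by (simp add: scalar_mult_eq_scaleR)
    also have "\<dots> = (\<Sum>a\<in>UNIV. h $ a * partial_deriv a f x)"
      by (simp add: sum scaleR partial_deriv_def)
    finally have "\<bar>frechet_derivative f (at x) h\<bar> \<le> (\<Sum>a\<in>UNIV. \<bar>h $ a * partial_deriv a f x\<bar>)"
      by (metis sum_abs)
    also have "\<dots> \<le> (\<Sum>a\<in>UNIV. norm h * B a)"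
      unfolding abs_mult using B component_le_norm_cart by (intro sum_mono mult_mono) auto
    also have "\<dots> = sum B UNIV * norm h" by (simp add: sum_distrib_left mult.commute)
    finally show "norm (frechet_derivative f (at x) h) \<le> sum B UNIV * norm h" by simp
  qed
  then have "norm (f x - f y) \<le> (\<Sum>a\<in>UNIV. B a) * norm (x - y)" for x y
    using differentiable_bound[of UNIV f "\<lambda>x. frechet_derivative f (at x)" "\<Sum>a\<in>UNIV. B a" x y] d
    by auto
  moreover have "(\<Sum>a\<in>UNIV. B a) > 0" using B(1) by (intro sum_pos) auto
  ultimately show ?thesis using that by auto
qed

section \<open>Seminorms, topology and separability\<close>

lemma finite_index_lists: "finite {as :: 'd::finite list. length as \<le> N}"
  using finite_lists_length_le[of "UNIV :: 'd set" N] by simp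

text \<open>A real supremum is known to dominate its members only when the family is bounded above.
  The finitely many derivatives are each bounded, and the sum of their bounds serves for
  all.\<close>

lemma iter_partial_le_test_seminorm:
  fixes f :: "real ^ 'd::finite \<Rightarrow> real"
  assumes f: "f \<in> test_functions" and "length as \<le> N"
  shows "\<bar>iter_partial as f x\<bar> \<le> test_seminorm N f"
proof -
  have "\<exists>B. \<forall>as. B as > 0 \<and> (\<forall>x. \<bar>iter_partial as f x\<bar> \<le> B as)"
    using test_functions_bounded[OF test_functions_iter_partial[OF f]] by (intro choice allI) metis
  then obtain B where B: "\<And>as. B as > 0" "\<And>as x. \<bar>iter_partial as f x\<bar> \<le> B as" by blast
  have "bdd_above ((\<lambda>(as, x). \<bar>iter_partial as f x\<bar>) ` ({as. length as \<le> N} \<times> UNIV))"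
  proof (rule bdd_aboveI2)
    fix p :: "'d list \<times> (real ^ 'd)"
    assume "p \<in> {as. length as \<le> N} \<times> UNIV"
    then have "(case p of (as, x) \<Rightarrow> \<bar>iter_partial as f x\<bar>) \<le> B (fst p)" "fst p \<in> {as. length as \<le> N}"
      using B(2) by auto
    then show "(case p of (as, x) \<Rightarrow> \<bar>iter_partial as f x\<bar>) \<le> sum B {as. length as \<le> N}"
      using member_le_sum[of "fst p" "{as. length as \<le> N}" B] finite_index_lists B(1)
      by (force intro: less_imp_le)
  qed
  then show ?thesis unfolding test_seminorm_def
    using cSUP_upper[of "(as, x)" "{as. length as \<le> N} \<times> UNIV" "\<lambda>(as, x). \<bar>iter_partial as f x\<bar>"] assms(2)
    by auto
qed

lemma test_seminorm_le:
  assumes "\<And>as x. length as \<le> N \<Longrightarrow> \<bar>iter_partial as f x\<bar> \<le> B"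
  shows "test_seminorm N f \<le> B"
  unfolding test_seminorm_def using assms
  by (intro cSUP_least) (auto intro: exI[of _ "[]"])

lemma test_seminorm_mono: "f \<in> test_functions \<Longrightarrow> m \<le> n \<Longrightarrow> test_seminorm m f \<le> test_seminorm n f"
  by (intro test_seminorm_le iter_partial_le_test_seminorm) auto

lemma test_seminorm_triangle:
  assumes "f \<in> test_functions" "g \<in> test_functions" "h \<in> test_functions"
  shows "test_seminorm N (\<lambda>x. f x - h x) \<le> test_seminorm N (\<lambda>x. f x - g x) + test_seminorm N (\<lambda>x. g x - h x)"
proof (rule test_seminorm_le)
  fix as :: "'a list" and x assume as: "length as \<le> N"
  have "iter_partial as (\<lambda>x. f x - h x) x = iter_partial as (\<lambda>x. f x - g x) x + iter_partial as (\<lambda>x. g x - h x) x"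
    using assms by (simp add: iter_partial_diff)
  then show "\<bar>iter_partial as (\<lambda>x. f x - h x) x\<bar> \<le> test_seminorm N (\<lambda>x. f x - g x) + test_seminorm N (\<lambda>x. g x - h x)"
    using iter_partial_le_test_seminorm[OF test_functions_diff[OF assms(1,2)] as, of x]
      iter_partial_le_test_seminorm[OF test_functions_diff[OF assms(2,3)] as, of x] by linarith
qed

lemma test_seminorm_diff_self: "f \<in> test_functions \<Longrightarrow> test_seminorm N (\<lambda>x. f x - f x) \<le> 0"
  by (intro test_seminorm_le) (subst iter_partial_diff, auto)

lemma topspace_test_topology: "topspace (test_topology :: (real ^ 'd::finite \<Rightarrow> real) topology) = test_functions"
proof -
  have "f \<in> {\<psi> \<in> test_functions. test_seminorm 0 (\<lambda>x. \<psi> x - f x) < 1}" if "f \<in> test_functions"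
    for f :: "real ^ 'd \<Rightarrow> real"
    using test_seminorm_diff_self[OF that, of 0] that by auto
  moreover have "{\<psi> \<in> test_functions. test_seminorm 0 (\<lambda>x. \<psi> x - f x) < 1} \<in>
     {{\<psi> \<in> test_functions. test_seminorm N (\<lambda>x. \<psi> x - \<phi> x) < \<epsilon>} | N \<phi> \<epsilon>.
        \<phi> \<in> test_functions \<and> \<epsilon> > 0}" if "f \<in> test_functions" for f :: "real ^ 'd \<Rightarrow> real"
    using that zero_less_one by blast
  ultimately have "test_functions \<subseteq> topspace (test_topology :: (real ^ 'd \<Rightarrow> real) topology)"
    unfolding test_topology_def topology_generated_by_topspace by (intro subsetI UnionI)
  moreover have "topspace (test_topology :: (real ^ 'd \<Rightarrow> real) topology) \<subseteq> test_functions"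
    unfolding test_topology_def topology_generated_by_topspace by (rule Union_least) auto
  ultimately show ?thesis by (rule equalityI[rotated])
qed

text \<open>Basic open sets are balls around arbitrary centres. The triangle inequality provides a
  ball around \<open>f\<close> inside each; for an intersection, the larger order with the smaller
  radius works for both.\<close>

lemma openin_test_topology_contains_ball:
  assumes "openin test_topology U" "f \<in> U"
  obtains N \<epsilon> where "\<epsilon> > 0" "\<And>g. g \<in> test_functions \<Longrightarrow> test_seminorm N (\<lambda>x. g x - f x) < \<epsilon> \<Longrightarrow> g \<in> U"
proof -
  have f: "f \<in> test_functions" using assms openin_subset topspace_test_topology by blast
  from assms(1) have "generate_topology_on {{\<psi> \<in> test_functions. test_seminorm N (\<lambda>x. \<psi> x - \<phi> x) < \<epsilon>} | N \<phi> \<epsilon>.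
        \<phi> \<in> test_functions \<and> \<epsilon> > 0} U"
    unfolding test_topology_def openin_topology_generated_by_iff .
  then have "\<exists>N \<epsilon>. \<epsilon> > 0 \<and> (\<forall>g\<in>test_functions. test_seminorm N (\<lambda>x. g x - f x) < \<epsilon> \<longrightarrow> g \<in> U)"
    using assms(2)
  proof (induction)
    case (Int a b)
    then obtain N \<epsilon> N' \<epsilon>' where *: "\<epsilon> > 0" "\<forall>g\<in>test_functions. test_seminorm N (\<lambda>x. g x - f x) < \<epsilon> \<longrightarrow> g \<in> a"
      "\<epsilon>' > 0" "\<forall>g\<in>test_functions. test_seminorm N' (\<lambda>x. g x - f x) < \<epsilon>' \<longrightarrow> g \<in> b" by blast
    show ?case
    proof (intro exI[of _ "max N N'"] exI[of _ "min \<epsilon> \<epsilon>'"] conjI ballI impI)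
      fix g assume g: "g \<in> test_functions" "test_seminorm (max N N') (\<lambda>x. g x - f x) < min \<epsilon> \<epsilon>'"
      have "test_seminorm N (\<lambda>x. g x - f x) \<le> test_seminorm (max N N') (\<lambda>x. g x - f x)"
        "test_seminorm N' (\<lambda>x. g x - f x) \<le> test_seminorm (max N N') (\<lambda>x. g x - f x)"
        using g f by (auto intro!: test_seminorm_mono test_functions_diff)
      then show "g \<in> a \<inter> b" using * g by auto
    qed (use * in auto)
  next
    case (UN K)
    then show ?case by blast
  next
    case (Basis s)
    then obtain N \<phi> \<epsilon> where s: "s = {\<psi> \<in> test_functions. test_seminorm N (\<lambda>x. \<psi> x - \<phi> x) < \<epsilon>}" "\<phi> \<in> test_functions"
      by blast
    show ?case
    proof (intro exI[of _ N] exI[of _ "\<epsilon> - test_seminorm N (\<lambda>x. f x - \<phi> x)"] conjI ballI impI)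
      fix g assume "g \<in> test_functions" "test_seminorm N (\<lambda>x. g x - f x) < \<epsilon> - test_seminorm N (\<lambda>x. f x - \<phi> x)"
      then show "g \<in> s" using test_seminorm_triangle[of g f \<phi> N] f s by auto
    qed (use Basis s in auto)
  qed auto
  then show ?thesis using that by blast
qed

text \<open>
  One representative is picked for every table of rounded values, on a finite net of the unit cube, of
  the derivatives up to order \<open>N\<close>, among the functions with a prescribed modulus of continuity.
\<close>

lemma test_functions_separable:
  obtains e :: "nat \<Rightarrow> (real ^ 'd::finite \<Rightarrow> real)"
  where "\<And>i. e i \<in> test_functions"
    and "\<And>f N \<epsilon>. f \<in> test_functions \<Longrightarrow> \<epsilon> > 0 \<Longrightarrow> \<exists>i. test_seminorm N (\<lambda>x. e i x - f x) < \<epsilon>"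
proof -
  have "\<forall>k::nat. \<exists>S. finite S \<and> S \<subseteq> cbox (0::real^'d) 1 \<and> cbox 0 1 \<subseteq> (\<Union>s\<in>S. ball s (1 / (k + 1)))"
    using compact_cbox[of "0::real^'d" 1] compact_imp_seq_compact seq_compact_imp_totally_bounded
    by (metis of_nat_0_le_iff add_nonneg_pos zero_less_divide_1_iff zero_less_one)
  then obtain S where S: "\<And>k. finite (S k)" "\<And>k. cbox (0::real^'d) 1 \<subseteq> (\<Union>s\<in>S k. ball s (1 / (real k + 1)))"
    by metis
  define L where "L N = {as :: 'd list. length as \<le> N}" for N :: nat
  \<comment> \<open>The table holds integers, namely values rounded down in units of
    \<open>1 / Suc n\<close>, on a finite index set. Hence only countably many tables occur.\<close>
  define code where "code N n k f = (\<lambda>p\<in>L N \<times> S k. \<lfloor>real (Suc n) * iter_partial (fst p) f (snd p)\<rfloor>)"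
    for N n k :: nat and f :: "real ^ 'd \<Rightarrow> real"
  define T where "T N n k = {f \<in> test_functions. \<forall>as\<in>L N. \<forall>x y. dist x y < 1 / (real k + 1) \<longrightarrow>
      \<bar>iter_partial as f x - iter_partial as f y\<bar> \<le> 1 / real (Suc n)}" for N n k :: nat
  define D where "D = (\<Union>N n k. inv_into (T N n k) (code N n k) ` code N n k ` T N n k)"
  have "countable (code N n k ` T N n k)" for N n k
  proof (rule countable_subset)
    show "code N n k ` T N n k \<subseteq> PiE (L N \<times> S k) (\<lambda>_. UNIV)"
      by (rule image_subsetI) (simp add: PiE_def code_def)
    show "countable (PiE (L N \<times> S k) (\<lambda>_. UNIV :: int set))"
      using finite_index_lists S(1) unfolding L_def by (intro countable_PiE) auto
  qed
  then have cD: "countable D" unfolding D_def by (intro countable_UN countable_image[of "code _ _ _ ` _"]) auto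
  have DT: "D \<subseteq> test_functions"
    unfolding D_def using inv_into_into[of _ "code _ _ _" "T _ _ _"] unfolding T_def by fastforce
  have dense: "\<exists>g\<in>D. test_seminorm N (\<lambda>x. g x - f x) < \<epsilon>" if f: "f \<in> test_functions" and \<epsilon>: "\<epsilon> > 0"
    for f :: "real ^ 'd \<Rightarrow> real" and N \<epsilon>
  proof -
    \<comment> \<open>The final error has three parts of size \<open>1 / Suc n\<close>: moving to a
      net point for \<open>f\<close>, moving to it for the representative, and the rounding
      there.\<close>
    obtain n :: nat where n: "3 / real (Suc n) < \<epsilon>"
      using reals_Archimedean[of "\<epsilon> / 3"] \<epsilon> by (auto simp: field_simps)
    have "\<exists>B. \<forall>as. B as > 0 \<and> (\<forall>x y. \<bar>iter_partial as f x - iter_partial as f y\<bar> \<le> B as * norm (x - y))"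
      using test_functions_lipschitz[OF test_functions_iter_partial[OF f]] by (intro choice allI) metis
    then obtain B where B: "\<And>as. B as > 0" 
      "\<And>as x y. \<bar>iter_partial as f x - iter_partial as f y\<bar> \<le> B as * norm (x - y)" by blast
    \<comment> \<open>The mesh is fine enough for the Lipschitz constants of all derivatives up to
      order \<open>N\<close> at once, so that \<open>f\<close> belongs to
      \<open>T N n k\<close>.\<close>
    obtain k :: nat where k: "sum B (L N) * real (Suc n) < real k" using reals_Archimedean2 by blast
    have fT: "f \<in> T N n k" unfolding T_def
    proof (intro CollectI conjI f ballI allI impI)
      fix as and x y :: "real ^ 'd" assume as: "as \<in> L N" and xy: "dist x y < 1 / (real k + 1)"
      have "B as \<le> sum B (L N)"
        using as finite_index_lists B(1) by (intro member_le_sum) (auto simp: L_def intro: less_imp_le)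
      then have "B as * real (Suc n) < real k + 1"
        using k mult_right_mono[of "B as" "sum B (L N)" "real (Suc n)"] by linarith
      then have "B as * (1 / (real k + 1)) \<le> 1 / real (Suc n)" by (simp add: field_simps)
      moreover have "B as * norm (x - y) \<le> B as * (1 / (real k + 1))"
        using xy B(1)[of as] by (intro mult_left_mono) (auto simp: dist_norm)
      ultimately show "\<bar>iter_partial as f x - iter_partial as f y\<bar> \<le> 1 / real (Suc n)"
        using B(2)[of as x y] by linarith
    qed
    define g where "g = inv_into (T N n k) (code N n k) (code N n k f)"
    have gD: "g \<in> D" unfolding D_def g_def using fT by blast
    have gT: "g \<in> T N n k" and gc: "code N n k g = code N n k f"
      unfolding g_def using fT by (simp_all add: inv_into_into f_inv_into_f)
    have g: "g \<in> test_functions" using gT unfolding T_def by blast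
    have "test_seminorm N (\<lambda>x. g x - f x) \<le> 3 / real (Suc n)"
    proof (rule test_seminorm_le)
      fix as :: "'d list" and x0 :: "real ^ 'd" assume "length as \<le> N"
      then have as: "as \<in> L N" unfolding L_def by simp
      \<comment> \<open>Periodicity moves the point into the cube that carries the net.\<close>
      obtain m where m: "x0 + int_vec m \<in> cbox 0 1" using ex_int_vec_unit_cube by blast
      define x where "x = x0 + int_vec m"
      obtain s where s: "s \<in> S k" "dist s x < 1 / (real k + 1)"
        using S(2)[of k] m unfolding x_def by auto
      have "\<lfloor>real (Suc n) * iter_partial as g s\<rfloor> = \<lfloor>real (Suc n) * iter_partial as f s\<rfloor>"
        using fun_cong[OF gc, of "(as, s)"] as s unfolding code_def by simp
      then have "\<bar>real (Suc n) * iter_partial as g s - real (Suc n) * iter_partial as f s\<bar> \<le> 1" by linarith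
      then have "\<bar>iter_partial as g s - iter_partial as f s\<bar> \<le> 1 / real (Suc n)"
        by (simp add: field_simps abs_le_iff)
      moreover have "\<bar>iter_partial as g s - iter_partial as g x\<bar> \<le> 1 / real (Suc n)"
        "\<bar>iter_partial as f s - iter_partial as f x\<bar> \<le> 1 / real (Suc n)"
        using gT fT as s unfolding T_def by auto
      ultimately have "\<bar>iter_partial as g x - iter_partial as f x\<bar> \<le> 3 * (1 / real (Suc n))" by linarith
      moreover have "iter_partial as g x = iter_partial as g x0" "iter_partial as f x = iter_partial as f x0"
        using periodic_iter_partial f g unfolding x_def test_functions_def periodic_def by blast+
      ultimately show "\<bar>iter_partial as (\<lambda>x. g x - f x) x0\<bar> \<le> 3 / real (Suc n)"
        using f g by (simp add: iter_partial_diff)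
    qed
    then show ?thesis using gD n by force
  qed
  then have "D \<noteq> {}" using test_functions_zero zero_less_one by blast
  then have r: "range (from_nat_into D) = D" using cD by (simp add: range_from_nat_into)
  show ?thesis
  proof (rule that[of "from_nat_into D"])
    show "from_nat_into D i \<in> test_functions" for i using r DT by blast
    fix f :: "real ^ 'd \<Rightarrow> real" and N and \<epsilon> :: real assume "f \<in> test_functions" "\<epsilon> > 0"
    then obtain g where "g \<in> D" "test_seminorm N (\<lambda>x. g x - f x) < \<epsilon>" using dense by blast
    then show "\<exists>i. test_seminorm N (\<lambda>x. from_nat_into D i x - f x) < \<epsilon>" using r by (metis imageE)
  qed
qed

text \<open>Both sides are continuous in \<open>f\<close>, the left by definition of the dual and
  the right because it is controlled by the supremum of the values. They agree on a dense
  set.\<close>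

lemma gen_function_eq_dirac_comb:
  fixes e :: "nat \<Rightarrow> (real ^ 'd::finite \<Rightarrow> real)" and t :: "nat \<Rightarrow> real"
  assumes e: "\<And>i. e i \<in> test_functions"
    and dense: "\<And>f N \<epsilon>. f \<in> test_functions \<Longrightarrow> \<epsilon> > 0 \<Longrightarrow> \<exists>i. test_seminorm N (\<lambda>x. e i x - f x) < \<epsilon>"
    and u: "u \<in> gen_functions"
    and eq: "\<And>i. u (e i) = (\<Sum>k<n. t k * e i (x k))"
    and f: "f \<in> test_functions"
  shows "u f = (\<Sum>k<n. t k * f (x k))"
proof -
  have "\<bar>u f - (\<Sum>k<n. t k * f (x k))\<bar> \<le> \<delta>" if \<delta>: "\<delta> > 0" for \<delta>
  proof -
    \<comment> \<open>The added 1 keeps \<open>R\<close> positive when all weights vanish.\<close>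
    define R where "R = (\<Sum>k<n. \<bar>t k\<bar>) + 1"
    have R: "R > 0" unfolding R_def by (intro add_nonneg_pos sum_nonneg) auto
    have "continuous_map test_topology euclideanreal u" using u unfolding gen_functions_def by blast
    then have "openin test_topology {g \<in> topspace test_topology. u g \<in> ball (u f) (\<delta> / 2)}" (is "openin _ ?U")
      by (rule openin_continuous_map_preimage) auto
    moreover have "f \<in> ?U" using f \<delta> topspace_test_topology by auto
    ultimately obtain N \<epsilon> where N: "\<epsilon> > 0"
      "\<And>g. g \<in> test_functions \<Longrightarrow> test_seminorm N (\<lambda>x. g x - f x) < \<epsilon> \<Longrightarrow> g \<in> ?U"
      by (rule openin_test_topology_contains_ball) blast
    obtain i where i: "test_seminorm N (\<lambda>x. e i x - f x) < min \<epsilon> (\<delta> / 2 / R)"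
      using dense[OF f, of "min \<epsilon> (\<delta> / 2 / R)"] N(1) \<delta> R by auto
    have "\<bar>u f - u (e i)\<bar> < \<delta> / 2" using N(2)[OF e, of i] i by (auto simp: dist_real_def)
    moreover have "\<bar>e i y - f y\<bar> \<le> \<delta> / 2 / R" for y
      using iter_partial_le_test_seminorm[OF test_functions_diff[OF e f], of "[]" N i y] i by auto
    then have "\<bar>\<Sum>k<n. t k * (e i (x k) - f (x k))\<bar> \<le> (\<Sum>k<n. \<bar>t k\<bar> * (\<delta> / 2 / R))"
      by (intro order_trans[OF sum_abs] sum_mono) (simp only: abs_mult mult_left_mono abs_ge_zero)
    then have "\<bar>u (e i) - (\<Sum>k<n. t k * f (x k))\<bar> \<le> (\<Sum>k<n. \<bar>t k\<bar>) * (\<delta> / 2 / R)"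
      unfolding eq by (simp only: sum_distrib_right right_diff_distrib sum_subtractf)
    moreover have "(\<Sum>k<n. \<bar>t k\<bar>) * (\<delta> / 2 / R) \<le> R * (\<delta> / 2 / R)"
      using \<delta> R unfolding R_def by (intro mult_right_mono) auto
    moreover have "R * (\<delta> / 2 / R) = \<delta> / 2" using R by simp
    ultimately show ?thesis by linarith
  qed
  then have "\<bar>u f - (\<Sum>k<n. t k * f (x k))\<bar> \<le> 0" by (rule field_le_epsilon) auto
  then show ?thesis by simp
qed

section \<open>Compound Poisson noises are Dirac combinations\<close>

lemma unit_cube_sets [measurable]: "{x :: real ^ 'd::finite. \<forall>a. 0 \<le> x $ a \<and> x $ a < 1} \<in> sets borel"
  by measurable

lemma emeasure_unit_cube: "emeasure lborel {x :: real ^ 'd::finite. \<forall>a. 0 \<le> x $ a \<and> x $ a < 1} = 1"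
proof -
  have one: "(1 :: real^'d) \<bullet> b = 1" if "b \<in> Basis" for b
    using that by (auto simp: Basis_vec_def inner_axis)
  have "emeasure lborel (box 0 (1::real^'d)) = 1" "emeasure lborel (cbox 0 (1::real^'d)) = 1"
    by (simp_all add: emeasure_lborel_box_eq emeasure_lborel_cbox_eq one)
  moreover have "emeasure lborel (box 0 (1::real^'d)) \<le> emeasure lborel {x :: real ^ 'd. \<forall>a. 0 \<le> x $ a \<and> x $ a < 1}"
    by (intro emeasure_mono) (auto simp: mem_box_cart less_imp_le)
  moreover have "emeasure lborel {x :: real ^ 'd. \<forall>a. 0 \<le> x $ a \<and> x $ a < 1} \<le> emeasure lborel (cbox 0 (1::real^'d))"
    by (intro emeasure_mono) (auto simp: mem_box_cart less_imp_le)
  ultimately show ?thesis by simp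
qed

lemma space_torus_measure: "space torus_measure = {x. \<forall>a. 0 \<le> x $ a \<and> x $ a < 1}"
  unfolding torus_measure_def by (simp add: space_restrict_space)

lemma prob_space_torus_measure: "prob_space (torus_measure :: (real ^ 'd::finite) measure)"
proof (rule prob_spaceI)
  show "emeasure torus_measure (space (torus_measure :: (real ^ 'd) measure)) = 1"
    unfolding space_torus_measure unfolding torus_measure_def
    by (subst emeasure_restrict_space) (auto simp: emeasure_unit_cube unit_cube_sets)
qed

lemma borel_measurable_torus_measure: "f \<in> borel_measurable borel \<Longrightarrow> f \<in> borel_measurable torus_measure"
  unfolding torus_measure_def by (intro measurable_restrict_space1) simp

lemma measurable_cylindrical_eval:
  assumes "f \<in> test_functions"
  shows "(\<lambda>u. u f) \<in> borel_measurable cylindrical"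
proof (rule measurableI)
  let ?G = "{{u \<in> gen_functions. (\<lambda>i\<in>{..<N}. u (\<phi> i)) \<in> B} | (N::nat) \<phi> B.
        (\<forall>i<N. \<phi> i \<in> test_functions) \<and> B \<in> sets (Pi\<^sub>M {..<N} (\<lambda>_. borel :: real measure))}
      :: ((real ^ 'd \<Rightarrow> real) \<Rightarrow> real) set set"
  have sub: "?G \<subseteq> Pow gen_functions" by auto
  have sp: "space cylindrical = (gen_functions :: ((real ^ 'd \<Rightarrow> real) \<Rightarrow> real) set)"
    unfolding cylindrical_def using sub by (rule space_measure_of)
  fix A :: "real set" assume A: "A \<in> sets borel"
  let ?B = "{g \<in> space (Pi\<^sub>M {..<Suc 0} (\<lambda>_. borel :: real measure)). g 0 \<in> A}"
  have B: "?B \<in> sets (Pi\<^sub>M {..<Suc 0} (\<lambda>_. borel :: real measure))"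
    using A by measurable
  have "(\<lambda>u. u f) -` A \<inter> space cylindrical = {u \<in> gen_functions. (\<lambda>i\<in>{..<Suc 0}. u f) \<in> ?B}"
    unfolding sp by (auto simp: space_PiM)
  also have "\<dots> \<in> ?G" using B assms by (intro CollectI exI[of _ "Suc 0"] exI[of _ "\<lambda>_. f"] exI[of _ ?B]) simp
  finally have "(\<lambda>u. u f) -` A \<inter> space cylindrical \<in> sets (sigma gen_functions ?G)"
    by (rule in_measure_of[OF sub])
  then show "(\<lambda>u. u f) -` A \<inter> space cylindrical \<in> sets cylindrical"
    unfolding cylindrical_def .
qed simp

lemma space_cylindrical: "space cylindrical = gen_functions"
  unfolding cylindrical_def by (rule space_measure_of) auto

section \<open>The compound Poisson model\<close>

lemma poisson_pgf:
  fixes z :: complex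
  assumes "c > 0"
  shows "(\<integral>n. z ^ n \<partial>measure_pmf (poisson_pmf c)) = exp (of_real c * (z - 1))"
proof -
  have "(\<integral>n. z ^ n \<partial>measure_pmf (poisson_pmf c)) = (\<integral>n. pmf (poisson_pmf c) n *\<^sub>R z ^ n \<partial>count_space UNIV)"
    unfolding measure_pmf_eq_density by (subst integral_density) auto
  also have "\<dots> = (\<integral>n. exp (- of_real c) * ((of_real c * z) ^ n /\<^sub>R fact n) \<partial>count_space UNIV)"
    using assms by (intro Bochner_Integration.integral_cong)
      (auto simp: scaleR_conv_of_real power_mult_distrib field_simps simp flip: exp_of_real)
  also have "\<dots> = exp (- of_real c) * exp (of_real c * z)"
  proof -
    have s: "(\<lambda>n. exp (- of_real c) * ((of_real c * z) ^ n /\<^sub>R fact n)) sums (exp (- of_real c) * exp (of_real c * z))"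
      by (intro sums_mult exp_converges)
    have "summable (\<lambda>n. norm (exp (- of_real c) * ((of_real c * z) ^ n /\<^sub>R fact n)))"
      unfolding norm_mult by (intro summable_mult summable_norm_exp)
    then show ?thesis
      using s sums_integral_count_space_nat integrable_count_space_nat_iff sums_unique2 by blast
  qed
  also have "\<dots> = exp (of_real c * (z - 1))" by (simp add: algebra_simps flip: exp_add)
  finally show ?thesis .
qed

text \<open>The integrand depends on the first \<open>n\<close> coordinates only, and their marginal
  is a finite product measure, over which the integral factors.\<close>

lemma integral_PiM_power:
  fixes g :: "'a \<Rightarrow> complex"
  assumes "prob_space \<mu>" and g: "g \<in> borel_measurable \<mu>" "\<And>x. norm (g x) \<le> 1"
  shows "(\<integral>\<theta>. (\<Prod>k<n. g (\<theta> k)) \<partial>(\<Pi>\<^sub>M k\<in>(UNIV::nat set). \<mu>)) = (\<integral>x. g x \<partial>\<mu>) ^ n"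
proof -
  interpret prob_space \<mu> by fact
  interpret P: product_prob_space "\<lambda>_::nat. \<mu>" UNIV by unfold_locales
  have [measurable]: "(\<lambda>\<theta>. \<Prod>k<n. g (\<theta> k)) \<in> borel_measurable (PiM {..<n} (\<lambda>_. \<mu>))"
    using g(1) by measurable
  have "(\<integral>\<theta>. (\<Prod>k<n. g (\<theta> k)) \<partial>(\<Pi>\<^sub>M k\<in>(UNIV::nat set). \<mu>)) = 
        (\<integral>\<theta>. (\<Prod>k<n. g (restrict \<theta> {..<n} k)) \<partial>(\<Pi>\<^sub>M k\<in>(UNIV::nat set). \<mu>))"
    by simp
  also have "\<dots> = (\<integral>\<theta>. (\<Prod>k<n. g (\<theta> k)) \<partial>distr (\<Pi>\<^sub>M k\<in>(UNIV::nat set). \<mu>) (PiM {..<n} (\<lambda>_. \<mu>)) (\<lambda>\<theta>. restrict \<theta> {..<n}))"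
    by (subst integral_distr) (auto intro: measurable_restrict_subset)
  also have "\<dots> = (\<integral>\<theta>. (\<Prod>k<n. g (\<theta> k)) \<partial>PiM {..<n} (\<lambda>_. \<mu>))"
    by (subst P.distr_PiM_restrict_finite) auto
  also have "\<dots> = (\<Prod>k<n. (\<integral>x. g x \<partial>\<mu>))"
    using g by (intro P.product_integral_prod integrable_const_bound[where B=1]) auto
  finally show ?thesis by simp
qed

text \<open>For a fixed count \<open>n\<close> the integral is an n-th power, and averaging it over
  the count evaluates the Poisson generating function. An infinite sequence of marks lets all counts
  share one product space.\<close>

lemma integral_compound_poisson:
  fixes g :: "'a \<Rightarrow> complex"
  assumes \<mu>: "prob_space \<mu>" and c: "c > 0" and g: "g \<in> borel_measurable \<mu>" "\<And>x. norm (g x) \<le> 1"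
  shows "(\<integral>(n, \<theta>). (\<Prod>k<n. g (\<theta> k)) \<partial>(measure_pmf (poisson_pmf c) \<Otimes>\<^sub>M (\<Pi>\<^sub>M k\<in>(UNIV::nat set). \<mu>)))
    = exp (of_real c * ((\<integral>x. g x \<partial>\<mu>) - 1))"
proof -
  interpret prob_space \<mu> by fact
  interpret P: product_prob_space "\<lambda>_::nat. \<mu>" UNIV by unfold_locales
  interpret PP: pair_prob_space "measure_pmf (poisson_pmf c)" "\<Pi>\<^sub>M k\<in>(UNIV::nat set). \<mu>"
    by unfold_locales
  have sets: "sets (measure_pmf (poisson_pmf c) \<Otimes>\<^sub>M (\<Pi>\<^sub>M k\<in>(UNIV::nat set). \<mu>)) = 
     sets (count_space UNIV \<Otimes>\<^sub>M (\<Pi>\<^sub>M k\<in>(UNIV::nat set). \<mu>))"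
    by (intro sets_pair_measure_cong) auto
  have m: "(\<lambda>(n, \<theta>). (\<Prod>k<n. g (\<theta> k))) \<in> borel_measurable (measure_pmf (poisson_pmf c) \<Otimes>\<^sub>M (\<Pi>\<^sub>M k\<in>(UNIV::nat set). \<mu>))"
    unfolding measurable_cong_sets[OF sets refl]
    using g(1) by (intro measurable_pair_measure_countable1) auto
  have "integrable (measure_pmf (poisson_pmf c) \<Otimes>\<^sub>M (\<Pi>\<^sub>M k\<in>(UNIV::nat set). \<mu>)) (\<lambda>(n, \<theta>). (\<Prod>k<n. g (\<theta> k)))"
    using g(2) m by (intro PP.integrable_const_bound[where B=1] AE_I2)
      (auto intro!: prod_le_1 simp flip: prod_norm split: prod.split)
  from PP.integral_fst'[OF this]
  have "(\<integral>(n, \<theta>). (\<Prod>k<n. g (\<theta> k)) \<partial>(measure_pmf (poisson_pmf c) \<Otimes>\<^sub>M (\<Pi>\<^sub>M k\<in>(UNIV::nat set). \<mu>)))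
     = (\<integral>n. (\<integral>\<theta>. (\<Prod>k<n. g (\<theta> k)) \<partial>(\<Pi>\<^sub>M k\<in>(UNIV::nat set). \<mu>)) \<partial>measure_pmf (poisson_pmf c))"
    by simp
  also have "\<dots> = (\<integral>n. (\<integral>x. g x \<partial>\<mu>) ^ n \<partial>measure_pmf (poisson_pmf c))"
    using integral_PiM_power[OF \<mu> g] by simp
  also have "\<dots> = exp (of_real c * ((\<integral>x. g x \<partial>\<mu>) - 1))"
    by (rule poisson_pgf[OF c])
  finally show ?thesis .
qed

lemma gen_functions_linear:
  "u \<in> gen_functions \<Longrightarrow> f \<in> test_functions \<Longrightarrow> g \<in> test_functions \<Longrightarrow>
    u (\<lambda>x. a * f x + b * g x) = a * u f + b * u g"
  by (simp add: gen_functions_def)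

text \<open>By linearity, the joint characteristic function of the values \<open>u (e i)\<close>
  becomes the characteristic functional at a single test function.\<close>

lemma gen_functions_lin_comb:
  assumes u: "u \<in> gen_functions" and e: "\<And>i. e i \<in> test_functions"
  shows "(\<lambda>x. lin_comb l (\<lambda>i. e i x)) \<in> test_functions \<and> 
    u (\<lambda>x. lin_comb l (\<lambda>i. e i x)) = lin_comb l (\<lambda>i. u (e i))"
proof (induction l)
  case Nil
  \<comment> \<open>The zero function is written as a combination with zero coefficients, so that
    linearity gives the value 0.\<close>
  have "u (\<lambda>x. 0 * e 0 x + 0 * e 0 x) = 0 * u (e 0) + 0 * u (e 0)"
    by (rule gen_functions_linear[OF u e e])
  then show ?case using test_functions_zero by simp
next
  case (Cons p l)
  obtain a i where p: "p = (a, i)" by (cases p)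
  have eq: "(\<lambda>x. lin_comb (p # l) (\<lambda>i. e i x)) = (\<lambda>x. a * e i x + 1 * lin_comb l (\<lambda>i. e i x))"
    unfolding p by simp
  have "u (\<lambda>x. a * e i x + 1 * lin_comb l (\<lambda>i. e i x)) = a * u (e i) + 1 * u (\<lambda>x. lin_comb l (\<lambda>i. e i x))"
    using Cons by (intro gen_functions_linear[OF u e]) blast
  moreover have "(\<lambda>x. a * e i x + 1 * lin_comb l (\<lambda>i. e i x)) \<in> test_functions"
    using e Cons by (intro test_functions_lin_comb) auto
  ultimately show ?case unfolding eq using Cons p by simp
qed

lemma lin_comb_sum: "lin_comb l (\<lambda>i. \<Sum>k\<in>A. t k * g i k) = (\<Sum>k\<in>A. t k * lin_comb l (\<lambda>i. g i k))"
  by (induction l) (auto simp: sum.distrib algebra_simps sum_distrib_left)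

text \<open>For fixed \<open>n\<close> and amplitude bound \<open>K\<close> the parameter set is
  compact by Tychonoff, and \<open>h n\<close> is continuous coordinate by coordinate. So each piece
  of the countable union is compact, hence closed.\<close>

lemma sigma_compact_dirac_combs:
  fixes e :: "nat \<Rightarrow> (real ^ 'd::finite \<Rightarrow> real)"
  assumes "\<And>i. e i \<in> test_functions"
  defines "h \<equiv> \<lambda>(n::nat) (\<theta> :: nat \<Rightarrow> real \<times> (real ^ 'd)) i. \<Sum>k<n. fst (\<theta> k) * e i (snd (\<theta> k))"
  shows "(\<Union>n. \<Union>K. h n ` (UNIV \<rightarrow> {- real K..real K} \<times> cbox 0 1)) \<in> sets borel"
proof (intro sets.countable_UN'' countableI_type)
  fix n K :: nat
  have "compactin (product_topology (\<lambda>_::nat. euclidean) UNIV) (PiE UNIV (\<lambda>_. {- real K..real K} \<times> cbox (0::real^'d) 1))"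
    unfolding compactin_PiE by (auto simp: compact_Times)
  then have c: "compact (UNIV \<rightarrow> {- real K..real K} \<times> cbox (0::real^'d) 1 :: (nat \<Rightarrow> _) set)"
    unfolding euclidean_product_topology compactin_euclidean_iff PiE_UNIV_domain .
  have "continuous_on S (\<lambda>\<theta>. h n \<theta> i)" for S i
    unfolding h_def
    by (intro continuous_intros continuous_on_compose2[OF test_functions_continuous_on[OF assms(1), of UNIV]]
       continuous_on_subset[OF continuous_on_product_coordinates]) auto
  then have "compact (h n ` (UNIV \<rightarrow> {- real K..real K} \<times> cbox 0 1))"
    by (intro compact_continuous_image[OF _ c] continuous_on_coordinatewise_then_product)
  then show "h n ` (UNIV \<rightarrow> {- real K..real K} \<times> cbox 0 1) \<in> sets borel"
    by (intro borel_closed compact_imp_closed)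
qed

theorem compound_poisson_noise_dirac_comb:
  fixes M :: "'w measure" and w :: "'w \<Rightarrow> (real ^ 'd::finite \<Rightarrow> real) \<Rightarrow> real"
  assumes "compound_poisson_noise M w"
  shows "AE \<omega> in M. w \<omega> \<in> gen_functions \<and> (\<exists>(n::nat) (t :: nat \<Rightarrow> real) x. \<forall>f\<in>test_functions. w \<omega> f = (\<Sum>k<n. t k * f (x k)))"
proof -
  obtain c P where c: "c > 0" and P: "prob_space P" and sP: "sets P = sets (restrict_space borel (- {0::real}))"
    and char: "\<And>\<phi>. \<phi> \<in> test_functions \<Longrightarrow> char_functional M w \<phi> =
           exp (of_real c * (\<integral>r. (\<integral>t. iexp (t * \<phi> r) - 1 \<partial>P) \<partial>torus_measure))"
    using assms unfolding compound_poisson_noise_def by blast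
  have M: "prob_space M" and w: "w \<in> measurable M cylindrical"
    using assms unfolding compound_poisson_noise_def gen_periodic_process_def by blast+
  have wg: "w \<omega> \<in> gen_functions" if "\<omega> \<in> space M" for \<omega>
    using measurable_space[OF w that] space_cylindrical by blast
  obtain e :: "nat \<Rightarrow> (real ^ 'd \<Rightarrow> real)" where e: "\<And>i. e i \<in> test_functions"
    and dense: "\<And>f N \<epsilon>. f \<in> test_functions \<Longrightarrow> \<epsilon> > 0 \<Longrightarrow> \<exists>i. test_seminorm N (\<lambda>x. e i x - f x) < \<epsilon>"
    using test_functions_separable by blast
  define T where "T = (torus_measure :: (real ^ 'd) measure)"
  interpret M: prob_space M by fact
  interpret P: prob_space P by fact
  interpret T: prob_space T unfolding T_def by (rule prob_space_torus_measure)
  interpret PT: pair_prob_space P T by unfold_locales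
  define \<mu> where "\<mu> = P \<Otimes>\<^sub>M T"
  have \<mu>: "prob_space \<mu>" unfolding \<mu>_def by unfold_locales
  interpret \<mu>: prob_space \<mu> by fact
  have [measurable]: "(\<lambda>x. x) \<in> borel_measurable P"
    unfolding measurable_cong_sets[OF sP refl] by (intro measurable_restrict_space1) simp
  have [measurable]: "(\<lambda>x. x) \<in> borel_measurable T"
    unfolding T_def by (intro borel_measurable_torus_measure) simp
  have [measurable]: "fst \<in> borel_measurable \<mu>" "snd \<in> borel_measurable \<mu>"
    unfolding \<mu>_def by (auto intro: measurable_compose[OF measurable_fst] measurable_compose[OF measurable_snd])
  \<comment> \<open>A sample of the model is a Poisson count together with a sequence of independent
    pairs of amplitude and location.\<close>
  define Q where "Q = measure_pmf (poisson_pmf c) \<Otimes>\<^sub>M (\<Pi>\<^sub>M k\<in>(UNIV::nat set). \<mu>)"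
  interpret PP: product_prob_space "\<lambda>_::nat. \<mu>" UNIV by unfold_locales
  interpret PQ: pair_prob_space "measure_pmf (poisson_pmf c)" "\<Pi>\<^sub>M k\<in>(UNIV::nat set). \<mu>" by unfold_locales
  have Q: "prob_space Q" unfolding Q_def by unfold_locales
  define h where "h = (\<lambda>n (\<theta> :: nat \<Rightarrow> real \<times> (real^'d)) i. \<Sum>k<n. fst (\<theta> k) * e i (snd (\<theta> k)))"
  define X where "X = (\<lambda>\<omega> i. w \<omega> (e i))"
  define Y where "Y = (\<lambda>(n, \<theta>). h n \<theta>)"
  have mX: "X \<in> borel_measurable M"
    unfolding X_def
    by (intro measurable_coordinatewise_then_product measurable_compose[OF w measurable_cylindrical_eval[OF e]])
  have sQ: "sets Q = sets (count_space UNIV \<Otimes>\<^sub>M (\<Pi>\<^sub>M k\<in>(UNIV::nat set). \<mu>))"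
    unfolding Q_def by (intro sets_pair_measure_cong) auto
  have mY: "Y \<in> borel_measurable Q"
    unfolding measurable_cong_sets[OF sQ refl] Y_def h_def
  proof (intro measurable_pair_measure_countable1)
    fix n :: nat
    have [measurable]: "e i \<in> borel_measurable borel" for i using e test_functions_measurable by blast
    show "(\<lambda>y. case (n, y) of (n, \<theta>) \<Rightarrow> \<lambda>i. \<Sum>k<n. fst (\<theta> k) * e i (snd (\<theta> k))) \<in> borel_measurable (\<Pi>\<^sub>M k\<in>UNIV. \<mu>)"
      by (simp, intro measurable_coordinatewise_then_product) measurable
  qed simp
  have "distr M borel X = distr Q borel Y"
  proof (rule distr_eq_if_char_eq[OF M Q mX mY])
    fix l
    define f where "f = (\<lambda>x. lin_comb l (\<lambda>i. e i x))"
    \<comment> \<open>\<open>gen_functions_lin_comb\<close> is applied to some generalized function;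
      any realization of the noise serves.\<close>
    obtain \<omega> where "\<omega> \<in> space M" using M.not_empty by blast
    then have f: "f \<in> test_functions" unfolding f_def using gen_functions_lin_comb[OF wg, where e=e, OF _ e] by blast
    have [measurable]: "f \<in> borel_measurable borel" using test_functions_measurable[OF f] .
    define g where "g = (\<lambda>p. iexp (fst p * f (snd p)))"
    have g: "g \<in> borel_measurable \<mu>" unfolding g_def by measurable
    have gn: "norm (g p) \<le> 1" for p unfolding g_def by (simp only: norm_exp_i_times)
    have ig: "integrable \<mu> g" using g gn by (intro \<mu>.integrable_const_bound[where B=1]) auto
    have "(\<integral>\<omega>. iexp (lin_comb l (X \<omega>)) \<partial>M) = char_functional M w f"
      unfolding char_functional_def X_def f_def
      using gen_functions_lin_comb[OF wg, where e=e, OF _ e] by (intro Bochner_Integration.integral_cong) auto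
    \<comment> \<open>Fubini identifies the iterated integral with an integral over
      \<open>\<mu>\<close>. As \<open>P\<close> and \<open>T\<close> have mass 1, the constant 1 can
      be subtracted at the end.\<close>
    also have "\<dots> = exp (of_real c * ((\<integral>p. g p \<partial>\<mu>) - 1))"
    proof -
      have "(\<integral>p. g p \<partial>\<mu>) = (\<integral>r. (\<integral>t. g (t, r) \<partial>P) \<partial>T)"
        using PT.integral_snd[of "\<lambda>t r. g (t, r)"] ig unfolding \<mu>_def by simp
      moreover have "(\<integral>t. iexp (t * f r) - 1 \<partial>P) = (\<integral>t. g (t, r) \<partial>P) - 1" for r
      proof -
        have "integrable P (\<lambda>t. iexp (t * f r))"
          by (intro P.integrable_const_bound[where B=1]) (auto simp del: of_real_mult)
        then show ?thesis unfolding g_def by (subst Bochner_Integration.integral_diff) (auto simp: P.prob_space)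
      qed
      moreover have "(\<integral>r. (\<integral>t. g (t, r) \<partial>P) - 1 \<partial>T) = (\<integral>r. (\<integral>t. g (t, r) \<partial>P) \<partial>T) - 1"
        using PT.integrable_snd[of "\<lambda>t r. g (t, r)"] ig unfolding \<mu>_def
        by (subst Bochner_Integration.integral_diff) (auto simp: T.prob_space)
      ultimately show ?thesis using char[OF f] unfolding T_def by simp
    qed
    also have "\<dots> = (\<integral>(n, \<theta>). (\<Prod>k<n. g (\<theta> k)) \<partial>Q)"
      unfolding Q_def by (rule integral_compound_poisson[OF \<mu> c g gn, symmetric])
    also have "\<dots> = (\<integral>\<omega>. iexp (lin_comb l (Y \<omega>)) \<partial>Q)"
    proof (intro Bochner_Integration.integral_cong refl)
      fix q :: "nat \<times> (nat \<Rightarrow> real \<times> (real^'d))"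
      obtain n \<theta> where q: "q = (n, \<theta>)" by (cases q)
      \<comment> \<open>The exponential of a sum over the atoms is the product of the factors
        \<open>g\<close>.\<close>
      have "lin_comb l (Y q) = (\<Sum>k<n. fst (\<theta> k) * f (snd (\<theta> k)))"
        unfolding q Y_def h_def f_def using lin_comb_sum by auto
      then show "(case q of (n, \<theta>) \<Rightarrow> \<Prod>k<n. g (\<theta> k)) = iexp (lin_comb l (Y q))"
        unfolding q g_def by (simp add: sum_distrib_left flip: exp_sum)
    qed
    finally show "(\<integral>\<omega>. iexp (lin_comb l (X \<omega>)) \<partial>M) = (\<integral>\<omega>. iexp (lin_comb l (Y \<omega>)) \<partial>Q)" .
  qed
  define C where "C = (\<Union>n. \<Union>K. h n ` (UNIV \<rightarrow> {- real K..real K} \<times> cbox 0 1))"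
  have C: "C \<in> sets borel" unfolding C_def h_def by (rule sigma_compact_dirac_combs[OF e])
  have "Y q \<in> C" if "q \<in> space Q" for q
  proof -
    obtain n \<theta> where q: "q = (n, \<theta>)" by (cases q)
    have "\<theta> \<in> space (\<Pi>\<^sub>M k\<in>(UNIV::nat set). \<mu>)" using that unfolding q Q_def by (simp add: space_pair_measure)
    then have \<theta>: "snd (\<theta> k) \<in> cbox 0 1" for k
      unfolding space_PiM \<mu>_def T_def by (auto simp: space_pair_measure space_torus_measure PiE_iff mem_box_cart less_imp_le)
         (metis (no_types, lifting) mem_Sigma_iff mem_Collect_eq prod.collapse less_imp_le)+
    obtain K :: nat where K: "(\<Sum>k<n. \<bar>fst (\<theta> k)\<bar>) \<le> real K" using real_arch_simple by blast
    \<comment> \<open>The compact parameter set bounds every coordinate, whereas \<open>K\<close>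
      bounds the first \<open>n\<close> amplitudes. The remaining entries are reset to zero, which
      leaves the value of \<open>h n\<close> unchanged.\<close>
    define \<theta>' where "\<theta>' k = (if k < n then \<theta> k else 0)" for k
    have "\<bar>fst (\<theta>' k)\<bar> \<le> real K" for k
    proof (cases "k < n")
      case True
      then have "\<bar>fst (\<theta> k)\<bar> \<le> (\<Sum>k<n. \<bar>fst (\<theta> k)\<bar>)" by (intro member_le_sum) auto
      then show ?thesis using K True unfolding \<theta>'_def by simp
    qed (auto simp: \<theta>'_def)
    then have "fst (\<theta>' k) \<in> {- real K..real K}" for k by (auto simp: abs_le_iff) (metis minus_le_iff)
    moreover have "snd (\<theta>' k) \<in> cbox 0 1" for k using \<theta> unfolding \<theta>'_def by (auto simp: mem_box_cart)
    ultimately have "\<theta>' \<in> UNIV \<rightarrow> {- real K..real K} \<times> cbox 0 1" by (auto simp: mem_Times_iff)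
    moreover have "Y q = h n \<theta>'" unfolding q Y_def h_def \<theta>'_def by (auto intro!: sum.cong)
    ultimately show ?thesis unfolding C_def by blast
  qed
  then have "AE q in Q. Y q \<in> C" by auto
  then have "AE y in distr Q borel Y. y \<in> C" using mY C by (subst AE_distr_iff) auto
  then have "AE y in distr M borel X. y \<in> C" by (subst \<open>distr M borel X = distr Q borel Y\<close>)
  then have "AE \<omega> in M. X \<omega> \<in> C" using mX C by (subst (asm) AE_distr_iff) auto
  with AE_space show ?thesis
  proof eventually_elim
    case (elim \<omega>)
    then obtain n \<theta> where "X \<omega> = h n \<theta>" unfolding C_def by blast
    then have eq: "w \<omega> (e i) = (\<Sum>k<n. fst (\<theta> k) * e i (snd (\<theta> k)))" for i
      unfolding X_def h_def by metis
    have "w \<omega> f = (\<Sum>k<n. fst (\<theta> k) * f (snd (\<theta> k)))" if "f \<in> test_functions" for f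
      by (rule gen_function_eq_dirac_comb[OF e dense wg[OF elim(1)] eq that])
    then have "\<forall>f\<in>test_functions. w \<omega> f = (\<Sum>k<n. (\<lambda>k. fst (\<theta> k)) k * f ((\<lambda>k. snd (\<theta> k)) k))"
      by simp
    then show ?case using wg[OF elim(1)] by (intro conjI exI)
  qed
qed

section \<open>Reproducing kernels in dimension one\<close>

text \<open>Continuity lets completeness of the basis, which concerns almost every point, yield
  identities at every point; compact support makes all products integrable.\<close>

definition cts_compact :: "(real \<Rightarrow> real) \<Rightarrow> bool" where
  "cts_compact f \<longleftrightarrow> continuous_on UNIV f \<and> (\<exists>r. \<forall>x. f x \<noteq> 0 \<longrightarrow> \<bar>x\<bar> \<le> r)"

lemma cts_compact_continuous: "cts_compact f \<Longrightarrow> continuous_on UNIV f" unfolding cts_compact_def by blast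

lemma cts_compact_measurable [measurable_dest]: "cts_compact f \<Longrightarrow> f \<in> borel_measurable borel"
  by (intro borel_measurable_continuous_onI cts_compact_continuous)

lemma cts_compact_integrable: assumes "cts_compact f" shows "integrable lborel f"
proof -
  obtain r where r: "\<And>x. f x \<noteq> 0 \<Longrightarrow> \<bar>x\<bar> \<le> r" using assms unfolding cts_compact_def by blast
  have "integrable lborel (\<lambda>x. indicator {-r..r} x *\<^sub>R f x)"
    using assms by (intro borel_integrable_compact) (auto simp: cts_compact_def intro: continuous_on_subset)
  moreover have "(\<lambda>x. indicator {-r..r} x *\<^sub>R f x) = f"
    using r by (fastforce simp: indicator_def abs_le_iff)
  ultimately show ?thesis by simp
qed

lemma cts_compact_add: assumes "cts_compact f" "cts_compact g" shows "cts_compact (\<lambda>x. f x + g x)"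
proof -
  obtain r s where "\<forall>x. f x \<noteq> 0 \<longrightarrow> \<bar>x\<bar> \<le> r" "\<forall>x. g x \<noteq> 0 \<longrightarrow> \<bar>x\<bar> \<le> s"
    using assms unfolding cts_compact_def by blast
  then have "\<forall>x. f x + g x \<noteq> 0 \<longrightarrow> \<bar>x\<bar> \<le> max r s" by (metis add_0 le_max_iff_disj)
  then show ?thesis using assms unfolding cts_compact_def by (auto intro!: continuous_intros)
qed

lemma cts_compact_mult_continuous: "cts_compact f \<Longrightarrow> continuous_on UNIV g \<Longrightarrow> cts_compact (\<lambda>x. f x * g x)"
  unfolding cts_compact_def by (auto intro!: continuous_intros)

lemma cts_compact_mult: "cts_compact f \<Longrightarrow> cts_compact g \<Longrightarrow> cts_compact (\<lambda>x. f x * g x)"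
  by (intro cts_compact_mult_continuous cts_compact_continuous)

lemma cts_compact_cmult: "cts_compact f \<Longrightarrow> cts_compact (\<lambda>x. c * f x)"
  using cts_compact_mult_continuous[of f "\<lambda>_. c"] by (simp add: mult.commute)

lemma cts_compact_zero: "cts_compact (\<lambda>_. 0)" unfolding cts_compact_def by simp

lemma cts_compact_sum: "(\<And>i. i \<in> I \<Longrightarrow> cts_compact (f i)) \<Longrightarrow> cts_compact (\<lambda>x. \<Sum>i\<in>I. f i x)"
  by (induction I rule: infinite_finite_induct) (auto intro: cts_compact_zero cts_compact_add)

lemma cts_compact_diff: "cts_compact f \<Longrightarrow> cts_compact g \<Longrightarrow> cts_compact (\<lambda>x. f x - g x)"
  using cts_compact_add[of f "\<lambda>x. (-1) * g x"] cts_compact_cmult[of g "-1"] by simp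

lemma cts_compact_affine:
  assumes "cts_compact f" "c \<noteq> 0"
  shows "cts_compact (\<lambda>x. f (c * x + t))"
proof -
  obtain r where r: "\<And>x. f x \<noteq> 0 \<Longrightarrow> \<bar>x\<bar> \<le> r" using assms unfolding cts_compact_def by blast
  have "\<bar>x\<bar> \<le> (r + \<bar>t\<bar>) / \<bar>c\<bar>" if "f (c * x + t) \<noteq> 0" for x
  proof -
    have "\<bar>c\<bar> * \<bar>x\<bar> \<le> r + \<bar>t\<bar>" using r[OF that] unfolding abs_mult[symmetric] by linarith
    then show ?thesis using assms(2) by (simp add: field_simps)
  qed
  moreover have "continuous_on UNIV (\<lambda>x. f (c * x + t))"
    by (rule continuous_on_compose2[OF cts_compact_continuous[OF assms(1)]]) (auto intro!: continuous_intros)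
  ultimately show ?thesis unfolding cts_compact_def by blast
qed

text \<open>The set where a continuous function does not vanish is open, and a nonempty open set is
  not negligible.\<close>

lemma continuous_AE_zero:
  fixes f :: "real \<Rightarrow> real"
  assumes "continuous_on UNIV f" "AE x in lborel. f x = 0"
  shows "f x = 0"
proof (rule ccontr)
  assume "f x \<noteq> 0"
  have "open {x. f x \<noteq> 0}"
    using open_Collect_neq[OF assms(1) continuous_on_const] by simp
  moreover have "{x. f x \<noteq> 0} \<in> null_sets lborel"
    using assms(2) \<open>open {x. f x \<noteq> 0}\<close> by (subst AE_iff_null_sets) auto
  then have "negligible {x. f x \<noteq> 0}"
    unfolding negligible_iff_null_sets by (rule null_sets_completionI)
  ultimately show False
    using open_not_negligible \<open>f x \<noteq> 0\<close> by blast
qed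

text \<open>A common radius \<open>R\<close> and bound \<open>B\<close> for both genders keep the
  later constants uniform; any system of regularity at least 1 provides them.\<close>

locale wavelet_1d =
  fixes \<psi> :: "gender \<Rightarrow> real \<Rightarrow> real" and R B :: real
  assumes \<psi>_continuous: "continuous_on UNIV (\<psi> g)"
    and \<psi>_support: "\<psi> g x \<noteq> 0 \<Longrightarrow> \<bar>x\<bar> \<le> R"
    and \<psi>_bound: "\<bar>\<psi> g x\<bar> \<le> B"
    and R_pos: "R > 0" and B_pos: "B > 0"
    and mother_integral: "(\<integral>x. \<psi> Mother x \<partial>lborel) = 0"
    and basis: "orthonormal_basis_L2 (wavelet_family_1d \<psi>)"
begin

section \<open>Translates, dilates and the two-scale relation\<close>

definition wv :: "gender \<Rightarrow> nat \<Rightarrow> int \<Rightarrow> real \<Rightarrow> real" where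
  "wv g n m x = 2 powr (real n / 2) * \<psi> g (2 ^ n * x - of_int m)"

definition ip :: "(real \<Rightarrow> real) \<Rightarrow> (real \<Rightarrow> real) \<Rightarrow> real" where
  "ip f h = (\<integral>x. f x * h x \<partial>lborel)"

text \<open>Integer translates outside the window vanish at \<open>x\<close>, so sums over it stand
  for sums over all integers and stay finite.\<close>

definition window :: "nat \<Rightarrow> real \<Rightarrow> int set" where
  "window n x = {m. \<bar>2 ^ n * x - of_int m\<bar> \<le> R}"

lemma finite_window: "finite (window n x)"
  unfolding window_def
  by (rule finite_subset[of _ "{\<lceil>2 ^ n * x - R\<rceil>..\<lfloor>2 ^ n * x + R\<rfloor>}"])
     (auto simp: ceiling_le_iff le_floor_iff abs_le_iff)

text \<open>A closed interval of length \<open>2 * R\<close> contains at most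
  \<open>2 * R + 1\<close> integers.\<close>

lemma card_window: "real (card (window n x)) \<le> 2 * R + 1"
proof -
  have "window n x \<subseteq> {\<lceil>2 ^ n * x - R\<rceil>..\<lfloor>2 ^ n * x + R\<rfloor>}"
    unfolding window_def by (auto simp: ceiling_le_iff le_floor_iff abs_le_iff)
  then have "card (window n x) \<le> card {\<lceil>2 ^ n * x - R\<rceil>..\<lfloor>2 ^ n * x + R\<rfloor>}"
    by (intro card_mono) auto
  then have "real (card (window n x)) \<le> real (nat (\<lfloor>2 ^ n * x + R\<rfloor> - \<lceil>2 ^ n * x - R\<rceil> + 1))"
    by simp
  also have "\<dots> \<le> 2 * R + 1" using R_pos by (cases "\<lfloor>2 ^ n * x + R\<rfloor> - \<lceil>2 ^ n * x - R\<rceil> + 1 \<ge> 0") (simp; linarith)+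
  finally show ?thesis .
qed

lemma wv_nonzero_window: "wv g n m x \<noteq> 0 \<Longrightarrow> m \<in> window n x"
  unfolding wv_def window_def using \<psi>_support by auto

lemma wv_bound: "\<bar>wv g n m x\<bar> \<le> 2 powr (real n / 2) * B"
  unfolding wv_def abs_mult using \<psi>_bound by (intro mult_mono) auto

lemma cts_compact_\<psi>: "cts_compact (\<psi> g)"
  unfolding cts_compact_def using \<psi>_continuous \<psi>_support by blast

lemma cts_compact_wv: "cts_compact (wv g n m)"
  unfolding wv_def using cts_compact_affine[OF cts_compact_\<psi>, of "2 ^ n" g "- of_int m"]
  by (intro cts_compact_cmult) simp

lemma wv_scale: "wv g (n + k) m x = 2 powr (real n / 2) * wv g k m (2 ^ n * x)"
  unfolding wv_def by (simp add: power_add ac_simps add_divide_distrib powr_add)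

lemma window_scale: "window (n + k) x = window k (2 ^ n * x)"
  unfolding window_def by (simp add: power_add ac_simps)

lemma ip_commute: "ip f h = ip h f" unfolding ip_def by (simp add: mult.commute)

lemma ip_add: "cts_compact f \<Longrightarrow> cts_compact g \<Longrightarrow> cts_compact h \<Longrightarrow> ip (\<lambda>x. f x + g x) h = ip f h + ip g h"
  unfolding ip_def by (simp add: distrib_right cts_compact_integrable cts_compact_mult)

lemma ip_diff: "cts_compact f \<Longrightarrow> cts_compact g \<Longrightarrow> cts_compact h \<Longrightarrow> ip (\<lambda>x. f x - g x) h = ip f h - ip g h"
  unfolding ip_def by (simp add: left_diff_distrib cts_compact_integrable cts_compact_mult)

lemma ip_sum: "(\<And>i. i \<in> I \<Longrightarrow> cts_compact (f i)) \<Longrightarrow> cts_compact h \<Longrightarrow> ip (\<lambda>x. \<Sum>i\<in>I. c i * f i x) h = (\<Sum>i\<in>I. c i * ip (f i) h)"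
  unfolding ip_def sum_distrib_right
  by (subst Bochner_Integration.integral_sum) (auto simp: mult.assoc intro!: cts_compact_integrable cts_compact_cmult cts_compact_mult)

lemma integral_dilate: "(\<integral>x. f (2 ^ n * x) \<partial>lborel) = (\<integral>x. f x \<partial>lborel) / 2 ^ n" for f :: "real \<Rightarrow> real"
  using lborel_integral_real_affine[of "2 ^ n" f 0] by simp

lemma powr_half: "2 powr (real n / 2) * 2 powr (real n / 2) = (2::real) ^ n"
  by (simp flip: powr_add add: powr_realpow)

lemma ip_wv_scale: "ip (wv g (n + k) m) (wv h (n + l) m') = ip (wv g k m) (wv h l m')"
proof -
  have "ip (wv g (n + k) m) (wv h (n + l) m') = (\<integral>x. 2 ^ n * (wv g k m (2 ^ n * x) * wv h l m' (2 ^ n * x)) \<partial>lborel)"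
    unfolding ip_def wv_scale powr_half[symmetric] by (simp add: ac_simps)
  also have "\<dots> = 2 ^ n * ((\<integral>x. wv g k m x * wv h l m' x \<partial>lborel) / 2 ^ n)"
    using integral_dilate[of "\<lambda>x. wv g k m x * wv h l m' x" n] by simp
  finally show ?thesis unfolding ip_def by simp
qed

lemma family_Inl: "wavelet_family_1d \<psi> (Inl m) = wv Father 0 m"
  unfolding wavelet_family_1d_def wv_def by auto

lemma family_Inr: "wavelet_family_1d \<psi> (Inr (j, m)) = wv Mother j m"
  unfolding wavelet_family_1d_def wv_def by auto

lemma ip_family: "ip (wavelet_family_1d \<psi> i) (wavelet_family_1d \<psi> i') = (if i = i' then 1 else 0)"
  using basis unfolding orthonormal_basis_L2_def ip_def by blast

text \<open>The basis contains the father at level 0 only. Inner products are invariant under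
  normalized dilation, so any level can be moved there.\<close>

lemma ip_same_level: "ip (wv g n m) (wv h n m') = (if g = h \<and> m = m' then 1 else 0)"
  using ip_wv_scale[of g n 0 m h 0 m'] ip_family[of "Inl m" "Inl m'"] ip_family[of "Inr (0, m)" "Inr (0, m')"]
    ip_family[of "Inl m" "Inr (0, m')"] ip_family[of "Inr (0, m)" "Inl m'"]
  unfolding family_Inl family_Inr by (cases g; cases h) auto

text \<open>The coarser function is dilated to level 0, where either gender belongs to the basis;
  the mother then sits at the positive level \<open>j - n\<close>.\<close>

lemma ip_higher_mother: "j > n \<Longrightarrow> ip (wv g n m) (wv Mother j m') = 0"
  using ip_wv_scale[of g n 0 m Mother "j - n" m'] ip_family[of "Inl m" "Inr (j - n, m')"]
    ip_family[of "Inr (0, m)" "Inr (j - n, m')"]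
  unfolding family_Inl family_Inr by (cases g) auto

lemma cts_compact_square_integrable: "cts_compact f \<Longrightarrow> integrable lborel (\<lambda>x. (f x)\<^sup>2)"
  unfolding power2_eq_square by (intro cts_compact_integrable cts_compact_mult)

lemma complete:
  assumes f: "cts_compact f" and "\<And>m. ip f (wv Father 0 m) = 0" "\<And>j m. ip f (wv Mother j m) = 0"
  shows "f x = 0"
proof -
  have "(\<integral>x. f x * wavelet_family_1d \<psi> i x \<partial>lborel) = 0" for i
    using assms(2,3) family_Inl family_Inr unfolding ip_def by (cases i) auto
  then have "AE x in lborel. f x = 0"
    using basis cts_compact_square_integrable[OF f] cts_compact_measurable[OF f]
    unfolding orthonormal_basis_L2_def by simp
  then show ?thesis by (rule continuous_AE_zero[OF cts_compact_continuous[OF f]])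
qed

text \<open>Stretching \<open>f\<close> by 2 lowers every level by one, so orthogonality from level
  1 on becomes orthogonality to the whole basis.\<close>

lemma complete_dilated:
  assumes f: "cts_compact f" and "\<And>m. ip f (wv Father 1 m) = 0" "\<And>j m. j \<ge> 1 \<Longrightarrow> ip f (wv Mother j m) = 0"
  shows "f x = 0"
proof -
  have cch: "cts_compact (\<lambda>x. f (x / 2))" using cts_compact_affine[OF f, of "1/2" 0] by simp
  have "ip (\<lambda>x. f (x / 2)) (wv g j m) = 0" if "ip f (wv g (Suc j) m) = 0" for g j m
  proof -
    have "0 = (\<integral>x. f (2 ^ 1 * x / 2) * (2 powr (1/2) * wv g j m (2 ^ 1 * x)) \<partial>lborel)"
      using that wv_scale[of g 1 j m] unfolding ip_def by simp
    also have "\<dots> = (\<integral>x. f (x / 2) * (2 powr (1/2) * wv g j m x) \<partial>lborel) / 2 ^ 1"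
      by (rule integral_dilate)
    also have "\<dots> = 2 powr (1/2) * ip (\<lambda>x. f (x / 2)) (wv g j m) / 2"
      unfolding ip_def by (simp add: mult.left_commute flip: integral_mult_right_zero)
    finally show ?thesis by simp
  qed
  then have "f (2 * x / 2) = 0" using assms by (intro complete[OF cch]) auto
  then show ?thesis by simp
qed

lemma wv_overlap_finite:
  assumes "cts_compact f"
  obtains N where "\<And>m. m \<notin> {- N..N} \<Longrightarrow> ip f (wv g n m) = 0"
proof -
  obtain r where r: "\<And>x. f x \<noteq> 0 \<Longrightarrow> \<bar>x\<bar> \<le> r" using assms unfolding cts_compact_def by blast
  have zero: "f x * wv g n m x = 0" if m: "m \<notin> {- \<lceil>2 ^ n * r + R\<rceil>..\<lceil>2 ^ n * r + R\<rceil>}" for m x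
  proof (rule ccontr)
    assume *: "f x * wv g n m x \<noteq> 0"
    then have "\<bar>x\<bar> \<le> r" "\<bar>2 ^ n * x - of_int m\<bar> \<le> R"
      using r wv_nonzero_window[of g n m x] unfolding window_def by auto
    then have "\<bar>2 ^ n * x\<bar> \<le> 2 ^ n * r" by (simp add: abs_mult)
    then have "\<bar>of_int m\<bar> \<le> 2 ^ n * r + R" using \<open>\<bar>2 ^ n * x - of_int m\<bar> \<le> R\<close> by linarith
    then have "\<bar>m\<bar> \<le> \<lceil>2 ^ n * r + R\<rceil>" by linarith
    then show False using m by auto
  qed
  then have "ip f (wv g n m) = 0" if "m \<notin> {- \<lceil>2 ^ n * r + R\<rceil>..\<lceil>2 ^ n * r + R\<rceil>}" for m
    unfolding ip_def zero[OF that] by simp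
  then show ?thesis by (rule that)
qed

text \<open>Exchanges the moving window for an index set independent of \<open>x\<close>, for which
  inner products of the sum, as a function of \<open>x\<close>, can be taken termwise.\<close>

lemma sum_window_eq:
  assumes "finite S" "\<And>m. m \<notin> S \<Longrightarrow> c m = 0"
  shows "(\<Sum>m\<in>window n x. c m * wv g n m x) = (\<Sum>m\<in>S. c m * wv g n m x)"
proof -
  have "(\<Sum>m\<in>window n x. c m * wv g n m x) = (\<Sum>m\<in>window n x \<inter> S. c m * wv g n m x)"
    using assms finite_window by (intro sum.mono_neutral_right) auto
  also have "\<dots> = (\<Sum>m\<in>S. c m * wv g n m x)"
    using assms finite_window wv_nonzero_window by (intro sum.mono_neutral_left) auto
  finally show ?thesis .
qed

text \<open>The difference \<open>D\<close> is orthogonal to the fathers of level 1 by construction,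
  and to all mothers from level 1 on by orthogonality between levels;
  \<open>complete_dilated\<close> then makes it zero.\<close>

lemma two_scale: "wv g 0 m x = (\<Sum>k\<in>window 1 x. ip (wv g 0 m) (wv Father 1 k) * wv Father 1 k x)"
proof -
  let ?f = "wv g 0 m"
  obtain N where N: "\<And>k. k \<notin> {- N..N} \<Longrightarrow> ip ?f (wv Father 1 k) = 0"
    using wv_overlap_finite[OF cts_compact_wv] by blast
  define D where "D x = ?f x - (\<Sum>k\<in>{-N..N}. ip ?f (wv Father 1 k) * wv Father 1 k x)" for x
  have ccP: "cts_compact (\<lambda>x. \<Sum>k\<in>{-N..N}. ip ?f (wv Father 1 k) * wv Father 1 k x)"
    by (intro cts_compact_sum cts_compact_cmult cts_compact_wv)
  have D: "cts_compact D" unfolding D_def by (intro cts_compact_diff cts_compact_wv ccP)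
  have ipD: "ip D h = ip ?f h - (\<Sum>k\<in>{-N..N}. ip ?f (wv Father 1 k) * ip (wv Father 1 k) h)" if "cts_compact h" for h
    unfolding D_def ip_diff[OF cts_compact_wv ccP that] ip_sum[OF cts_compact_wv that] ..
  have "D x = 0"
  proof (rule complete_dilated[OF D])
    fix k
    have "(\<Sum>k'\<in>{-N..N}. ip ?f (wv Father 1 k') * ip (wv Father 1 k') (wv Father 1 k)) =
        (\<Sum>k'\<in>{-N..N}. if k' = k then ip ?f (wv Father 1 k) else 0)"
      by (intro sum.cong) (auto simp: ip_same_level)
    also have "\<dots> = ip ?f (wv Father 1 k)" using N[of k] by (simp add: sum.delta')
    finally show "ip D (wv Father 1 k) = 0" using ipD[OF cts_compact_wv] by simp
  next
    fix j k assume j: "(j::nat) \<ge> 1"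
    have "ip (wv Father 1 k') (wv Mother j k) = 0" for k'
      using ip_same_level[of Father 1 k' Mother k] ip_higher_mother[of 1 j Father k' k] j
      by (cases "j = 1") auto
    then show "ip D (wv Mother j k) = 0"
      using j ipD[OF cts_compact_wv, of Mother j k] ip_higher_mother[of 0 j g m k] by simp
  qed
  then show ?thesis unfolding D_def using sum_window_eq[where S="{-N..N}" and c="\<lambda>k. ip ?f (wv Father 1 k)" and n=1 and g=Father and x=x] N by simp
qed

text \<open>The integral kernel of the orthogonal projection onto the span of the translates at
  level \<open>n\<close>.\<close>

definition kernel :: "gender \<Rightarrow> nat \<Rightarrow> real \<Rightarrow> real \<Rightarrow> real" where
  "kernel g n x y = (\<Sum>m\<in>window n x. wv g n m x * wv g n m y)"

lemma kernel_scale: "kernel g (n + k) x y = 2 ^ n * kernel g k (2 ^ n * x) (2 ^ n * y)"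
  unfolding kernel_def window_scale wv_scale sum_distrib_left
  by (intro sum.cong refl) (simp add: powr_half[symmetric] ac_simps)

lemma cts_compact_kernel: "cts_compact (kernel g n x)"
  unfolding kernel_def by (intro cts_compact_sum cts_compact_cmult cts_compact_wv)

lemma ip_kernel: "cts_compact h \<Longrightarrow> ip (kernel g n x) h = (\<Sum>m\<in>window n x. wv g n m x * ip (wv g n m) h)"
  unfolding kernel_def by (intro ip_sum cts_compact_wv)

text \<open>
  As a function of \<open>y\<close>, the difference of both sides is orthogonal to the whole wavelet basis.
\<close>

lemma kernel_split_0: "kernel Father 1 x y = kernel Father 0 x y + kernel Mother 0 x y"
proof -
  define h where "h y = kernel Father 1 x y - (kernel Father 0 x y + kernel Mother 0 x y)" for y
  have h: "cts_compact h" unfolding h_def by (intro cts_compact_diff cts_compact_add cts_compact_kernel)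
  have iph: "ip h f = ip (kernel Father 1 x) f - (ip (kernel Father 0 x) f + ip (kernel Mother 0 x) f)" if "cts_compact f" for f
    unfolding h_def using that by (subst ip_diff) (auto intro!: cts_compact_add cts_compact_kernel simp: ip_add cts_compact_kernel)
  have same: "ip (kernel g 0 x) (wv g' 0 m) = (if g = g' then wv g' 0 m x else 0)" for g g' m
  proof -
    have "ip (kernel g 0 x) (wv g' 0 m) = (\<Sum>k\<in>window 0 x. if k = m then if g = g' then wv g' 0 m x else 0 else 0)"
      unfolding ip_kernel[OF cts_compact_wv] by (intro sum.cong) (auto simp: ip_same_level)
    also have "\<dots> = (if g = g' then wv g' 0 m x else 0)"
      using finite_window wv_nonzero_window[of g' 0 m x] by (auto simp: sum.delta')
    finally show ?thesis .
  qed
  \<comment> \<open>By the two-scale relation, functions of level 0 lie in the level-1 span of the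
    father, whose kernel reproduces them.\<close>
  have lvl1: "ip (kernel Father 1 x) (wv g 0 m) = wv g 0 m x" for g m
    unfolding ip_kernel[OF cts_compact_wv] using two_scale[of g m x] by (simp add: mult.commute ip_commute)
  have zero: "ip h (wv g 0 m) = 0" for g m
    unfolding iph[OF cts_compact_wv] lvl1 same by (cases g) auto
  have "h y = 0"
  proof (rule complete[OF h])
    show "ip h (wv Father 0 m) = 0" for m by (rule zero)
    show "ip h (wv Mother j m) = 0" for j m
    proof (cases "j = 0")
      case False
      \<comment> \<open>Mothers of level at least 1 are orthogonal to all three kernels.\<close>
      have "ip (wv Father 1 k) (wv Mother j m) = 0" for k
        using ip_same_level[of Father 1 k Mother m] ip_higher_mother[of 1 j Father k m] False
        by (cases "j = 1") auto
      then show ?thesis unfolding iph[OF cts_compact_wv] unfolding ip_kernel[OF cts_compact_wv] 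
        using False ip_higher_mother[of 0 j] by simp
    qed (simp add: zero)
  qed
  then show ?thesis unfolding h_def by simp
qed

lemma kernel_split: "kernel Father (Suc n) x y = kernel Father n x y + kernel Mother n x y"
  using kernel_scale[of Father n 1 x y] kernel_scale[of Father n 0 x y] kernel_scale[of Mother n 0 x y]
    kernel_split_0[of "2 ^ n * x" "2 ^ n * y"] by (simp add: algebra_simps)

lemma kernel_support:
  assumes "kernel g n x y \<noteq> 0"
  shows "\<bar>x - y\<bar> \<le> 2 * R / 2 ^ n"
proof -
  obtain m where "wv g n m x \<noteq> 0" "wv g n m y \<noteq> 0"
    using assms unfolding kernel_def by (metis (no_types, lifting) mult_eq_0_iff sum.neutral)
  then have "\<bar>2 ^ n * x - of_int m\<bar> \<le> R" "\<bar>2 ^ n * y - of_int m\<bar> \<le> R"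
    using wv_nonzero_window unfolding window_def by blast+
  then have "\<bar>2 ^ n * x - 2 ^ n * y\<bar> \<le> 2 * R" by linarith
  then have "2 ^ n * \<bar>x - y\<bar> \<le> 2 * R" by (simp add: abs_mult flip: right_diff_distrib)
  then show ?thesis by (simp add: field_simps)
qed

lemma kernel_bound: "\<bar>kernel g n x y\<bar> \<le> (2 * R + 1) * B\<^sup>2 * 2 ^ n"
proof -
  have "\<bar>kernel g n x y\<bar> \<le> (\<Sum>m\<in>window n x. \<bar>wv g n m x\<bar> * \<bar>wv g n m y\<bar>)"
    unfolding kernel_def abs_mult[symmetric] by (rule sum_abs)
  also have "\<dots> \<le> (\<Sum>m\<in>window n x. (2 powr (real n / 2) * B) * (2 powr (real n / 2) * B))"
    using B_pos by (intro sum_mono mult_mono wv_bound) auto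
  also have "\<dots> = real (card (window n x)) * (B\<^sup>2 * 2 ^ n)"
    by (simp add: power2_eq_square powr_half[symmetric])
  also have "\<dots> \<le> (2 * R + 1) * (B\<^sup>2 * 2 ^ n)"
    by (intro mult_right_mono card_window) auto
  finally show ?thesis by (simp add: mult.assoc)
qed

text \<open>The father is reproduced at level 0, and each mother kernel added by
  \<open>kernel_split\<close> annihilates it.\<close>

lemma kernel_reproduces_father: "ip (kernel Father n x) (wv Father 0 0) = wv Father 0 0 x"
proof (induction n)
  case 0
  have "ip (kernel Father 0 x) (wv Father 0 0) = (\<Sum>k\<in>window 0 x. if k = 0 then wv Father 0 0 x else 0)"
    unfolding ip_kernel[OF cts_compact_wv] by (intro sum.cong) (auto simp: ip_same_level)
  then show ?case using finite_window wv_nonzero_window[of Father 0 0 x] by (auto simp: sum.delta')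
next
  case (Suc n)
  have "ip (wv Mother n k) (wv Father 0 0) = 0" for k
    using ip_same_level[of Mother 0 k Father 0] ip_higher_mother[of 0 n Father 0 k] ip_commute
    by (cases "n = 0") auto
  then have "ip (kernel Mother n x) (wv Father 0 0) = 0"
    unfolding ip_kernel[OF cts_compact_wv] by simp
  moreover have "kernel Father (Suc n) x = (\<lambda>y. kernel Father n x y + kernel Mother n x y)"
    using kernel_split by blast
  ultimately show ?case using Suc by (simp add: ip_add cts_compact_kernel cts_compact_wv)
qed

text \<open>The level-0 projection of the constant function 1, evaluated at
  \<open>x\<close>.\<close>

definition kernel_mass :: "real \<Rightarrow> real" where
  "kernel_mass x = (\<integral>y. kernel Father 0 x y \<partial>lborel)"

lemma wv_integral: "(\<integral>y. wv g n m y \<partial>lborel) = 2 powr (real n / 2) * ((\<integral>y. \<psi> g y \<partial>lborel) / 2 ^ n)"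
  using integral_dilate[of "\<lambda>y. \<psi> g (y - of_int m)" n] lborel_integral_real_affine[of 1 "\<psi> g" "- of_int m"]
  unfolding wv_def by simp

lemma kernel_integral_eq_mass: "(\<integral>y. kernel Father n x y \<partial>lborel) = kernel_mass (2 ^ n * x)"
  using kernel_scale[of Father n 0 x] integral_dilate[of "kernel Father 0 (2 ^ n * x)" n]
  unfolding kernel_mass_def by simp

text \<open>Passing from level 0 to level 1 adds a mother kernel, whose integral vanishes, and the
  mass at level 1 is that of level 0 at the doubled point.\<close>

lemma kernel_mass_dilate: "kernel_mass (2 * x) = kernel_mass x"
proof -
  have "(\<integral>y. kernel Mother 0 x y \<partial>lborel) = 0"
    unfolding kernel_def using mother_integral
    by (subst Bochner_Integration.integral_sum) (auto intro!: cts_compact_integrable cts_compact_cmult cts_compact_wv simp: wv_integral)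
  moreover have "(\<integral>y. kernel Father 1 x y \<partial>lborel) = kernel_mass x + (\<integral>y. kernel Mother 0 x y \<partial>lborel)"
    unfolding kernel_mass_def kernel_split_0
    by (intro Bochner_Integration.integral_add cts_compact_integrable cts_compact_kernel)
  ultimately show ?thesis using kernel_integral_eq_mass[of 1 x] by simp
qed

text \<open>
  Since the mass is invariant under dilation by 2, its value at \<open>x\<close> is the limit of its values along \<open>x / 2 ^ n\<close>.
\<close>

lemma kernel_mass_const: "kernel_mass x = kernel_mass 0"
proof -
  define I where "I = (\<integral>y. \<psi> Father y \<partial>lborel)"
  \<comment> \<open>For points within distance 1 of 0 the window lies in a fixed range, so the mass
    is there a finite sum of continuous functions.\<close>
  define N where "N = \<lceil>R + 1\<rceil>"
  have "kernel_mass y = (\<Sum>m\<in>{-N..N}. I * \<psi> Father (y - of_int m))" if "\<bar>y\<bar> \<le> 1" for y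
  proof -
    have "kernel_mass y = (\<Sum>m\<in>window 0 y. I * \<psi> Father (y - of_int m))"
      unfolding kernel_mass_def kernel_def
      by (subst Bochner_Integration.integral_sum)
         (auto intro!: cts_compact_integrable cts_compact_cmult cts_compact_wv simp: wv_integral I_def, simp add: wv_def mult.commute)
    also have "\<dots> = (\<Sum>m\<in>{-N..N}. I * \<psi> Father (y - of_int m))"
    proof (rule sum.mono_neutral_left)
      show "window 0 y \<subseteq> {-N..N}"
      proof
        fix m assume "m \<in> window 0 y"
        then have "\<bar>of_int m\<bar> \<le> R + 1" unfolding window_def using that by auto
        then have "\<bar>m\<bar> \<le> N" unfolding N_def by linarith
        then show "m \<in> {-N..N}" by auto
      qed
      show "\<forall>i\<in>{-N..N} - window 0 y. I * \<psi> Father (y - of_int i) = 0"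
        using wv_nonzero_window[of Father 0 _ y] unfolding wv_def by auto
    qed auto
    finally show ?thesis .
  qed
  moreover have "((\<lambda>y. \<Sum>m\<in>{-N..N}. I * \<psi> Father (y - of_int m)) \<longlongrightarrow> (\<Sum>m\<in>{-N..N}. I * \<psi> Father (0 - of_int m))) (at 0)"
    by (intro isCont_tendsto_compose[OF _ tendsto_ident_at] tendsto_intros)
       (auto intro!: isCont_o2[OF _ continuous_on_interior[OF \<psi>_continuous]] continuous_intros 
          isCont_tendsto_compose[OF continuous_on_interior[OF \<psi>_continuous]] tendsto_eq_intros)
  ultimately have lim: "(kernel_mass \<longlongrightarrow> kernel_mass 0) (at 0)"
    by (subst tendsto_cong[where g="\<lambda>y. \<Sum>m\<in>{-N..N}. I * \<psi> Father (y - of_int m)"])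
       (auto simp: eventually_at intro!: exI[of _ 1])
  have eq: "kernel_mass (x / 2 ^ n) = kernel_mass x" for n
    using kernel_mass_dilate[of "x / 2 ^ Suc _"] by (induction n) (auto simp: field_simps)
  have "(\<lambda>n. kernel_mass (x / 2 ^ n)) \<longlonglongrightarrow> kernel_mass 0"
  proof (cases "x = 0")
    case False
    have "(\<lambda>n. x / 2 ^ n) \<longlonglongrightarrow> 0" using LIMSEQ_divide_realpow_zero[of 2 x] by simp
    then have "filterlim (\<lambda>n. x / 2 ^ n) (at 0) sequentially"
      using False by (auto simp: filterlim_at)
    then show ?thesis by (rule filterlim_compose[OF lim])
  qed simp
  then show ?thesis unfolding eq using LIMSEQ_unique tendsto_const by blast
qed

text \<open>
  The kernels reproduce the father wavelet at every scale, and applied to a continuous function they converge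
  to its product with the constant \<open>kernel_mass 0\<close>, which is therefore 1.
\<close>

lemma kernel_integral: "(\<integral>y. kernel Father n x y \<partial>lborel) = 1"
proof -
  let ?f = "wv Father 0 0"
  obtain x0 where x0: "?f x0 \<noteq> 0"
    using ip_same_level[of Father 0 0 Father 0] unfolding ip_def by fastforce
  \<comment> \<open>The kernel height without its factor \<open>2 ^ n\<close>, times the length
    \<open>4 * R\<close> of the support interval without its factor \<open>1 / 2 ^ n\<close>; the
    two powers cancel.\<close>
  let ?C = "(2 * R + 1) * B\<^sup>2 * (4 * R)"
  have C: "?C > 0" using R_pos B_pos by simp
  have est: "\<bar>?f x0 - kernel_mass 0 * ?f x0\<bar> \<le> \<epsilon>" if \<epsilon>: "\<epsilon> > 0" for \<epsilon>
  proof -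
    have "isCont ?f x0" using cts_compact_continuous[OF cts_compact_wv] by (simp add: continuous_on_eq_continuous_at)
    then obtain d where d: "d > 0" "\<And>y. \<bar>y - x0\<bar> < d \<Longrightarrow> \<bar>?f y - ?f x0\<bar> < \<epsilon> / ?C"
      unfolding continuous_at_eps_delta using \<epsilon> C 
      by (metis (no_types, lifting) dist_real_def divide_pos_pos)
    obtain n where n: "2 * R / 2 ^ n < d"
      using real_arch_pow[of 2 "2 * R / d"] d(1) by (auto simp: field_simps)
    let ?I = "{x0 - 2 * R / 2 ^ n..x0 + 2 * R / 2 ^ n}"
    have k: "cts_compact (kernel Father n x0)" by (rule cts_compact_kernel)
    have i1: "integrable lborel (\<lambda>y. kernel Father n x0 y * (?f y - ?f x0))"
      using cts_compact_continuous[OF cts_compact_wv] by (intro cts_compact_integrable cts_compact_mult_continuous[OF k] continuous_intros) auto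
    have i2: "integrable lborel (\<lambda>y. indicator ?I y * ((2 * R + 1) * B\<^sup>2 * 2 ^ n * (\<epsilon> / ?C)))"
      by (intro integrable_mult_left integrable_real_indicator) (auto simp: emeasure_lborel_Icc_eq)
    have "?f x0 - kernel_mass 0 * ?f x0 = ip (kernel Father n x0) ?f - (\<integral>y. kernel Father n x0 y \<partial>lborel) * ?f x0"
      unfolding kernel_reproduces_father kernel_integral_eq_mass using kernel_mass_const[of "2 ^ n * x0"] by simp
    also have "\<dots> = (\<integral>y. kernel Father n x0 y * (?f y - ?f x0) \<partial>lborel)"
      unfolding ip_def right_diff_distrib
      using cts_compact_integrable[OF k] cts_compact_integrable[OF cts_compact_mult[OF k cts_compact_wv[of Father 0 0]]]
      by (subst Bochner_Integration.integral_diff) auto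
    finally have "\<bar>?f x0 - kernel_mass 0 * ?f x0\<bar> \<le> (\<integral>y. \<bar>kernel Father n x0 y * (?f y - ?f x0)\<bar> \<partial>lborel)"
      by (simp only: integral_abs_bound)
    also have "\<dots> \<le> (\<integral>y. indicator ?I y * ((2 * R + 1) * B\<^sup>2 * 2 ^ n * (\<epsilon> / ?C)) \<partial>lborel)"
    proof (rule integral_mono[OF integrable_abs[OF i1] i2])
      fix y
      show "\<bar>kernel Father n x0 y * (?f y - ?f x0)\<bar> \<le> indicator ?I y * ((2 * R + 1) * B\<^sup>2 * 2 ^ n * (\<epsilon> / ?C))"
      proof (cases "kernel Father n x0 y = 0")
        case False
        then have xy: "\<bar>x0 - y\<bar> \<le> 2 * R / 2 ^ n" by (rule kernel_support)
        then have "y \<in> ?I" by (auto simp: abs_le_iff)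
        moreover have "\<bar>?f y - ?f x0\<bar> \<le> \<epsilon> / ?C" using d(2)[of y] xy n by (simp add: abs_minus_commute)
        then have "\<bar>kernel Father n x0 y * (?f y - ?f x0)\<bar> \<le> (2 * R + 1) * B\<^sup>2 * 2 ^ n * (\<epsilon> / ?C)"
          unfolding abs_mult using R_pos by (intro mult_mono kernel_bound) auto
        ultimately show ?thesis by simp
      qed (use \<epsilon> C R_pos in \<open>auto intro!: mult_nonneg_nonneg\<close>)
    qed
    also have "\<dots> = 4 * R / 2 ^ n * ((2 * R + 1) * B\<^sup>2 * 2 ^ n * (\<epsilon> / ?C))"
      using R_pos by simp
    also have "\<dots> = \<epsilon>"
    proof -
      have "b / p * (a * p * (e / (a * b))) = e" if "a > 0" "b > 0" "p > 0" for a b p e :: real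
        using that by (simp add: field_simps)
      from this[of "(2 * R + 1) * B\<^sup>2" "4 * R" "2 ^ n"] show ?thesis using R_pos B_pos by simp
    qed
    finally show ?thesis .
  qed
  have "\<bar>?f x0 - kernel_mass 0 * ?f x0\<bar> \<le> 0" 
    by (rule field_le_epsilon) (use est in simp)
  then have "(1 - kernel_mass 0) * ?f x0 = 0" by (simp add: algebra_simps)
  then have "kernel_mass 0 = 1" using x0 by simp
  then show ?thesis unfolding kernel_integral_eq_mass using kernel_mass_const by simp
qed

end

section \<open>Tensor product kernels\<close>

lemma bij_betw_vec_lambda_PiE:
  "bij_betw vec_lambda (PiE UNIV S) {m :: 'b ^ 'd::finite. \<forall>a. m $ a \<in> S a}"
  by (rule bij_betw_byWitness[where f'=vec_nth]) (auto simp: PiE_UNIV_domain)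

lemma finite_vec_box: "(\<And>a. finite (S a)) \<Longrightarrow> finite {m :: 'b ^ 'd::finite. \<forall>a. m $ a \<in> S a}"
  using bij_betw_finite[OF bij_betw_vec_lambda_PiE[of S]] by (auto intro: finite_PiE)

lemma card_vec_box: "card {m :: 'b ^ 'd::finite. \<forall>a. m $ a \<in> S a} = (\<Prod>a\<in>UNIV. card (S a))"
  using bij_betw_same_card[OF bij_betw_vec_lambda_PiE[of S]] by (simp add: card_PiE)

lemma sum_vec_box:
  fixes f :: "'d::finite \<Rightarrow> 'b \<Rightarrow> 'c::comm_semiring_1"
  assumes "\<And>a. finite (S a)"
  shows "(\<Sum>m | \<forall>a. m $ a \<in> S a. \<Prod>a\<in>UNIV. f a (m $ a)) = (\<Prod>a\<in>UNIV. \<Sum>k\<in>S a. f a k)"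
proof -
  have "(\<Prod>a\<in>UNIV. \<Sum>k\<in>S a. f a k) = (\<Sum>g\<in>PiE UNIV S. \<Prod>a\<in>UNIV. f a (g a))"
    using assms by (intro prod_sum_PiE) auto
  also have "\<dots> = (\<Sum>m | \<forall>a. m $ a \<in> S a. \<Prod>a\<in>UNIV. f a (m $ a))"
    using sum.reindex_bij_betw[OF bij_betw_vec_lambda_PiE[of S], of "\<lambda>m. \<Prod>a\<in>UNIV. f a (m $ a)"] by simp
  finally show ?thesis ..
qed

lemma integral_lborel_prod_cart:
  fixes f :: "'d::finite \<Rightarrow> real \<Rightarrow> real"
  assumes f: "\<And>a. integrable lborel (f a)"
  shows "(\<integral>y. (\<Prod>a\<in>UNIV. f a (y $ a)) \<partial>(lborel :: (real ^ 'd) measure)) = (\<Prod>a\<in>UNIV. \<integral>s. f a s \<partial>lborel)"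
proof -
  \<comment> \<open>Lebesgue measure is the image of a product indexed by basis vectors, so the
    factors are reindexed from coordinates \<open>a\<close> to vectors
    \<open>axis a 1\<close>.\<close>
  define F where "F b = f (THE a. b = axis a 1)" for b :: "real ^ 'd"
  have F: "F (axis a 1) = f a" for a
    unfolding F_def by (rule arg_cong[where f=f]) (auto simp: axis_eq_axis)
  have Basis: "(Basis :: (real ^ 'd) set) = range (\<lambda>a. axis a 1)"
    unfolding Basis_vec_def by auto
  have inj: "inj (\<lambda>a. axis a 1 :: real ^ 'd)" by (auto simp: inj_on_def axis_eq_axis)
  have pr: "(\<Prod>b\<in>(Basis :: (real ^ 'd) set). H b) = (\<Prod>a\<in>UNIV. H (axis a 1))" for H :: "real ^ 'd \<Rightarrow> real"
    unfolding Basis using prod.reindex[OF inj, of H] by simp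
  interpret product_sigma_finite "\<lambda>_ :: real ^ 'd. lborel :: real measure" by standard
  have [measurable]: "f a \<in> borel_measurable borel" for a using borel_measurable_integrable[OF f[of a]] by simp
  have "(\<integral>y. (\<Prod>a\<in>UNIV. f a (y $ a)) \<partial>(lborel :: (real ^ 'd) measure)) = 
     (\<integral>y. (\<Prod>a\<in>UNIV. f a (y $ a)) \<partial>distr (\<Pi>\<^sub>M b\<in>(Basis :: (real ^ 'd) set). lborel) borel (\<lambda>f. \<Sum>b\<in>Basis. f b *\<^sub>R b))"
    by (subst lborel_eq) simp
  also have "\<dots> = (\<integral>y. (\<Prod>a\<in>UNIV. f a ((\<Sum>b\<in>Basis. y b *\<^sub>R b) $ a)) \<partial>(\<Pi>\<^sub>M b\<in>(Basis :: (real ^ 'd) set). lborel))"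
    by (subst integral_distr) auto
  also have "\<dots> = (\<integral>y. (\<Prod>b\<in>Basis. F b (y b)) \<partial>(\<Pi>\<^sub>M b\<in>(Basis :: (real ^ 'd) set). lborel))"
  proof -
    have "(\<Sum>b\<in>Basis. y b *\<^sub>R b) $ a = y (axis a 1)" for y :: "real ^ 'd \<Rightarrow> real" and a
      using inner_sum_left_Basis[of "axis a 1 :: real ^ 'd" y] by (simp add: cart_eq_inner_axis)
    then show ?thesis unfolding pr F by simp
  qed
  also have "\<dots> = (\<Prod>b\<in>(Basis :: (real ^ 'd) set). \<integral>s. F b s \<partial>lborel)"
    using f by (intro product_integral_prod) (auto simp: Basis F)
  also have "\<dots> = (\<Prod>a\<in>UNIV. \<integral>s. f a s \<partial>lborel)" unfolding pr F ..
  finally show ?thesis .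
qed

lemma integrable_compact_support_cart:
  fixes f :: "real ^ 'd::finite \<Rightarrow> real"
  assumes "continuous_on UNIV f" and supp: "\<And>y a. f y \<noteq> 0 \<Longrightarrow> \<bar>y $ a - c $ a\<bar> \<le> r"
  shows "integrable lborel f"
proof -
  let ?S = "cbox (\<chi> a. c $ a - r) (\<chi> a. c $ a + r)"
  have "integrable lborel (\<lambda>x. indicator ?S x *\<^sub>R f x)"
    using assms by (intro borel_integrable_compact) (auto intro: continuous_on_subset)
  moreover have "y \<in> ?S" if "f y \<noteq> 0" for y
    using supp[OF that] by (auto simp: mem_box_cart abs_le_iff) (smt (verit))+
  then have "(\<lambda>x. indicator ?S x *\<^sub>R f x) = f" by (fastforce simp: indicator_def)
  ultimately show ?thesis by simp
qed

lemma abs_integral_le_cube: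
  fixes f :: "real ^ 'd::finite \<Rightarrow> real"
  assumes supp: "\<And>y a. f y \<noteq> 0 \<Longrightarrow> \<bar>y $ a - c $ a\<bar> \<le> r" and "\<And>y. \<bar>f y\<bar> \<le> S" and "r \<ge> 0"
    and int: "integrable lborel f"
  shows "\<bar>\<integral>y. f y \<partial>lborel\<bar> \<le> S * (2 * r) ^ CARD('d)"
proof -
  let ?C = "cbox (\<chi> a. c $ a - r) (\<chi> a. c $ a + r) :: (real ^ 'd) set"
  have "y \<in> ?C" if "f y \<noteq> 0" for y
    using supp[OF that] by (auto simp: mem_box_cart abs_le_iff) (smt (verit))+
  then have le: "\<bar>f y\<bar> \<le> S * indicator ?C y" for y using assms(2)[of y] by (cases "f y = 0") (auto simp: indicator_def)
  have "?C \<noteq> {}" using \<open>r \<ge> 0\<close> by (auto simp: interval_ne_empty_cart)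
  then have m: "measure lborel ?C = (2 * r) ^ CARD('d)"
    by (subst content_cbox_cart) (auto)
  have "\<bar>\<integral>y. f y \<partial>lborel\<bar> \<le> (\<integral>y. \<bar>f y\<bar> \<partial>lborel)" by (rule integral_abs_bound)
  also have "\<dots> \<le> (\<integral>y. S * indicator ?C y \<partial>lborel)"
    using int le by (intro integral_mono) (auto intro!: integrable_mult_right integrable_real_indicator emeasure_bounded_finite bounded_cbox)
  also have "\<dots> = S * (2 * r) ^ CARD('d)" using m by simp
  finally show ?thesis .
qed

text \<open>Subtracting \<phi> at the centre \<open>c\<close> leaves, in dimension d, an integrand
  of height at most S^d K d r on a cube of side \<open>2 * r\<close>. The estimate serves twice:
  products of integral zero give cancellation, products of integral one an approximate
  identity.\<close>

lemma product_kernel_estimate: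
  fixes f :: "'d::finite \<Rightarrow> real \<Rightarrow> real" and c :: "real ^ 'd"
  assumes f: "\<And>a. cts_compact (f a)" and supp: "\<And>a s. f a s \<noteq> 0 \<Longrightarrow> \<bar>s - c $ a\<bar> \<le> r" and bound: "\<And>a s. \<bar>f a s\<bar> \<le> S" 
    and r: "r \<ge> 0" and S: "S \<ge> 0" and \<phi>: "continuous_on UNIV \<phi>" and lip: "\<And>x y. \<bar>\<phi> x - \<phi> y\<bar> \<le> K * norm (x - y)"
    and K: "K \<ge> 0"
  shows "\<bar>(\<integral>y. (\<Prod>a\<in>UNIV. f a (y $ a)) * \<phi> y \<partial>lborel) - (\<Prod>a\<in>UNIV. \<integral>s. f a s \<partial>lborel) * \<phi> c\<bar>
    \<le> (2 * r * S) ^ CARD('d) * (K * real CARD('d) * r)"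
proof -
  let ?F = "\<lambda>y :: real ^ 'd. \<Prod>a\<in>UNIV. f a (y $ a)"
  have contF: "continuous_on UNIV ?F"
    by (intro continuous_on_prod continuous_on_compose2[OF cts_compact_continuous[OF f]] continuous_intros) auto
  have suppF: "\<bar>y $ a - c $ a\<bar> \<le> r" if "?F y \<noteq> 0" for y a
    using that supp[of a "y $ a"] by auto
  have i0: "integrable lborel ?F" using contF suppF by (rule integrable_compact_support_cart)
  have i1: "integrable lborel (\<lambda>y. ?F y * \<phi> y)"
    using suppF by (intro integrable_compact_support_cart[where c=c and r=r] continuous_on_mult contF \<phi>) auto
  have i2: "integrable lborel (\<lambda>y. ?F y * (\<phi> y - \<phi> c))"
    using suppF by (intro integrable_compact_support_cart[where c=c and r=r] continuous_on_mult continuous_on_diff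
      continuous_on_const contF \<phi>) auto
  have "(\<Prod>a\<in>UNIV. \<integral>s. f a s \<partial>lborel) = (\<integral>y. ?F y \<partial>lborel)"
    using integral_lborel_prod_cart[of f] cts_compact_integrable[OF f] by simp
  then have "(\<integral>y. ?F y * \<phi> y \<partial>lborel) - (\<Prod>a\<in>UNIV. \<integral>s. f a s \<partial>lborel) * \<phi> c = (\<integral>y. ?F y * (\<phi> y - \<phi> c) \<partial>lborel)"
    using i0 i1 by (simp add: right_diff_distrib)
  also have "\<bar>(\<integral>y. ?F y * (\<phi> y - \<phi> c) \<partial>lborel)\<bar> \<le> (S ^ CARD('d) * (K * (real CARD('d) * r))) * (2 * r) ^ CARD('d)"
  proof (rule abs_integral_le_cube[where c=c and r=r])
    show "\<bar>y $ a - c $ a\<bar> \<le> r" if "?F y * (\<phi> y - \<phi> c) \<noteq> 0" for y a using that suppF by auto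
    show "\<bar>?F y * (\<phi> y - \<phi> c)\<bar> \<le> S ^ CARD('d) * (K * (real CARD('d) * r))" for y
    proof (cases "?F y = 0")
      case False
      have "\<bar>?F y\<bar> \<le> (\<Prod>a\<in>(UNIV::'d set). S)" unfolding abs_prod by (intro prod_mono) (auto simp: bound)
      then have "\<bar>?F y\<bar> \<le> S ^ CARD('d)" by simp
      moreover have "norm (y - c) \<le> (\<Sum>a\<in>UNIV. \<bar>(y - c) $ a\<bar>)" by (rule norm_le_l1_cart)
      then have "norm (y - c) \<le> (\<Sum>a\<in>(UNIV::'d set). r)"
        by (rule order_trans) (use suppF[OF False] in \<open>intro sum_mono, simp\<close>)
      then have "K * norm (y - c) \<le> K * (real CARD('d) * r)" using K by (intro mult_left_mono) auto
      then have "\<bar>\<phi> y - \<phi> c\<bar> \<le> K * (real CARD('d) * r)" using lip[of y c] by linarith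
      ultimately show ?thesis unfolding abs_mult using S by (intro mult_mono) auto
    next
      case True
      have "0 \<le> S ^ CARD('d) * (K * (real CARD('d) * r))" using S K r by simp
      then show ?thesis by (simp only: True mult_zero_left abs_zero)
    qed
  qed (use r i2 in auto)
  also have "\<dots> = (2 * r * S) ^ CARD('d) * (K * real CARD('d) * r)" by (simp add: power_mult_distrib)
  finally show ?thesis .
qed

section \<open>Tensor products of wavelets and kernels\<close>

context wavelet_1d
begin

definition wv_vec :: "nat \<Rightarrow> ('d::finite \<Rightarrow> gender) \<Rightarrow> int ^ 'd \<Rightarrow> real ^ 'd \<Rightarrow> real" where
  "wv_vec n G m x = (\<Prod>a\<in>UNIV. wv (G a) n (m $ a) (x $ a))"

definition window_vec :: "nat \<Rightarrow> real ^ 'd::finite \<Rightarrow> (int ^ 'd) set" where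
  "window_vec n x = {m. \<forall>a. m $ a \<in> window n (x $ a)}"

lemma wavelet_eq_wv_vec: "wavelet \<psi> L j G m x = wv_vec (j + L) G m x"
proof -
  have "2 powr (real (j + L) * real CARD('a) / 2) = (\<Prod>a\<in>(UNIV::'a set). 2 powr (real (j + L) / 2) :: real)"
    by (simp add: powr_power mult.commute)
  then show ?thesis unfolding wavelet_def wv_vec_def wv_def prod.distrib by simp
qed

lemma finite_window_vec: "finite (window_vec n x)"
  unfolding window_vec_def by (intro finite_vec_box finite_window)

lemma card_window_vec: "real (card (window_vec n (x :: real ^ 'd::finite))) \<le> (2 * R + 1) ^ CARD('d)"
proof -
  have "real (card (window_vec n x)) = (\<Prod>a\<in>UNIV. real (card (window n (x $ a))))"
    unfolding window_vec_def by (simp add: card_vec_box)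
  also have "\<dots> \<le> (\<Prod>a\<in>(UNIV::'d set). 2 * R + 1)"
    by (intro prod_mono) (auto simp: card_window)
  finally show ?thesis by simp
qed

lemma wv_vec_nonzero_window: "wv_vec n G m x \<noteq> 0 \<Longrightarrow> m \<in> window_vec n x"
  unfolding wv_vec_def window_vec_def using wv_nonzero_window by fastforce

lemma wv_vec_bound: "\<bar>wv_vec n G m (x :: real ^ 'd::finite)\<bar> \<le> (2 powr (real n / 2) * B) ^ CARD('d)"
proof -
  have "\<bar>wv_vec n G m x\<bar> \<le> (\<Prod>a\<in>(UNIV::'d set). 2 powr (real n / 2) * B)"
    unfolding wv_vec_def abs_prod by (intro prod_mono) (auto simp: wv_bound)
  then show ?thesis by simp
qed

lemma continuous_wv_vec: "continuous_on UNIV (wv_vec n G m)"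
  unfolding wv_vec_def
  by (intro continuous_on_prod continuous_on_compose2[OF cts_compact_continuous[OF cts_compact_wv]] continuous_intros) auto

definition kernel_vec :: "('d::finite \<Rightarrow> gender) \<Rightarrow> nat \<Rightarrow> real ^ 'd \<Rightarrow> real ^ 'd \<Rightarrow> real" where
  "kernel_vec G n x y = (\<Prod>a\<in>UNIV. kernel (G a) n (x $ a) (y $ a))"

lemma kernel_vec_eq_sum: "kernel_vec G n x y = (\<Sum>m\<in>window_vec n x. wv_vec n G m x * wv_vec n G m y)"
  unfolding kernel_vec_def kernel_def window_vec_def wv_vec_def prod.distrib[symmetric]
  by (rule sum_vec_box[symmetric, OF finite_window])

lemma UNIV_gender: "UNIV = {Father, Mother}"
  using gender.exhaust by blast

lemma finite_UNIV_gender: "finite (UNIV :: gender set)" unfolding UNIV_gender by simp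

lemma finite_genders: "finite (S :: ('d::finite \<Rightarrow> gender) set)"
  using finite_PiE[of "UNIV :: 'd set" "\<lambda>_. UNIV :: gender set"] finite_UNIV_gender
  by (auto simp: PiE_UNIV_domain intro: finite_subset)

text \<open>Splitting each one-dimensional factor into father plus mother and expanding the product
  gives one term for every choice of genders.\<close>

lemma sum_kernel_vec: "(\<Sum>G\<in>UNIV. kernel_vec G n x y) = kernel_vec (\<lambda>_. Father) (Suc n) x y"
proof -
  have "kernel_vec (\<lambda>_. Father) (Suc n) x y = (\<Prod>a\<in>UNIV. \<Sum>g\<in>UNIV. kernel g n (x $ a) (y $ a))"
    unfolding kernel_vec_def kernel_split UNIV_gender by simp
  also have "\<dots> = (\<Sum>G\<in>PiE UNIV (\<lambda>_. UNIV). kernel_vec G n x y)"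
    unfolding kernel_vec_def by (rule prod_sum_PiE) (auto simp: finite_UNIV_gender)
  finally show ?thesis by (simp add: PiE_UNIV_domain)
qed

text \<open>From level 1 on, \<open>genders\<close> omits the all-father choice, whose kernel is
  exactly the sum accumulated so far.\<close>

lemma kernel_vec_telescope:
  "(\<Sum>j<Suc J. \<Sum>G\<in>genders j. kernel_vec G (j + L) x y) = kernel_vec (\<lambda>_. Father) (Suc J + L) x y"
proof (induction J)
  case 0
  then show ?case by (simp add: genders_def sum_kernel_vec)
next
  case (Suc J)
  have g: "genders (Suc J) = UNIV - {\<lambda>_. Father}"
    unfolding genders_def by (auto simp: fun_eq_iff) (metis gender.exhaust)
  have "(\<Sum>G\<in>genders (Suc J). kernel_vec G (Suc J + L) x y) 
     = kernel_vec (\<lambda>_. Father) (Suc (Suc J + L)) x y - kernel_vec (\<lambda>_. Father) (Suc J + L) x y"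
    unfolding g sum_kernel_vec[symmetric] using finite_genders by (subst sum_diff1) auto
  then show ?case using Suc by simp
qed

end

section \<open>Pointwise wavelet expansion\<close>

lemma integral_lborel_translate:
  fixes f :: "'a::euclidean_space \<Rightarrow> real"
  assumes "f \<in> borel_measurable borel"
  shows "(\<integral>y. f (y + t) \<partial>lborel) = (\<integral>y. f y \<partial>lborel)"
proof -
  have "(\<integral>y. f y \<partial>lborel) = (\<integral>y. f y \<partial>distr lborel borel ((+) t))" by (simp add: lborel_distr_plus)
  also have "\<dots> = (\<integral>y. f (t + y) \<partial>lborel)" using assms by (subst integral_distr) auto
  finally show ?thesis by (simp add: add.commute)
qed

lemma positions_eq: "positions L j = {m :: int ^ 'd. \<forall>a. m $ a \<in> {0..<2 ^ (j + L)}}"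
  unfolding positions_def by auto

lemma finite_positions: "finite (positions L j :: (int ^ 'd::finite) set)"
  unfolding positions_eq by (rule finite_vec_box) simp

section \<open>Periodized wavelets and their coefficients\<close>

context wavelet_1d
begin

text \<open>For \<open>n = j + L\<close> this is the element of \<open>positions L j\<close>
  congruent to \<open>m\<close>.\<close>

definition residue_vec :: "nat \<Rightarrow> int ^ 'd::finite \<Rightarrow> int ^ 'd" where
  "residue_vec n m = (\<chi> a. m $ a mod 2 ^ n)"

lemma residue_vec_positions: "residue_vec (j + L) m \<in> positions L j"
  unfolding residue_vec_def positions_def by simp

lemma wv_vec_translate: "wv_vec n G m (x + int_vec k) = wv_vec n G (\<chi> a. m $ a - 2 ^ n * k $ a) x"
  unfolding wv_vec_def wv_def int_vec_def by (simp add: algebra_simps)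

text \<open>An integer shift of the argument shifts the translation index by a multiple of
  \<open>2 ^ (j + L)\<close>, so periodization runs through one residue class, of which only members
  in the window contribute.\<close>

lemma wavelet_per_eq_sum:
  assumes "m \<in> positions L j"
  shows "wavelet_per \<psi> L j G m x = (\<Sum>m' | m' \<in> window_vec (j + L) x \<and> residue_vec (j + L) m' = m. wv_vec (j + L) G m' x)"
proof -
  let ?n = "j + L"
  define s where "s k = (\<chi> a. m $ a - 2 ^ ?n * k $ a)" for k :: "int ^ 'a"
  have inj: "inj s" unfolding s_def by (auto simp: inj_on_def vec_eq_iff)
  have range: "range s = {m'. residue_vec ?n m' = m}"
  proof (intro equalityI subsetI)
    fix m' assume "m' \<in> range s"
    then obtain k where "m' = s k" by blast
    then show "m' \<in> {m'. residue_vec ?n m' = m}"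
      using assms unfolding s_def residue_vec_def positions_def by (auto simp: vec_eq_iff mod_diff_right_eq[symmetric])
  next
    fix m' assume "m' \<in> {m'. residue_vec ?n m' = m}"
    then have "m $ a = m' $ a mod 2 ^ ?n" for a unfolding residue_vec_def by auto
    then have "m' = s (\<chi> a. - (m' $ a div 2 ^ ?n))"
      unfolding s_def by (auto simp: vec_eq_iff)
    then show "m' \<in> range s" by blast
  qed
  have "wavelet_per \<psi> L j G m x = infsum ((\<lambda>m'. wv_vec ?n G m' x) \<circ> s) UNIV"
    unfolding wavelet_per_def wavelet_eq_wv_vec wv_vec_translate s_def comp_def ..
  also have "\<dots> = infsum (\<lambda>m'. wv_vec ?n G m' x) (range s)"
    using infsum_reindex[OF inj] by metis
  also have "\<dots> = infsum (\<lambda>m'. wv_vec ?n G m' x) {m'. m' \<in> window_vec ?n x \<and> residue_vec ?n m' = m}"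
    unfolding range using wv_vec_nonzero_window by (intro infsum_cong_neutral) auto
  also have "\<dots> = (\<Sum>m' | m' \<in> window_vec ?n x \<and> residue_vec ?n m' = m. wv_vec ?n G m' x)"
    by (intro infsum_finite finite_subset[OF _ finite_window_vec[of ?n x]]) auto
  finally show ?thesis .
qed

lemma wavelet_per_bound:
  assumes "m \<in> positions L j"
  shows "\<bar>wavelet_per \<psi> L j G m (x :: real ^ 'd::finite)\<bar> \<le> (2 * R + 1) ^ CARD('d) * (2 powr (real (j + L) / 2) * B) ^ CARD('d)"
proof -
  let ?n = "j + L"
  let ?S = "{m'. m' \<in> window_vec ?n x \<and> residue_vec ?n m' = m}"
  have "\<bar>wavelet_per \<psi> L j G m x\<bar> \<le> (\<Sum>m'\<in>?S. (2 powr (real ?n / 2) * B) ^ CARD('d))"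
    unfolding wavelet_per_eq_sum[OF assms] by (intro order_trans[OF sum_abs] sum_mono wv_vec_bound)
  also have "\<dots> = real (card ?S) * (2 powr (real ?n / 2) * B) ^ CARD('d)" by simp
  also have "\<dots> \<le> (2 * R + 1) ^ CARD('d) * (2 powr (real ?n / 2) * B) ^ CARD('d)"
  proof (rule mult_right_mono)
    have "card ?S \<le> card (window_vec ?n x)" by (intro card_mono finite_window_vec) auto
    then show "real (card ?S) \<le> (2 * R + 1) ^ CARD('d)" using card_window_vec[of ?n x] by linarith
  qed (use B_pos in simp)
  finally show ?thesis .
qed

lemma wavelet_per_nonzero:
  assumes "m \<in> positions L j" "wavelet_per \<psi> L j G m x \<noteq> 0"
  shows "m \<in> residue_vec (j + L) ` window_vec (j + L) x"
  using assms(2) unfolding wavelet_per_eq_sum[OF assms(1)] by (force dest: sum.not_neutral_contains_not_neutral)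

definition coef :: "nat \<Rightarrow> ('d::finite \<Rightarrow> gender) \<Rightarrow> int ^ 'd \<Rightarrow> (real ^ 'd \<Rightarrow> real) \<Rightarrow> real" where
  "coef n G m \<phi> = (\<integral>y. wv_vec n G m y * \<phi> y \<partial>lborel)"

text \<open>Congruent indices give wavelets that differ by an integer translation, invisible to a
  periodic function and to Lebesgue measure.\<close>

lemma coef_residue:
  assumes "\<phi> \<in> test_functions"
  shows "coef n G (residue_vec n m) \<phi> = coef n G m \<phi>"
proof -
  let ?k = "\<chi> a. m $ a div 2 ^ n"
  have res: "residue_vec n m = (\<chi> a. m $ a - 2 ^ n * ?k $ a)"
    unfolding residue_vec_def by (simp add: vec_eq_iff minus_mult_div_eq_mod)
  have per: "\<phi> (y + int_vec ?k) = \<phi> y" for y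
    using assms unfolding test_functions_def periodic_def by blast
  have "coef n G (residue_vec n m) \<phi> = (\<integral>y. wv_vec n G m (y + int_vec ?k) * \<phi> (y + int_vec ?k) \<partial>lborel)"
    unfolding coef_def res wv_vec_translate[symmetric] per ..
  also have "\<dots> = coef n G m \<phi>"
    unfolding coef_def
    by (rule integral_lborel_translate) 
       (intro borel_measurable_times test_functions_measurable[OF assms] borel_measurable_continuous_onI continuous_wv_vec)
  finally show ?thesis .
qed

lemma wv_vec_support:
  assumes "wv_vec n G m x \<noteq> 0"
  shows "\<bar>x $ a - of_int (m $ a) / 2 ^ n\<bar> \<le> R / 2 ^ n"
proof -
  have "\<bar>2 ^ n * x $ a - of_int (m $ a)\<bar> \<le> R"
    using wv_vec_nonzero_window[OF assms] unfolding window_vec_def window_def by auto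
  moreover have "x $ a - of_int (m $ a) / 2 ^ n = (2 ^ n * x $ a - of_int (m $ a)) / 2 ^ n" by (simp add: field_simps)
  ultimately show ?thesis by (simp add: divide_right_mono)
qed

lemma integrable_wv_vec_mult:
  assumes "\<phi> \<in> test_functions"
  shows "integrable lborel (\<lambda>y. wv_vec n G m y * \<phi> y)"
  by (rule integrable_compact_support_cart[where c="\<chi> a. of_int (m $ a) / 2 ^ n" and r="R / 2 ^ n"])
     (auto intro!: continuous_on_mult continuous_wv_vec test_functions_continuous_on[OF assms] wv_vec_support)

text \<open>Integer translates of the half-open unit cube tile the space, so integrating the
  periodization over the torus amounts to integrating the original wavelet over the whole
  space.\<close>

lemma integral_torus_wavelet_per:
  fixes m :: "int ^ 'd::finite"
  assumes \<phi>: "\<phi> \<in> test_functions"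
  shows "(\<integral>x. wavelet_per \<psi> L j G m x * \<phi> x \<partial>torus_measure) = coef (j + L) G m \<phi>"
proof -
  let ?n = "j + L"
  let ?Q = "{x :: real ^ 'd. \<forall>a. 0 \<le> x $ a \<and> x $ a < 1}"
  define h where "h y = wv_vec ?n G m y * \<phi> y" for y
  have h: "integrable lborel h" unfolding h_def by (rule integrable_wv_vec_mult[OF \<phi>])
  have hb [measurable]: "h \<in> borel_measurable borel" using borel_measurable_integrable[OF h] by simp
  have Q [measurable]: "?Q \<in> sets borel" by measurable
  \<comment> \<open>A finite set of shifts containing all those that move a point of the cube into
    the support; finiteness lets sum and integral commute.\<close>
  define F where "F = {k :: int ^ 'd. \<forall>a. k $ a \<in> {- \<lceil>R + \<bar>of_int (m $ a)\<bar> + 1\<rceil>..\<lceil>R + \<bar>of_int (m $ a)\<bar> + 1\<rceil>}}"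
  have F: "finite F" unfolding F_def by (rule finite_vec_box) simp
  have inF: "k \<in> F" if x: "x \<in> ?Q" and nz: "wv_vec ?n G m (x + int_vec k) \<noteq> 0" for x k
    unfolding F_def
  proof (intro CollectI allI)
    fix a
    have "\<bar>(x $ a + of_int (k $ a)) - of_int (m $ a) / 2 ^ ?n\<bar> \<le> R / 2 ^ ?n"
      using wv_vec_support[OF nz, of a] by (simp add: int_vec_def)
    moreover have "R / 2 ^ ?n \<le> R / 1" using R_pos by (intro divide_left_mono) auto
    moreover have "\<bar>of_int (m $ a) / 2 ^ ?n\<bar> \<le> \<bar>of_int (m $ a)\<bar> / (1 :: real)"
      unfolding abs_divide by (intro divide_left_mono) auto
    moreover have "0 \<le> x $ a" "x $ a < 1" using x by auto
    ultimately have "\<bar>of_int (k $ a)\<bar> \<le> R + \<bar>of_int (m $ a)\<bar> + 1" by linarith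
    then have "\<bar>k $ a\<bar> \<le> \<lceil>R + \<bar>of_int (m $ a)\<bar> + 1\<rceil>" by linarith
    then show "k $ a \<in> {- \<lceil>R + \<bar>of_int (m $ a)\<bar> + 1\<rceil>..\<lceil>R + \<bar>of_int (m $ a)\<bar> + 1\<rceil>}" by auto
  qed
  have per: "\<phi> (y + int_vec k) = \<phi> y" for y k
    using \<phi> unfolding test_functions_def periodic_def by blast
  have "(\<integral>x. wavelet_per \<psi> L j G m x * \<phi> x \<partial>torus_measure) = 
      (\<integral>x. indicator ?Q x *\<^sub>R (wavelet_per \<psi> L j G m x * \<phi> x) \<partial>lborel)"
    unfolding torus_measure_def by (rule integral_restrict_space) simp
  also have "\<dots> = (\<integral>x. (\<Sum>k\<in>F. indicator ?Q x * h (x + int_vec k)) \<partial>lborel)"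
  proof (intro Bochner_Integration.integral_cong refl)
    fix x :: "real ^ 'd"
    show "indicator ?Q x *\<^sub>R (wavelet_per \<psi> L j G m x * \<phi> x) = (\<Sum>k\<in>F. indicator ?Q x * h (x + int_vec k))"
    proof (cases "x \<in> ?Q")
      case True
      have "wavelet_per \<psi> L j G m x = infsum (\<lambda>k. wv_vec ?n G m (x + int_vec k)) F"
        unfolding wavelet_per_def wavelet_eq_wv_vec using inF[OF True] by (intro infsum_cong_neutral) auto
      then show ?thesis using F True unfolding h_def per by (simp add: sum_distrib_right)
    qed simp
  qed
  also have "\<dots> = (\<integral>x. (\<Sum>k\<in>F. indicator ?Q ((x + int_vec k) - int_vec k) * h (x + int_vec k)) \<partial>lborel)"
    by simp
  also have "\<dots> = (\<Sum>k\<in>F. \<integral>x. indicator ?Q ((x + int_vec k) - int_vec k) * h (x + int_vec k) \<partial>lborel)"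
  proof (rule Bochner_Integration.integral_sum)
    fix k
    have "integrable lborel (\<lambda>x. h (x + int_vec k))"
      unfolding h_def wv_vec_translate per by (rule integrable_wv_vec_mult[OF \<phi>])
    then have "integrable lborel (\<lambda>x. h (x + int_vec k) * indicator ?Q x)"
      by (rule integrable_real_mult_indicator[rotated]) simp
    then show "integrable lborel (\<lambda>x. indicator ?Q ((x + int_vec k) - int_vec k) * h (x + int_vec k))"
      by (simp add: mult.commute)
  qed
  also have "\<dots> = (\<Sum>k\<in>F. \<integral>y. indicator ?Q (y - int_vec k) * h y \<partial>lborel)"
    by (intro sum.cong refl integral_lborel_translate) measurable
  also have "\<dots> = (\<integral>y. (\<Sum>k\<in>F. indicator ?Q (y - int_vec k) * h y) \<partial>lborel)"
  proof (rule Bochner_Integration.integral_sum[symmetric])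
    fix k
    have "{y. y - int_vec k \<in> ?Q} \<in> sets lborel" by measurable
    then have "integrable lborel (\<lambda>y. h y * indicator {y. y - int_vec k \<in> ?Q} y)"
      using h by (rule integrable_real_mult_indicator)
    then show "integrable lborel (\<lambda>y. indicator ?Q (y - int_vec k) * h y)"
      by (simp add: mult.commute indicator_def)
  qed
  also have "\<dots> = (\<integral>y. h y \<partial>lborel)"
  proof (intro Bochner_Integration.integral_cong refl)
    fix y :: "real ^ 'd"
    \<comment> \<open>The only shifted cube that contains \<open>y\<close> is given by the integer
      parts of its coordinates.\<close>
    define k0 where "k0 = (\<chi> a. \<lfloor>y $ a\<rfloor>)"
    have k0: "y - int_vec k \<in> ?Q \<longleftrightarrow> k = k0" for k
    proof -
      have "0 \<le> y $ a - of_int (k $ a) \<and> y $ a - of_int (k $ a) < 1 \<longleftrightarrow> k $ a = \<lfloor>y $ a\<rfloor>" for a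
        by linarith
      then show ?thesis by (simp add: k0_def int_vec_def vec_eq_iff)
    qed
    show "(\<Sum>k\<in>F. indicator ?Q (y - int_vec k) * h y) = h y"
    proof (cases "h y = 0")
      case False
      then have "wv_vec ?n G m ((y - int_vec k0) + int_vec k0) \<noteq> 0" unfolding h_def by simp
      then have "k0 \<in> F" using inF[of "y - int_vec k0" k0] k0[of k0] by blast
      have "(\<Sum>k\<in>F. indicator ?Q (y - int_vec k) * h y) = (\<Sum>k\<in>F. if k = k0 then h y else 0)"
        by (intro sum.cong refl) (simp add: indicator_def k0 del: mem_Collect_eq)
      then show ?thesis using F \<open>k0 \<in> F\<close> by simp
    qed simp
  qed
  finally show ?thesis unfolding h_def coef_def .
qed

text \<open>Coefficients depend on the residue class only, so grouping the window at
  \<open>x\<close> by classes turns the periodized sum into the kernel applied to \<phi>.\<close>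

lemma level_sum:
  assumes \<phi>: "\<phi> \<in> test_functions"
  shows "(\<Sum>m\<in>positions L j. wavelet_per \<psi> L j G m x * coef (j + L) G m \<phi>) = 
    (\<integral>y. kernel_vec G (j + L) x y * \<phi> y \<partial>lborel)"
proof -
  let ?n = "j + L"
  have "(\<Sum>m\<in>positions L j. wavelet_per \<psi> L j G m x * coef ?n G m \<phi>) =
    (\<Sum>m\<in>positions L j. \<Sum>m' | m' \<in> window_vec ?n x \<and> residue_vec ?n m' = m. wv_vec ?n G m' x * coef ?n G m' \<phi>)"
    using coef_residue[OF \<phi>] by (intro sum.cong refl) (auto simp: wavelet_per_eq_sum sum_distrib_right intro!: sum.cong)
  also have "\<dots> = (\<Sum>m'\<in>window_vec ?n x. wv_vec ?n G m' x * coef ?n G m' \<phi>)"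
    by (intro sum.group finite_window_vec finite_positions) (auto simp: residue_vec_positions)
  also have "\<dots> = (\<integral>y. (\<Sum>m'\<in>window_vec ?n x. wv_vec ?n G m' x * (wv_vec ?n G m' y * \<phi> y)) \<partial>lborel)"
    unfolding coef_def by (subst Bochner_Integration.integral_sum) (auto intro: integrable_wv_vec_mult[OF \<phi>])
  also have "\<dots> = (\<integral>y. kernel_vec G ?n x y * \<phi> y \<partial>lborel)"
    unfolding kernel_vec_eq_sum by (simp add: sum_distrib_right mult.assoc)
  finally show ?thesis .
qed

text \<open>The grouping of \<open>level_sum\<close>, with the triangle inequality inside each
  class. It leaves a sum over a window, whose size is bounded independently of the level.\<close>

lemma level_abs_sum:
  assumes \<phi>: "\<phi> \<in> test_functions"
  shows "(\<Sum>m\<in>positions L j. \<bar>wavelet_per \<psi> L j G m x * coef (j + L) G m \<phi>\<bar>) \<le>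
    (\<Sum>m\<in>window_vec (j + L) x. \<bar>wv_vec (j + L) G m x * coef (j + L) G m \<phi>\<bar>)"
proof -
  let ?n = "j + L"
  have "\<bar>wavelet_per \<psi> L j G m x * coef ?n G m \<phi>\<bar> \<le>
     (\<Sum>m' | m' \<in> window_vec ?n x \<and> residue_vec ?n m' = m. \<bar>wv_vec ?n G m' x * coef ?n G m' \<phi>\<bar>)"
    if "m \<in> positions L j" for m
  proof -
    have "wavelet_per \<psi> L j G m x * coef ?n G m \<phi> =
      (\<Sum>m' | m' \<in> window_vec ?n x \<and> residue_vec ?n m' = m. wv_vec ?n G m' x * coef ?n G m' \<phi>)"
      using coef_residue[OF \<phi>] that by (auto simp: wavelet_per_eq_sum sum_distrib_right intro!: sum.cong)
    then show ?thesis by (simp only: sum_abs)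
  qed
  then have "(\<Sum>m\<in>positions L j. \<bar>wavelet_per \<psi> L j G m x * coef ?n G m \<phi>\<bar>) \<le>
    (\<Sum>m\<in>positions L j. \<Sum>m' | m' \<in> window_vec ?n x \<and> residue_vec ?n m' = m. \<bar>wv_vec ?n G m' x * coef ?n G m' \<phi>\<bar>)"
    by (rule sum_mono)
  also have "\<dots> = (\<Sum>m'\<in>window_vec ?n x. \<bar>wv_vec ?n G m' x * coef ?n G m' \<phi>\<bar>)"
    by (intro sum.group finite_window_vec finite_positions) (auto simp: residue_vec_positions)
  finally show ?thesis .
qed

section \<open>Decay of the terms and convergence\<close>

lemma half_powr_power: "(2 powr (real n / 2) * c) ^ d * (2 powr (real n / 2) * c) ^ d = (2 ^ n * c\<^sup>2) ^ d"
  for c :: real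
  by (simp add: powr_half[symmetric] power2_eq_square ac_simps flip: power_mult_distrib)

text \<open>A mother factor makes the product have integral zero, so only the variation of \<phi>
  over the support counts, which gives the factor \<open>1 / 2 ^ n\<close>. The heights of the two
  wavelets multiply to order 2^(nd), compensated by the volume of the support.\<close>

lemma coef_mother_bound:
  fixes G :: "'d::finite \<Rightarrow> gender"
  assumes \<phi>: "\<phi> \<in> test_functions" and lip: "\<And>x y. \<bar>\<phi> x - \<phi> y\<bar> \<le> K * norm (x - y)" and K: "K \<ge> 0"
    and G: "G a0 = Mother"
  shows "\<bar>wv_vec n G m x * coef n G m \<phi>\<bar> \<le> (2 * R * B\<^sup>2) ^ CARD('d) * (K * real CARD('d) * R) / 2 ^ n"
proof -
  let ?P = "2 powr (real n / 2) * B" and ?d = "CARD('d)"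
  have "\<bar>(\<integral>y. (\<Prod>a\<in>UNIV. wv (G a) n (m $ a) (y $ a)) * \<phi> y \<partial>lborel) 
      - (\<Prod>a\<in>UNIV. \<integral>s. wv (G a) n (m $ a) s \<partial>lborel) * \<phi> (\<chi> a. of_int (m $ a) / 2 ^ n)\<bar>
    \<le> (2 * (R / 2 ^ n) * ?P) ^ CARD('d) * (K * real CARD('d) * (R / 2 ^ n))"
  proof (rule product_kernel_estimate)
    fix a s assume "wv (G a) n (m $ a) s \<noteq> 0"
    then have "\<bar>2 ^ n * s - of_int (m $ a)\<bar> \<le> R" using wv_nonzero_window unfolding window_def by blast
    moreover have "s - of_int (m $ a) / 2 ^ n = (2 ^ n * s - of_int (m $ a)) / 2 ^ n" by (simp add: field_simps)
    ultimately show "\<bar>s - (\<chi> a. of_int (m $ a) / 2 ^ n) $ a\<bar> \<le> R / 2 ^ n" by (simp add: divide_right_mono)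
  qed (use R_pos B_pos K lip cts_compact_wv wv_bound test_functions_continuous_on[OF \<phi>] in auto)
  moreover have "(\<Prod>a\<in>UNIV. \<integral>s. wv (G a) n (m $ a) s \<partial>lborel) = 0"
    using G mother_integral by (auto simp: wv_integral intro!: exI[of _ a0])
  ultimately have "\<bar>coef n G m \<phi>\<bar> \<le> (2 * (R / 2 ^ n) * ?P) ^ ?d * (K * real ?d * (R / 2 ^ n))"
    unfolding coef_def wv_vec_def by simp
  then have "\<bar>wv_vec n G m x * coef n G m \<phi>\<bar> \<le> ?P ^ ?d * ((2 * (R / 2 ^ n) * ?P) ^ ?d * (K * real ?d * (R / 2 ^ n)))"
    unfolding abs_mult using wv_vec_bound[of n G m x] B_pos by (intro mult_mono) auto
  also have "\<dots> = (?P ^ ?d * ?P ^ ?d) * (2 * (R / 2 ^ n)) ^ ?d * (K * real ?d * (R / 2 ^ n))"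
    by (simp only: power_mult_distrib ac_simps)
  also have "\<dots> = (2 ^ n * B\<^sup>2 * (2 * (R / 2 ^ n))) ^ ?d * (K * real ?d * (R / 2 ^ n))"
    unfolding half_powr_power by (simp only: power_mult_distrib)
  also have "\<dots> = (2 * R * B\<^sup>2) ^ ?d * (K * real ?d * R) / 2 ^ n" by (simp add: ac_simps)
  finally show ?thesis .
qed

text \<open>The tensor kernels have integral one and supports of radius
  \<open>2 * R / 2 ^ n\<close>, so the error is governed by the variation of a Lipschitz function
  over such a cube.\<close>

lemma kernel_vec_converges:
  fixes \<phi> :: "real ^ 'd::finite \<Rightarrow> real"
  assumes \<phi>: "\<phi> \<in> test_functions"
  shows "(\<lambda>n. \<integral>y. kernel_vec (\<lambda>_. Father) n x y * \<phi> y \<partial>lborel) \<longlonglongrightarrow> \<phi> x"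
proof -
  let ?d = "CARD('d)"
  obtain K where K: "K > 0" and lip: "\<And>x y. \<bar>\<phi> x - \<phi> y\<bar> \<le> K * norm (x - y)"
    using test_functions_lipschitz[OF \<phi>] by blast
  let ?A = "(2 * R + 1) * B\<^sup>2"
  let ?E = "(4 * R * ?A) ^ ?d * (K * real ?d * (2 * R))"
  have "\<bar>(\<integral>y. kernel_vec (\<lambda>_. Father) n x y * \<phi> y \<partial>lborel) - \<phi> x\<bar> \<le> ?E / 2 ^ n" for n
  proof -
    have "\<bar>(\<integral>y. (\<Prod>a\<in>UNIV. kernel Father n (x $ a) (y $ a)) * \<phi> y \<partial>lborel) 
      - (\<Prod>a\<in>(UNIV::'d set). \<integral>s. kernel Father n (x $ a) s \<partial>lborel) * \<phi> x\<bar>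
      \<le> (2 * (2 * R / 2 ^ n) * (?A * 2 ^ n)) ^ CARD('d) * (K * real CARD('d) * (2 * R / 2 ^ n))"
    proof (rule product_kernel_estimate)
      show "\<bar>s - x $ a\<bar> \<le> 2 * R / 2 ^ n" if "kernel Father n (x $ a) s \<noteq> 0" for a s
        using kernel_support[OF that] by (simp add: abs_minus_commute)
    qed (use R_pos B_pos K lip cts_compact_kernel kernel_bound[of Father n] test_functions_continuous_on[OF \<phi>] in auto)
    also have "2 * (2 * R / 2 ^ n) * (?A * 2 ^ n) = 4 * R * ?A" by simp
    finally show ?thesis unfolding kernel_integral kernel_vec_def by simp
  qed
  then have "\<forall>\<^sub>F n in sequentially. norm ((\<integral>y. kernel_vec (\<lambda>_. Father) n x y * \<phi> y \<partial>lborel) - \<phi> x) \<le> ?E / 2 ^ n"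
    by (intro always_eventually allI) (simp only: real_norm_def)
  moreover have "(\<lambda>n. ?E / 2 ^ n) \<longlonglongrightarrow> 0" using LIMSEQ_divide_realpow_zero[of 2 ?E] by simp
  ultimately have "(\<lambda>n. (\<integral>y. kernel_vec (\<lambda>_. Father) n x y * \<phi> y \<partial>lborel) - \<phi> x) \<longlonglongrightarrow> 0"
    by (rule Lim_null_comparison)
  then show ?thesis by (simp add: LIM_zero_iff)
qed

lemma integrable_kernel_vec_mult:
  assumes \<phi>: "\<phi> \<in> test_functions"
  shows "integrable lborel (\<lambda>y. kernel_vec G n x y * \<phi> y)"
  unfolding kernel_vec_eq_sum sum_distrib_right
  by (intro Bochner_Integration.integrable_sum) (simp add: mult.assoc integrable_wv_vec_mult[OF \<phi>])

text \<open>Absolute summability over all indices allows the value to be computed level by level,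
  where the partial sums are integrals against father kernels of increasing level.\<close>

theorem pointwise_wavelet_expansion:
  fixes \<phi> :: "real ^ 'd::finite \<Rightarrow> real"
  assumes \<phi>: "\<phi> \<in> test_functions"
  shows "((\<lambda>(j, G, m). wavelet_per \<psi> L j G m x * (\<integral>y. wavelet_per \<psi> L j G m y * \<phi> y \<partial>torus_measure))
     has_sum \<phi> x) {(j, G, m). G \<in> genders j \<and> m \<in> positions L j}"
proof -
  let ?d = "CARD('d)"
  define T where "T j = (genders j :: ('d \<Rightarrow> gender) set) \<times> (positions L j :: (int ^ 'd) set)" for j
  define f where "f = (\<lambda>(j, G, m). wavelet_per \<psi> L j G m x * coef (j + L) G m \<phi>)"
  have T: "finite (T j)" for j unfolding T_def by (intro finite_cartesian_product finite_genders finite_positions)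
  have idx: "{(j, G, m). G \<in> genders j \<and> m \<in> positions L j} = Sigma UNIV T"
    unfolding T_def by auto
  define g where "g j = (\<Sum>p\<in>T j. f (j, p))" for j
  have g: "g j = (\<integral>y. (\<Sum>G\<in>genders j. kernel_vec G (j + L) x y) * \<phi> y \<partial>lborel)" for j
  proof -
    have "g j = (\<Sum>G\<in>genders j. \<Sum>m\<in>positions L j. wavelet_per \<psi> L j G m x * coef (j + L) G m \<phi>)"
      unfolding g_def T_def f_def by (simp add: sum.cartesian_product)
    also have "\<dots> = (\<Sum>G\<in>genders j. \<integral>y. kernel_vec G (j + L) x y * \<phi> y \<partial>lborel)"
      unfolding level_sum[OF \<phi>] ..
    also have "\<dots> = (\<integral>y. (\<Sum>G\<in>genders j. kernel_vec G (j + L) x y * \<phi> y) \<partial>lborel)"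
      by (intro Bochner_Integration.integral_sum[symmetric] integrable_kernel_vec_mult \<phi>)
    finally show ?thesis by (simp add: sum_distrib_right)
  qed
  have "(\<Sum>j<Suc J. g j) = (\<integral>y. kernel_vec (\<lambda>_. Father) (Suc J + L) x y * \<phi> y \<partial>lborel)" for J
  proof -
    have "(\<Sum>j<Suc J. g j) = (\<integral>y. (\<Sum>j<Suc J. (\<Sum>G\<in>genders j. kernel_vec G (j + L) x y) * \<phi> y) \<partial>lborel)"
      unfolding g
      by (intro Bochner_Integration.integral_sum[symmetric])
         (auto simp: sum_distrib_right intro!: Bochner_Integration.integrable_sum integrable_kernel_vec_mult \<phi>)
    then show ?thesis unfolding sum_distrib_right[symmetric] kernel_vec_telescope .
  qed
  moreover have "(\<lambda>J. \<integral>y. kernel_vec (\<lambda>_. Father) (Suc J + L) x y * \<phi> y \<partial>lborel) \<longlonglongrightarrow> \<phi> x"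
    using LIMSEQ_ignore_initial_segment[OF kernel_vec_converges[OF \<phi>, of x], of "Suc L"] by (simp add: ac_simps)
  ultimately have "(\<lambda>J. \<Sum>j<Suc J. g j) \<longlonglongrightarrow> \<phi> x" by simp
  then have "g sums \<phi> x" unfolding sums_def by (rule LIMSEQ_imp_Suc)
  obtain K where K: "K > 0" and lip: "\<And>x y. \<bar>\<phi> x - \<phi> y\<bar> \<le> K * norm (x - y)"
    using test_functions_lipschitz[OF \<phi>] by blast
  define D where "D = (2 * R * B\<^sup>2) ^ ?d * (K * real ?d * R)"
  have D: "D \<ge> 0" unfolding D_def using R_pos K by simp
  define C where "C = real (card (UNIV :: ('d \<Rightarrow> gender) set)) * ((2 * R + 1) ^ ?d * D)"
  \<comment> \<open>Level 0 contains the all-father term, which has no cancellation; being a single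
    finite level, it leaves summability unaffected.\<close>
  have bound: "(\<Sum>p\<in>T j. \<bar>f (j, p)\<bar>) \<le> C * (1 / 2) ^ j" if j: "j \<noteq> 0" for j
  proof -
    have "(\<Sum>p\<in>T j. \<bar>f (j, p)\<bar>) = (\<Sum>G\<in>genders j. \<Sum>m\<in>positions L j. \<bar>wavelet_per \<psi> L j G m x * coef (j + L) G m \<phi>\<bar>)"
      unfolding T_def f_def by (simp add: sum.cartesian_product case_prod_beta)
    also have "\<dots> \<le> (\<Sum>G\<in>(genders j :: ('d \<Rightarrow> gender) set). (2 * R + 1) ^ ?d * (D / 2 ^ (j + L)))"
    proof (rule sum_mono)
      fix G :: "'d \<Rightarrow> gender" assume "G \<in> genders j"
      then obtain a0 where "G a0 = Mother" using j unfolding genders_def by auto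
      then have "\<bar>wv_vec (j + L) G m x * coef (j + L) G m \<phi>\<bar> \<le> D / 2 ^ (j + L)" for m
        unfolding D_def using K by (intro coef_mother_bound[OF \<phi> lip]) auto
      then have "(\<Sum>m\<in>window_vec (j + L) x. \<bar>wv_vec (j + L) G m x * coef (j + L) G m \<phi>\<bar>) \<le> 
          real (card (window_vec (j + L) x)) * (D / 2 ^ (j + L))"
        by (intro sum_bounded_above)
      also have "\<dots> \<le> (2 * R + 1) ^ ?d * (D / 2 ^ (j + L))"
        using D by (intro mult_right_mono card_window_vec) auto
      finally show "(\<Sum>m\<in>positions L j. \<bar>wavelet_per \<psi> L j G m x * coef (j + L) G m \<phi>\<bar>) \<le> (2 * R + 1) ^ ?d * (D / 2 ^ (j + L))"
        using level_abs_sum[OF \<phi>, of L j G x] by linarith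
    qed
    also have "\<dots> = real (card (genders j :: ('d \<Rightarrow> gender) set)) * ((2 * R + 1) ^ ?d * (D / 2 ^ (j + L)))" by simp
    also have "\<dots> \<le> real (card (UNIV :: ('d \<Rightarrow> gender) set)) * ((2 * R + 1) ^ ?d * (D / 2 ^ j))"
    proof (intro mult_mono)
      show "real (card (genders j :: ('d \<Rightarrow> gender) set)) \<le> real (card (UNIV :: ('d \<Rightarrow> gender) set))"
        by (simp add: card_mono finite_genders)
      show "D / 2 ^ (j + L) \<le> D / 2 ^ j" using D by (intro divide_left_mono) auto
    qed (use D R_pos in auto)
    also have "\<dots> = C * (1 / 2) ^ j" unfolding C_def by (simp add: power_divide)
    finally show ?thesis .
  qed
  have "summable (\<lambda>j. \<Sum>p\<in>T j. \<bar>f (j, p)\<bar>)"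
  proof (rule summable_comparison_test_ev)
    show "\<forall>\<^sub>F j in sequentially. norm (\<Sum>p\<in>T j. \<bar>f (j, p)\<bar>) \<le> C * (1 / 2) ^ j"
      using eventually_gt_at_top[of "0::nat"] by eventually_elim (use bound in \<open>auto simp: sum_nonneg\<close>)
  qed (intro summable_mult summable_geometric, simp)
  then have s: "summable (\<lambda>j. norm (\<Sum>p\<in>T j. \<bar>f (j, p)\<bar>))" by (simp add: sum_nonneg)
  have abs: "(\<lambda>p. norm (f p)) summable_on Sigma UNIV T"
    unfolding Infinite_Sum.abs_summable_on_Sigma_iff using T norm_summable_imp_summable_on[of "\<lambda>j. norm (\<Sum>p\<in>T j. \<bar>f (j, p)\<bar>)"] s by simp
  have "(g has_sum \<phi> x) UNIV"
  proof (rule norm_summable_imp_has_sum[OF _ \<open>g sums \<phi> x\<close>])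
    show "summable (\<lambda>j. norm (g j))"
    proof (rule summable_comparison_test[OF _ s])
      have "norm (norm (g j)) \<le> norm (\<Sum>p\<in>T j. \<bar>f (j, p)\<bar>)" for j
        unfolding g_def by (simp add: sum_nonneg)
      then show "\<exists>N. \<forall>n\<ge>N. norm (norm (g n)) \<le> norm (\<Sum>p\<in>T n. \<bar>f (n, p)\<bar>)" by blast
    qed
  qed
  then have "(f has_sum \<phi> x) (Sigma UNIV T)"
    using T abs_summable_summable[OF abs] by (intro has_sum_SigmaI[where g=g]) (auto simp: g_def intro: has_sum_finite)
  then show ?thesis unfolding idx f_def integral_torus_wavelet_per[OF \<phi>] .
qed

end

section \<open>Besov norms of Dirac combinations\<close>

lemma enn_powr_ennreal: "x \<ge> 0 \<Longrightarrow> enn_powr (ennreal x) r = ennreal (x powr r)"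
  unfolding enn_powr_def by simp

lemma enn_powr_mono_ennreal:
  assumes "a \<le> ennreal x" "x \<ge> 0" "r \<ge> 0"
  shows "enn_powr a r \<le> ennreal (x powr r)"
proof -
  obtain y where y: "a = ennreal y" "y \<ge> 0" using assms(1) by (cases a) (auto simp: top_unique)
  then have "y \<le> x" using assms by simp
  then show ?thesis using y assms by (simp add: enn_powr_ennreal ennreal_leI powr_mono2)
qed

lemma recip_ereal: "r > 0 \<Longrightarrow> recip (ereal r) = 1 / r"
  unfolding recip_def by (simp add: divide_ereal_def inverse_eq_divide one_ereal_def)

lemma recip_infinity: "recip \<infinity> = 0"
  unfolding recip_def by simp

text \<open>Zero entries contribute nothing to the sum because \<open>0 powr r\<close> is 0. For
  infinite \<open>p\<close> the exponent \<open>recip p\<close> is 0, so the same bound covers the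
  supremum.\<close>

lemma lp_norm_le_sparse:
  assumes p: "0 < p" and I: "finite I" and A: "A \<ge> 0" and N: "1 \<le> N"
    and card: "real (card {i \<in> I. a i \<noteq> 0}) \<le> N" and le: "\<And>i. i \<in> I \<Longrightarrow> a i \<le> ennreal A"
  shows "lp_norm p I a \<le> ennreal (N powr recip p * A)"
proof (cases p)
  case (real r)
  then have r: "r > 0" using p by simp
  have "(\<Sum>\<^sub>\<infinity>i\<in>I. enn_powr (a i) r) = (\<Sum>i\<in>I. enn_powr (a i) r)" using I by simp
  also have "\<dots> = (\<Sum>i | i \<in> I \<and> a i \<noteq> 0. enn_powr (a i) r)"
    using I by (intro sum.mono_neutral_right) (auto simp: enn_powr_def)
  also have "\<dots> \<le> (\<Sum>i | i \<in> I \<and> a i \<noteq> 0. ennreal (A powr r))"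
    using le A r by (intro sum_mono enn_powr_mono_ennreal) auto
  also have "\<dots> = ennreal (real (card {i \<in> I. a i \<noteq> 0}) * A powr r)"
    by (simp add: ennreal_mult flip: ennreal_of_nat_eq_real_of_nat)
  also have "\<dots> \<le> ennreal (N * A powr r)"
    using card by (intro ennreal_leI mult_right_mono) auto
  finally have "enn_powr (\<Sum>\<^sub>\<infinity>i\<in>I. enn_powr (a i) r) (1 / r) \<le> ennreal ((N * A powr r) powr (1 / r))"
    using N r by (intro enn_powr_mono_ennreal) auto
  also have "(N * A powr r) powr (1 / r) = N powr (1 / r) * A"
    using N A r by (simp add: powr_mult powr_powr)
  finally show ?thesis unfolding lp_norm_def real using r by (simp add: recip_ereal)
next
  case PInf
  then show ?thesis unfolding lp_norm_def using le N by (auto simp: recip_infinity intro: SUP_least)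
next
  case MInf
  then show ?thesis using p by simp
qed

text \<open>For a finite exponent \<open>r\<close> the powers of the bound are again geometric, of
  ratio \<open>\<rho> powr r\<close>; for the infinite exponent all entries are at most
  \<open>D\<close>.\<close>

lemma lp_norm_geometric_finite:
  assumes q: "0 < q" and D: "D \<ge> 0" and \<rho>: "0 < \<rho>" "\<rho> < 1" and le: "\<And>j::nat. a j \<le> ennreal (D * \<rho> ^ j)"
  shows "lp_norm q UNIV a < \<infinity>"
proof (cases q)
  case (real r)
  then have r: "r > 0" using q by simp
  define s where "s j = (D * \<rho> ^ j) powr r" for j :: nat
  have s: "s j = D powr r * (\<rho> powr r) ^ j" for j
    unfolding s_def using D \<rho> by (simp add: powr_mult powr_powr mult.commute flip: powr_realpow)
  have "\<rho> powr r < 1" using powr_less_mono2[of r \<rho> 1] \<rho> r by simp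
  then have sm: "summable s" unfolding s by (intro summable_mult summable_geometric) auto
  have s0: "s j \<ge> 0" for j unfolding s_def by simp
  have "(\<Sum>\<^sub>\<infinity>j\<in>UNIV. enn_powr (a j) r) = (SUP F\<in>{F. finite F \<and> F \<subseteq> UNIV}. \<Sum>j\<in>F. enn_powr (a j) r)"
    by (rule nonneg_infsum_complete) simp
  also have "\<dots> \<le> ennreal (suminf s)"
  proof (rule SUP_least)
    fix F :: "nat set" assume "F \<in> {F. finite F \<and> F \<subseteq> UNIV}"
    then have F: "finite F" by simp
    have "(\<Sum>j\<in>F. enn_powr (a j) r) \<le> (\<Sum>j\<in>F. ennreal (s j))"
      unfolding s_def using le D \<rho> r by (intro sum_mono enn_powr_mono_ennreal) auto
    also have "\<dots> = ennreal (\<Sum>j\<in>F. s j)" using s0 by simp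
    also have "\<dots> \<le> ennreal (suminf s)" using F sm s0 by (intro ennreal_leI sum_le_suminf) auto
    finally show "(\<Sum>j\<in>F. enn_powr (a j) r) \<le> ennreal (suminf s)" .
  qed
  finally have "enn_powr (\<Sum>\<^sub>\<infinity>j\<in>UNIV. enn_powr (a j) r) (1 / r) \<le> ennreal (suminf s powr (1 / r))"
    using r sm s0 by (intro enn_powr_mono_ennreal suminf_nonneg) auto
  also have "\<dots> < \<infinity>" by simp
  finally show ?thesis unfolding lp_norm_def real by simp
next
  case PInf
  have "a j \<le> ennreal D" for j
  proof -
    have "D * \<rho> ^ j \<le> D * 1" using D \<rho> by (intro mult_left_mono power_le_one) auto
    then show ?thesis using le[of j] ennreal_leI order_trans by fastforce
  qed
  then have "(SUP j. a j) \<le> ennreal D" by (rule SUP_least)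
  also have "\<dots> < \<infinity>" by simp
  finally show ?thesis unfolding lp_norm_def PInf by simp
next
  case MInf
  then show ?thesis using q by simp
qed

text \<open>Regularity at least 1 gives both differentiability, hence continuity, and a vanishing
  zeroth moment of the mother.\<close>

lemma wavelet_system_imp_wavelet_1d:
  assumes "wavelet_system u \<psi>" "u \<ge> 1"
  obtains R B where "wavelet_1d \<psi> R B"
proof -
  have C: "C_k u (\<psi> g)" "compact (closure {x. \<psi> g x \<noteq> 0})" for g
    using assms(1) unfolding wavelet_system_def by blast+
  have "\<psi> g differentiable (at x)" for g x
    using C(1)[of g] assms(2) unfolding C_k_def by (metis funpow_0 less_le_trans zero_less_one)
  then have cont: "continuous_on UNIV (\<psi> g)" for g
    by (intro continuous_at_imp_continuous_on ballI differentiable_imp_continuous_within)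
  have "\<forall>g. \<exists>r>0. \<forall>x. \<psi> g x \<noteq> 0 \<longrightarrow> \<bar>x\<bar> \<le> r"
  proof
    fix g
    obtain r where "r > 0" "\<forall>x\<in>closure {x. \<psi> g x \<noteq> 0}. norm x \<le> r"
      using compact_imp_bounded[OF C(2)] bounded_pos by blast
    then show "\<exists>r>0. \<forall>x. \<psi> g x \<noteq> 0 \<longrightarrow> \<bar>x\<bar> \<le> r"
      using closure_subset[of "{x. \<psi> g x \<noteq> 0}"] by (intro exI[of _ r]) (auto dest!: subsetD)
  qed
  then obtain r where r: "\<And>g. r g > 0" "\<And>g x. \<psi> g x \<noteq> 0 \<Longrightarrow> \<bar>x\<bar> \<le> r g" by metis
  have "\<forall>g. \<exists>b>0. \<forall>x. \<bar>\<psi> g x\<bar> \<le> b"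
  proof
    fix g
    have "compact (\<psi> g ` {- r g..r g})"
      by (intro compact_continuous_image continuous_on_subset[OF cont]) auto
    then obtain b where b: "b > 0" "\<And>x. x \<in> {- r g..r g} \<Longrightarrow> \<bar>\<psi> g x\<bar> \<le> b"
      using bounded_pos compact_imp_bounded by (metis imageI real_norm_def)
    have "\<bar>\<psi> g x\<bar> \<le> b" for x
      using b r(2)[of g x] by (cases "\<psi> g x = 0") (auto simp: abs_le_iff)
    then show "\<exists>b>0. \<forall>x. \<bar>\<psi> g x\<bar> \<le> b" using b(1) by blast
  qed
  then obtain b where b: "\<And>g. b g > 0" "\<And>g x. \<bar>\<psi> g x\<bar> \<le> b g" by metis
  have "wavelet_1d \<psi> (max (r Father) (r Mother)) (max (b Father) (b Mother))"
  proof
    fix g x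
    show "\<bar>x\<bar> \<le> max (r Father) (r Mother)" if "\<psi> g x \<noteq> 0" using r(2)[OF that] by (cases g) auto
    show "\<bar>\<psi> g x\<bar> \<le> max (b Father) (b Mother)" using b(2)[of g x] by (cases g) auto
    have "(\<integral>x. x ^ 0 * \<psi> Mother x \<partial>lborel) = 0" using assms unfolding wavelet_system_def by (metis less_le_trans zero_less_one)
    then show "(\<integral>x. \<psi> Mother x \<partial>lborel) = 0" by simp
    show "orthonormal_basis_L2 (wavelet_family_1d \<psi>)" using assms(1) unfolding wavelet_system_def by blast
  qed (use r(1) b(1) cont in \<open>auto simp: less_max_iff_disj\<close>)
  then show ?thesis by (rule that)
qed

section \<open>Coefficients of Dirac combinations\<close>

context wavelet_1d
begin

text \<open>Expansions use the rescaled wavelets 2^(-(j + L) d / 2) Psi, so the coefficient is the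
  reciprocal power of 2 times the pairing with Psi, here an evaluation at the points
  \<open>x k\<close>.\<close>

definition dirac_coeff ::
    "nat \<Rightarrow> nat \<Rightarrow> (nat \<Rightarrow> real) \<Rightarrow> (nat \<Rightarrow> real ^ 'd::finite) \<Rightarrow> nat \<Rightarrow> ('d \<Rightarrow> gender) \<Rightarrow> int ^ 'd \<Rightarrow> real" where
  "dirac_coeff L n t x j G m =
     2 powr (real (j + L) * real CARD('d) / 2) * (\<Sum>k<n. t k * wavelet_per \<psi> L j G m (x k))"

text \<open>Half of the exponent of \<open>2 ^ (j + L)\<close> comes from the normalization of the
  coefficients, the other half from the height of the wavelet.\<close>

lemma dirac_coeff_bound:
  fixes x :: "nat \<Rightarrow> real ^ 'd::finite"
  assumes "m \<in> positions L j"
  shows "\<bar>dirac_coeff L n t x j G m\<bar> \<le> (\<Sum>k<n. \<bar>t k\<bar>) * ((2 * R + 1) * B) ^ CARD('d) * (2 ^ (j + L)) ^ CARD('d)"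
proof -
  let ?d = "CARD('d)" and ?P = "2 powr (real (j + L) / 2) :: real"
  have P: "2 powr (real (j + L) * real ?d / 2) = ?P ^ ?d"
    by (simp add: powr_power mult.commute)
  have "\<bar>\<Sum>k<n. t k * wavelet_per \<psi> L j G m (x k)\<bar> \<le> (\<Sum>k<n. \<bar>t k\<bar> * ((2 * R + 1) ^ ?d * (?P * B) ^ ?d))"
    by (intro order_trans[OF sum_abs] sum_mono) (simp only: abs_mult mult_left_mono wavelet_per_bound[OF assms] abs_ge_zero)
  then have "\<bar>\<Sum>k<n. t k * wavelet_per \<psi> L j G m (x k)\<bar> \<le> (\<Sum>k<n. \<bar>t k\<bar>) * ((2 * R + 1) ^ ?d * (?P * B) ^ ?d)"
    by (simp only: sum_distrib_right)
  then have "\<bar>dirac_coeff L n t x j G m\<bar> \<le> ?P ^ ?d * ((\<Sum>k<n. \<bar>t k\<bar>) * ((2 * R + 1) ^ ?d * (?P * B) ^ ?d))"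
    unfolding dirac_coeff_def P abs_mult by (intro mult_mono) auto
  also have "\<dots> = (\<Sum>k<n. \<bar>t k\<bar>) * ((2 * R + 1) * B) ^ ?d * ((?P * 1) ^ ?d * (?P * 1) ^ ?d)"
    by (simp add: power_mult_distrib)
  also have "\<dots> = (\<Sum>k<n. \<bar>t k\<bar>) * ((2 * R + 1) * B) ^ ?d * (2 ^ (j + L)) ^ ?d"
    unfolding half_powr_power by simp
  finally show ?thesis .
qed

text \<open>Only positions whose residue class meets the window of some \<open>x k\<close> survive,
  and the bound on the size of a window does not depend on the level.\<close>

lemma card_dirac_coeff_nonzero:
  fixes x :: "nat \<Rightarrow> real ^ 'd::finite"
  shows "real (card {m \<in> positions L j. dirac_coeff L n t x j G m \<noteq> 0}) \<le> real n * (2 * R + 1) ^ CARD('d)"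
proof -
  let ?W = "\<lambda>k. residue_vec (j + L) ` window_vec (j + L) (x k)"
  have "{m \<in> positions L j. dirac_coeff L n t x j G m \<noteq> 0} \<subseteq> (\<Union>k<n. ?W k)"
  proof
    fix m assume "m \<in> {m \<in> positions L j. dirac_coeff L n t x j G m \<noteq> 0}"
    then have m: "m \<in> positions L j" and "(\<Sum>k<n. t k * wavelet_per \<psi> L j G m (x k)) \<noteq> 0"
      unfolding dirac_coeff_def by auto
    then obtain k where "k < n" "wavelet_per \<psi> L j G m (x k) \<noteq> 0"
      by (auto elim: sum.not_neutral_contains_not_neutral)
    then show "m \<in> (\<Union>k<n. ?W k)" using wavelet_per_nonzero[OF m] by blast
  qed
  then have "card {m \<in> positions L j. dirac_coeff L n t x j G m \<noteq> 0} \<le> card (\<Union>k<n. ?W k)"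
    by (intro card_mono) (auto simp: finite_window_vec)
  also have "\<dots> \<le> (\<Sum>k<n. card (?W k))" by (rule card_UN_le) simp
  also have "\<dots> \<le> (\<Sum>k<n. card (window_vec (j + L) (x k)))"
    by (intro sum_mono card_image_le finite_window_vec)
  finally have "real (card {m \<in> positions L j. dirac_coeff L n t x j G m \<noteq> 0}) \<le> (\<Sum>k<n. real (card (window_vec (j + L) (x k))))"
    unfolding of_nat_sum[symmetric] by (rule of_nat_mono)
  also have "\<dots> \<le> (\<Sum>k<n. (2 * R + 1) ^ CARD('d))" by (intro sum_mono card_window_vec)
  finally show ?thesis by simp
qed

lemma besov_seq_norm_dirac_coeff:
  fixes x :: "nat \<Rightarrow> real ^ 'd::finite"
  assumes p: "0 < p" and q: "0 < q" and \<tau>: "\<tau> < real CARD('d) * (recip p - 1)"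
  shows "besov_seq_norm L \<tau> p q (\<lambda>j G m. complex_of_real (dirac_coeff L n t x j G m)) < \<infinity>"
proof -
  let ?d = "CARD('d)"
  \<comment> \<open>The maximum keeps \<open>N\<close> at least 1 when there are no atoms.\<close>
  define N where "N = max 1 (real n * (2 * R + 1) ^ ?d)"
  define Ng where "Ng = real (card (UNIV :: ('d \<Rightarrow> gender) set))"
  define E where "E = (\<Sum>k<n. \<bar>t k\<bar>) * ((2 * R + 1) * B) ^ ?d"
  have E: "E \<ge> 0" unfolding E_def using R_pos B_pos by (intro mult_nonneg_nonneg sum_nonneg) auto
  have Ng: "Ng \<ge> 1" unfolding Ng_def using finite_genders[of "UNIV :: ('d \<Rightarrow> gender) set"] by (simp add: Suc_le_eq card_gt_0_iff)
  \<comment> \<open>The exponent combines the weight of level \<open>j\<close> with the growth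
    2^(jd) of the coefficients; it is negative by the hypothesis on \<tau>.\<close>
  define \<rho> where "\<rho> = 2 powr (\<tau> - real ?d * recip p + real ?d)"
  have \<rho>: "0 < \<rho>" "\<rho> < 1" unfolding \<rho>_def using \<tau> by (auto simp: powr_less_one algebra_simps)
  \<comment> \<open>This collects the factors independent of \<open>j\<close>, including the growth
    caused by the base level \<open>L\<close>.\<close>
  define D where "D = Ng powr recip q * (N powr recip p * E) * (2 ^ L) ^ ?d"
  have inner: "lp_norm p (positions L j) (\<lambda>m. ennreal (norm (complex_of_real (dirac_coeff L n t x j G m))))
      \<le> ennreal (N powr recip p * (E * (2 ^ (j + L)) ^ ?d))" for j G
  proof (rule lp_norm_le_sparse[OF p finite_positions])
    have "{i \<in> positions L j. ennreal (norm (complex_of_real (dirac_coeff L n t x j G i))) \<noteq> 0} = 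
      {i \<in> positions L j. dirac_coeff L n t x j G i \<noteq> 0}" by (auto simp: ennreal_eq_0_iff)
    then show "real (card {i \<in> positions L j. ennreal (norm (complex_of_real (dirac_coeff L n t x j G i))) \<noteq> 0}) \<le> N"
      unfolding N_def using card_dirac_coeff_nonzero[of L j n t x G] by auto
    show "ennreal (norm (complex_of_real (dirac_coeff L n t x j G m))) \<le> ennreal (E * (2 ^ (j + L)) ^ ?d)"
      if "m \<in> positions L j" for m
      using dirac_coeff_bound[OF that, of n t x G] unfolding E_def by (intro ennreal_leI) simp
  qed (use E in \<open>auto simp: N_def\<close>)
  have outer: "lp_norm q (genders j) (\<lambda>G. lp_norm p (positions L j) (\<lambda>m. ennreal (norm (complex_of_real (dirac_coeff L n t x j G m)))))
      \<le> ennreal (Ng powr recip q * (N powr recip p * (E * (2 ^ (j + L)) ^ ?d)))" for j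
  proof (rule lp_norm_le_sparse[OF q finite_genders _ Ng _ inner])
    show "real (card {G \<in> genders j. lp_norm p (positions L j) (\<lambda>m. ennreal (norm (complex_of_real (dirac_coeff L n t x j G m)))) \<noteq> 0}) \<le> Ng"
      unfolding Ng_def by (simp add: card_mono finite_genders)
  qed (use E in auto)
  show ?thesis
    unfolding besov_seq_norm_def
  proof (rule lp_norm_geometric_finite[OF q _ \<rho>])
    show "D \<ge> 0" unfolding D_def using E by simp
    fix j
    have "2 powr (real j * (\<tau> - real ?d * recip p)) * (2 ^ j) ^ ?d = \<rho> ^ j"
    proof -
      have "(2 ^ j) ^ ?d = (2 :: real) powr (real j * real ?d)"
        by (simp add: powr_realpow flip: power_mult of_nat_mult)
      then show ?thesis unfolding \<rho>_def by (simp add: powr_power algebra_simps flip: powr_add)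
    qed
    then have "D * \<rho> ^ j = 2 powr (real j * (\<tau> - real ?d * recip p)) * 
        (Ng powr recip q * (N powr recip p * (E * (2 ^ (j + L)) ^ ?d)))"
      unfolding D_def by (simp add: power_add power_mult_distrib)
    moreover have "ennreal (2 powr (real j * (\<tau> - real ?d * recip p))) *
         lp_norm q (genders j) (\<lambda>G. lp_norm p (positions L j) (\<lambda>m. ennreal (norm (complex_of_real (dirac_coeff L n t x j G m)))))
      \<le> ennreal (2 powr (real j * (\<tau> - real ?d * recip p))) * ennreal (Ng powr recip q * (N powr recip p * (E * (2 ^ (j + L)) ^ ?d)))"
      by (intro mult_left_mono outer) simp
    ultimately show "ennreal (2 powr (real j * (\<tau> - real ?d * recip p))) *
         lp_norm q (genders j) (\<lambda>G. lp_norm p (positions L j) (\<lambda>m. ennreal (norm (complex_of_real (dirac_coeff L n t x j G m)))))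
         \<le> ennreal (D * \<rho> ^ j)"
      by (simp add: ennreal_mult')
  qed
qed

text \<open>For each atom the paired terms are those of the pointwise wavelet series of \<phi> at
  that atom, since the two normalizing powers of 2 cancel. Finitely many such series are
  added.\<close>

lemma wavelet_expansion_dirac_coeff:
  fixes x :: "nat \<Rightarrow> real ^ 'd::finite"
  assumes f: "\<And>\<phi>. \<phi> \<in> test_functions \<Longrightarrow> f \<phi> = (\<Sum>k<n. t k * \<phi> (x k))"
  shows "wavelet_expansion \<psi> L (\<lambda>j G m. complex_of_real (dirac_coeff L n t x j G m)) f"
  unfolding wavelet_expansion_def
proof
  fix \<phi> :: "real ^ 'd \<Rightarrow> real" assume \<phi>: "\<phi> \<in> test_functions"
  let ?T = "{(j, G, m). G \<in> genders j \<and> m \<in> positions L j} :: (nat \<times> ('d \<Rightarrow> gender) \<times> (int ^ 'd)) set"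
  define g where "g x = (\<lambda>(j, G, m). wavelet_per \<psi> L j G m x * (\<integral>y. wavelet_per \<psi> L j G m y * \<phi> y \<partial>torus_measure))" for x
  have "((\<lambda>i. \<Sum>k<n. t k * g (x k) i) has_sum (\<Sum>k<n. t k * \<phi> (x k))) ?T"
  proof (induction n)
    case (Suc n)
    have "(g (x n) has_sum \<phi> (x n)) ?T" unfolding g_def by (rule pointwise_wavelet_expansion[OF \<phi>])
    from has_sum_add[OF Suc has_sum_cmult_right[OF this, of "t n"]] show ?case by simp
  qed simp
  then have "((\<lambda>i. complex_of_real (\<Sum>k<n. t k * g (x k) i)) has_sum complex_of_real (f \<phi>)) ?T"
    unfolding f[OF \<phi>] by (rule has_sum_of_real)
  moreover have "complex_of_real (\<Sum>k<n. t k * g (x k) (j, G, m)) = 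
     complex_of_real (dirac_coeff L n t x j G m) * of_real (2 powr (- (real (j + L) * real CARD('d) / 2)) *
            (\<integral>x. wavelet_per \<psi> L j G m x * \<phi> x \<partial>torus_measure))" for j G m
  proof -
    have "(\<Sum>k<n. t k * g (x k) (j, G, m)) = 
      (\<Sum>k<n. t k * wavelet_per \<psi> L j G m (x k)) * (\<integral>y. wavelet_per \<psi> L j G m y * \<phi> y \<partial>torus_measure)"
      unfolding g_def by (simp add: sum_distrib_right mult.assoc)
    also have "\<dots> = dirac_coeff L n t x j G m * (2 powr (- (real (j + L) * real CARD('d) / 2)) *
            (\<integral>x. wavelet_per \<psi> L j G m x * \<phi> x \<partial>torus_measure))"
      unfolding dirac_coeff_def by (simp add: powr_minus)
    finally show ?thesis by (simp only: of_real_mult)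
  qed
  ultimately show "((\<lambda>(j, G, m). complex_of_real (dirac_coeff L n t x j G m) * of_real (2 powr (- (real (j + L) * real CARD('d) / 2)) *
            (\<integral>x. wavelet_per \<psi> L j G m x * \<phi> x \<partial>torus_measure)))
         has_sum of_real (f \<phi>)) ?T"
    by (elim has_sum_cong[THEN iffD1, rotated]) auto
qed

end

lemma dirac_comb_in_besov_space:
  fixes f :: "(real ^ 'd::finite \<Rightarrow> real) \<Rightarrow> real" and n :: nat
  assumes "f \<in> gen_functions" and f: "\<And>\<phi>. \<phi> \<in> test_functions \<Longrightarrow> f \<phi> = (\<Sum>k<n. t k * \<phi> (x k))"
    and "0 < p" "0 < q" "\<tau> < real CARD('d) * (recip p - 1)"
  shows "f \<in> besov_space \<tau> p q"
proof -
  have "\<exists>c. besov_seq_norm L \<tau> p q c < \<infinity> \<and> wavelet_expansion \<psi> L c f"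
    if ws: "wavelet_system u \<psi>" and u: "real u > max \<tau> (real CARD('d) * max (recip p - 1) 0 - \<tau>)" for u \<psi> L
  proof -
    \<comment> \<open>The regularity threshold is at least the absolute value of \<tau>, hence
      nonnegative, and \<open>u\<close> exceeds it strictly.\<close>
    have "u \<noteq> 0"
    proof
      assume "u = 0"
      moreover have "real CARD('d) * max (recip p - 1) 0 \<ge> 0" by simp
      ultimately show False using u by linarith
    qed
    then have "u \<ge> 1" by simp
    with ws obtain R B where "wavelet_1d \<psi> R B" by (rule wavelet_system_imp_wavelet_1d)
    then interpret wavelet_1d \<psi> R B .
    have "wavelet_expansion \<psi> L (\<lambda>j G m. complex_of_real (dirac_coeff L n t x j G m)) f"
      by (rule wavelet_expansion_dirac_coeff) (rule f)
    with besov_seq_norm_dirac_coeff[OF assms(3-5)] show ?thesis by (intro exI conjI)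
  qed
  then show ?thesis unfolding besov_space_def using assms(1) by blast
qed

theorem proposition5:
  fixes M :: "'w measure"
    and w :: "'w \<Rightarrow> (real ^ 'd::finite \<Rightarrow> real) \<Rightarrow> real"
    and \<tau> :: real and p q :: ereal
  assumes "compound_poisson_noise M w"
    and "0 < p" and "0 < q"
    and "\<tau> < real CARD('d) * (recip p - 1)"
  shows "AE \<omega> in M. w \<omega> \<in> besov_space \<tau> p q"
  using compound_poisson_noise_dirac_comb[OF assms(1)]
proof eventually_elim
  case (elim \<omega>)
  then obtain n t x where "\<forall>f\<in>test_functions. w \<omega> f = (\<Sum>k<n::nat. t k * f (x k))" by blast
  then show ?case using elim assms by (intro dirac_comb_in_besov_space[where n=n and t=t and x=x]) auto
qed

end
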